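(* Let $M$ be a finite-dimensional smooth manifold, let $T>0$, let $H:[0,T]\times T^*M\to\mathbb{R}$ be smooth, let $q_0\in M$, and let $p_1:M\to T^*M$ be a smooth section of the cotangent bundle (so $p_1(q)\in T_q^*M$). Let $(q,p)\in C^1_{q_0}([0,T],T^*M)$, i.e. a $C^1$ curve in $T^*M$ with base curve $q$ satisfying $q(0)=q_0$. If the free boundary Type II d'Alembert variational principle $$\delta S[q,p]=\langle p_1(q(T)),\delta q(T)\rangle\quad\text{for all partial variations }(\delta q,\delta p)\text{ of }(q,p)$$ holds, then, in canonical cotangent bundle coordinates, $$\dot q(t)=D_pH(t,q,p)\quad\text{for all }t\in(0,T),$$ $$\dot p(t)=-D_qH(t,q,p)\quad\text{for all }t\in(0,T),$$ $$q(0)=q_0,\qquad p(T)=p_1(q(T)).$$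
   Context: $\langle\cdot,\cdot\rangle:T_q^*M\times T_qM\to\mathbb{R}$ is the duality pairing, $\pi_{T^*M}:T^*M\to M$ is the cotangent bundle projection, and $(q,p)$ denotes both canonical (cotangent) coordinates on $T^*M$ and a curve in $T^*M$ with base curve $q$. No regularity (non-degeneracy) of $H$ in $p$ is assumed. The space of curves is $C^1_{q_0}([0,T],T^*M)=\{z\in C^1([0,T],T^*M):\pi_{T^*M}(z(0))=q_0\}$. The action on this space is $$S[q,p]=\int_0^T\big[\langle p(t),\dot q(t)\rangle-H(t,q(t),p(t))\big]\,dt.$$ A partial variation of a curve $z=(q,p)$ is a tangent vector at $z$ to this space of curves, i.e. a $C^1$ map $X:[0,T]\to TT^*M$ with $X(t)\in T_{z(t)}T^*M$ for all $t$ and $T\pi_{T^*M}(X(0))=0$. In bundle coordinates $X=(q,p,\delta q,\delta p)$, the last condition reads $\delta q(0)=0$ (no condition is imposed on $\delta q(T)$ or $\delta p$); intrinsically $\delta q(t)=T\pi_{T^*M}(X(t))\in T_{q(t)}M$. The variation of the action is $\delta S[q,p]=\frac{d}{d\epsilon}\big|_{\epsilon=0}S[q_\epsilon,p_\epsilon]$, where $(q_\epsilon,p_\epsilon)$ is a one-parameter family of curves in $C^1_{q_0}([0,T],T^*M)$ equal to $(q,p)$ at $\epsilon=0$ and with derivative $X$ at $\epsilon=0$. *)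

theory Defs
  imports "HOL-Analysis.Analysis"
begin

subsection \<open>Smooth functions on subsets of normed spaces\<close>

text \<open>Intended for open \<open>S\<close> in a finite-dimensional space.\<close>

primrec Ck_on :: "nat \<Rightarrow> 'a::real_normed_vector set \<Rightarrow> ('a \<Rightarrow> 'b::real_normed_vector) \<Rightarrow> bool" where
  "Ck_on 0 S f \<longleftrightarrow> continuous_on S f"
| "Ck_on (Suc k) S f \<longleftrightarrow>
     (\<forall>x\<in>S. f differentiable (at x)) \<and>
     (\<forall>v. Ck_on k S (\<lambda>x. frechet_derivative f (at x) v))"

text \<open>On a set that need not be open (such as a product with \<open>[0,T]\<close>), smoothness means local
  extendability to a smooth function.\<close>

definition smooth_on :: "'a::real_normed_vector set \<Rightarrow> ('a \<Rightarrow> 'b::real_normed_vector) \<Rightarrow> bool" where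
  "smooth_on S f \<longleftrightarrow>
     (\<forall>x\<in>S. \<exists>W g. open W \<and> x \<in> W \<and> (\<forall>k. Ck_on k W g) \<and> (\<forall>y\<in>S \<inter> W. g y = f y))"

text \<open>\<open>f\<close> is \<open>C\<^sup>1\<close> on the relatively open subset \<open>S\<close> of the interval \<open>J\<close> (one-sided derivatives
  at end points of \<open>J\<close>).\<close>

definition C1_on :: "real set \<Rightarrow> real set \<Rightarrow> (real \<Rightarrow> 'a::real_normed_vector) \<Rightarrow> bool" where
  "C1_on J S f \<longleftrightarrow>
     (\<exists>D. continuous_on S D \<and> (\<forall>t\<in>S. (f has_vector_derivative D t) (at t within J)))"


subsection \<open>Manifolds\<close>

text \<open>A chart is its domain together with its coordinate map, whose values outside the domain are
  irrelevant. A manifold is given by an atlas, not necessarily maximal; its point set is the union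
  of the chart domains and its topology is the one generated by the charts.\<close>

type_synonym ('m, 'a) chart = "'m set \<times> ('m \<Rightarrow> 'a)"

definition chart_inv :: "('m, 'a) chart \<Rightarrow> 'a \<Rightarrow> 'm" where
  "chart_inv c = inv_into (fst c) (snd c)"

definition carrier_of :: "('m, 'a) chart set \<Rightarrow> 'm set" where
  "carrier_of A = (\<Union>c\<in>A. fst c)"

definition atlas_topology :: "('m, 'a::topological_space) chart set \<Rightarrow> 'm topology" where
  "atlas_topology A = topology_generated_by {fst c \<inter> snd c -` W | c W. c \<in> A \<and> open W}"

text \<open>The model space is \<open>\<real>\<^sup>n\<close>, presented as an inner product space with an orthonormal basis
  \<open>E\<close>, \<open>n = card E\<close>; the coordinates of \<open>q\<close> in a chart \<open>c\<close> are \<open>snd c q \<bullet> e\<close> for \<open>e \<in> E\<close>. The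
  class \<open>euclidean_space\<close> with \<open>E = Basis\<close> is an instance, but would exclude \<open>n = 0\<close>.\<close>

definition smooth_manifold :: "'a::real_inner set \<Rightarrow> ('m, 'a) chart set \<Rightarrow> bool" where
  "smooth_manifold E A \<longleftrightarrow>
     finite E \<and> pairwise orthogonal E \<and> (\<forall>e\<in>E. norm e = 1) \<and> span E = UNIV \<and>
     (\<forall>c\<in>A. inj_on (snd c) (fst c)) \<and>
     (\<forall>c\<in>A. \<forall>d\<in>A. open (snd c ` (fst c \<inter> fst d)) \<and>
        smooth_on (snd c ` (fst c \<inter> fst d)) (snd d \<circ> chart_inv c)) \<and>
     Hausdorff_space (atlas_topology A) \<and> second_countable (atlas_topology A)"

definition smooth_map ::
  "('m, 'a::real_normed_vector) chart set \<Rightarrow> ('n, 'b::real_normed_vector) chart set \<Rightarrow> ('m \<Rightarrow> 'n) \<Rightarrow> bool"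
  where
  "smooth_map A B f \<longleftrightarrow>
     continuous_map (atlas_topology A) (atlas_topology B) f \<and>
     (\<forall>c\<in>A. \<forall>d\<in>B. smooth_on (snd c ` (fst c \<inter> f -` fst d)) (snd d \<circ> f \<circ> chart_inv c))"

definition smooth_time_dependent ::
  "real set \<Rightarrow> ('m, 'a::real_normed_vector) chart set \<Rightarrow> (real \<Rightarrow> 'm \<Rightarrow> real) \<Rightarrow> bool" where
  "smooth_time_dependent J A f \<longleftrightarrow>
     (\<forall>c\<in>A. smooth_on (J \<times> snd c ` fst c) (\<lambda>(t, y). f t (chart_inv c y)))"

definition C1_curve ::
  "('m, 'a::real_normed_vector) chart set \<Rightarrow> real set \<Rightarrow> (real \<Rightarrow> 'm) \<Rightarrow> bool" where
  "C1_curve A J \<gamma> \<longleftrightarrow>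
     continuous_map (top_of_set J) (atlas_topology A) \<gamma> \<and>
     (\<forall>c\<in>A. C1_on J {t\<in>J. \<gamma> t \<in> fst c} (snd c \<circ> \<gamma>))"

text \<open>A family \<open>\<epsilon> \<mapsto> Z \<epsilon>\<close> (\<open>\<epsilon>\<close> in the open interval \<open>I\<close>) that is \<open>C\<^sup>1\<close> as a curve in the manifold
  of \<open>C\<^sup>1\<close> curves \<open>J \<rightarrow> M\<close> with the \<open>C\<^sup>1\<close> topology: in charts, \<open>Z\<close>, \<open>Zt = \<partial>\<^sub>t Z\<close>, \<open>Ze = \<partial>\<^sub>\<epsilon> Z\<close> and
  \<open>Zet = \<partial>\<^sub>\<epsilon> \<partial>\<^sub>t Z\<close> exist and are jointly continuous.\<close>

definition C1_family ::
  "('m, 'a::real_normed_vector) chart set \<Rightarrow> real set \<Rightarrow> real set \<Rightarrow> (real \<Rightarrow> real \<Rightarrow> 'm) \<Rightarrow> bool" where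
  "C1_family A I J Z \<longleftrightarrow>
     continuous_map (top_of_set (I \<times> J)) (atlas_topology A) (\<lambda>(\<epsilon>, t). Z \<epsilon> t) \<and>
     (\<forall>c\<in>A. \<exists>Zt Ze Zet.
        continuous_on {(\<epsilon>, t) \<in> I \<times> J. Z \<epsilon> t \<in> fst c} (\<lambda>(\<epsilon>, t). Zt \<epsilon> t) \<and>
        continuous_on {(\<epsilon>, t) \<in> I \<times> J. Z \<epsilon> t \<in> fst c} (\<lambda>(\<epsilon>, t). Ze \<epsilon> t) \<and>
        continuous_on {(\<epsilon>, t) \<in> I \<times> J. Z \<epsilon> t \<in> fst c} (\<lambda>(\<epsilon>, t). Zet \<epsilon> t) \<and>
        (\<forall>\<epsilon>\<in>I. \<forall>t\<in>J. Z \<epsilon> t \<in> fst c \<longrightarrow>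
           ((\<lambda>s. snd c (Z \<epsilon> s)) has_vector_derivative Zt \<epsilon> t) (at t within J) \<and>
           ((\<lambda>\<eta>. snd c (Z \<eta> t)) has_vector_derivative Ze \<epsilon> t) (at \<epsilon>) \<and>
           ((\<lambda>\<eta>. Zt \<eta> t) has_vector_derivative Zet \<epsilon> t) (at \<epsilon>)))"


subsection \<open>Tangent bundle\<close>

text \<open>A tangent vector at \<open>x\<close> is the family of its coordinate representatives in the charts at
  \<open>x\<close>, which transform by the derivatives of the transition maps (and are set to \<open>0\<close> for all other
  charts). Linear operations are pointwise.\<close>

type_synonym ('m, 'a) tvec = "('m, 'a) chart \<Rightarrow> 'a"

definition tangent_space ::
  "('m, 'a::real_normed_vector) chart set \<Rightarrow> 'm \<Rightarrow> ('m, 'a) tvec set" where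
  "tangent_space A x =
     {v. (\<forall>c. \<not> (c \<in> A \<and> x \<in> fst c) \<longrightarrow> v c = 0) \<and>
         (\<forall>c\<in>A. \<forall>d\<in>A. x \<in> fst c \<inter> fst d \<longrightarrow>
            v d = frechet_derivative (snd d \<circ> chart_inv c) (at (snd c x)) (v c))}"

text \<open>The tangent vector at \<open>x\<close> with representative \<open>w\<close> in the chart \<open>c\<close>; for a basis vector
  \<open>w = e\<close> this is the coordinate vector \<open>\<partial>/\<partial>q\<^sup>e\<close> of \<open>c\<close>.\<close>

definition chart_vector ::
  "('m, 'a::real_normed_vector) chart set \<Rightarrow> ('m, 'a) chart \<Rightarrow> 'm \<Rightarrow> 'a \<Rightarrow> ('m, 'a) tvec" where
  "chart_vector A c x w =
     (\<lambda>d. if d \<in> A \<and> x \<in> fst d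
          then frechet_derivative (snd d \<circ> chart_inv c) (at (snd c x)) w else 0)"

text \<open>Elements of the bundles are pairs of a base point and a (co)vector at it.\<close>

definition tangent_chart ::
  "('m, 'a::real_normed_vector) chart set \<Rightarrow> ('m, 'a) chart \<Rightarrow> ('m \<times> ('m, 'a) tvec, 'a \<times> 'a) chart"
  where
  "tangent_chart A c =
     ({(x, v). x \<in> fst c \<and> v \<in> tangent_space A x}, \<lambda>(x, v). (snd c x, v c))"

definition tangent_atlas ::
  "('m, 'a::real_normed_vector) chart set \<Rightarrow> ('m \<times> ('m, 'a) tvec, 'a \<times> 'a) chart set" where
  "tangent_atlas A = tangent_chart A ` A"

text \<open>The velocity \<open>\<gamma>'(t) \<in> TM\<close> (one-sided if \<open>t\<close> is an end point of \<open>J\<close>).\<close>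

definition velocity ::
  "('m, 'a::real_normed_vector) chart set \<Rightarrow> real set \<Rightarrow> (real \<Rightarrow> 'm) \<Rightarrow> real \<Rightarrow> 'm \<times> ('m, 'a) tvec"
  where
  "velocity A J \<gamma> t =
     (\<gamma> t, \<lambda>c. if c \<in> A \<and> \<gamma> t \<in> fst c
               then vector_derivative (snd c \<circ> \<gamma>) (at t within J) else 0)"

text \<open>The tangent map of \<open>f\<close>, computed in some chart at the base point (for tangent vectors the
  choice does not matter).\<close>

definition tangent_map ::
  "('m, 'a::real_normed_vector) chart set \<Rightarrow> ('n, 'b::real_normed_vector) chart set \<Rightarrow>
   ('m \<Rightarrow> 'n) \<Rightarrow> 'm \<times> ('m, 'a) tvec \<Rightarrow> 'n \<times> ('n, 'b) tvec" where
  "tangent_map A B f = (\<lambda>(x, v).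
     (f x, \<lambda>d. if d \<in> B \<and> f x \<in> fst d
               then (let c = (SOME c. c \<in> A \<and> x \<in> fst c)
                     in frechet_derivative (snd d \<circ> f \<circ> chart_inv c) (at (snd c x)) (v c))
               else 0))"


subsection \<open>Cotangent bundle\<close>

text \<open>Covectors at \<open>x\<close> are the linear functionals on the tangent space at \<open>x\<close>, extended by \<open>0\<close> to
  the ambient type.\<close>

type_synonym ('m, 'a) covec = "('m, 'a) tvec \<Rightarrow> real"

definition cotangent_space ::
  "('m, 'a::real_normed_vector) chart set \<Rightarrow> 'm \<Rightarrow> ('m, 'a) covec set" where
  "cotangent_space A x =
     {\<alpha>. (\<forall>v. v \<notin> tangent_space A x \<longrightarrow> \<alpha> v = 0) \<and>
         (\<forall>u\<in>tangent_space A x. \<forall>v\<in>tangent_space A x. \<alpha> (\<lambda>c. u c + v c) = \<alpha> u + \<alpha> v) \<and>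
         (\<forall>r. \<forall>v\<in>tangent_space A x. \<alpha> (\<lambda>c. r *\<^sub>R v c) = r * \<alpha> v)}"

text \<open>Canonical coordinates \<open>(q,p)\<close>: the components of \<open>p\<close> are \<open>p\<^sub>e = \<langle>p, \<partial>/\<partial>q\<^sup>e\<rangle>\<close>.\<close>

definition cotangent_chart ::
  "'a::real_inner set \<Rightarrow> ('m, 'a) chart set \<Rightarrow> ('m, 'a) chart \<Rightarrow> ('m \<times> ('m, 'a) covec, 'a \<times> 'a) chart"
  where
  "cotangent_chart E A c =
     ({(x, \<alpha>). x \<in> fst c \<and> \<alpha> \<in> cotangent_space A x},
      \<lambda>(x, \<alpha>). (snd c x, \<Sum>e\<in>E. \<alpha> (chart_vector A c x e) *\<^sub>R e))"

definition cotangent_atlas ::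
  "'a::real_inner set \<Rightarrow> ('m, 'a) chart set \<Rightarrow> ('m \<times> ('m, 'a) covec, 'a \<times> 'a) chart set" where
  "cotangent_atlas E A = cotangent_chart E A ` A"

definition pairing :: "'m \<times> ('m, 'a) covec \<Rightarrow> 'm \<times> ('m, 'a) tvec \<Rightarrow> real" where
  "pairing \<alpha> v = snd \<alpha> (snd v)"

definition smooth_covector_field ::
  "'a::real_inner set \<Rightarrow> ('m, 'a) chart set \<Rightarrow> ('m \<Rightarrow> 'm \<times> ('m, 'a) covec) \<Rightarrow> bool" where
  "smooth_covector_field E A \<omega> \<longleftrightarrow>
     smooth_map A (cotangent_atlas E A) \<omega> \<and> (\<forall>q\<in>carrier_of A. fst (\<omega> q) = q)"


subsection \<open>The action and its variations\<close>

definition C1_curves_from ::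
  "'a::real_inner set \<Rightarrow> ('m, 'a) chart set \<Rightarrow> real \<Rightarrow> 'm \<Rightarrow> (real \<Rightarrow> 'm \<times> ('m, 'a) covec) set" where
  "C1_curves_from E A T q0 = {z. C1_curve (cotangent_atlas E A) {0..T} z \<and> fst (z 0) = q0}"

definition action ::
  "('m, 'a::real_inner) chart set \<Rightarrow> real \<Rightarrow> (real \<Rightarrow> 'm \<times> ('m, 'a) covec \<Rightarrow> real) \<Rightarrow>
   (real \<Rightarrow> 'm \<times> ('m, 'a) covec) \<Rightarrow> real" where
  "action A T H z =
     integral {0..T} (\<lambda>t. pairing (z t) (velocity A {0..T} (fst \<circ> z) t) - H t (z t))"

definition delta_q ::
  "'a::real_inner set \<Rightarrow> ('m, 'a) chart set \<Rightarrow>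
   ('m \<times> ('m, 'a) covec) \<times> ('m \<times> ('m, 'a) covec, 'a \<times> 'a) tvec \<Rightarrow> 'm \<times> ('m, 'a) tvec" where
  "delta_q E A = tangent_map (cotangent_atlas E A) A fst"

definition partial_variation ::
  "'a::real_inner set \<Rightarrow> ('m, 'a) chart set \<Rightarrow> real \<Rightarrow> (real \<Rightarrow> 'm \<times> ('m, 'a) covec) \<Rightarrow>
   (real \<Rightarrow> ('m \<times> ('m, 'a) covec) \<times> ('m \<times> ('m, 'a) covec, 'a \<times> 'a) tvec) \<Rightarrow> bool" where
  "partial_variation E A T z X \<longleftrightarrow>
     C1_curve (tangent_atlas (cotangent_atlas E A)) {0..T} X \<and>
     (\<forall>t\<in>{0..T}. fst (X t) = z t) \<and>
     snd (delta_q E A (X 0)) = (\<lambda>_. 0)"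

text \<open>\<open>Z\<close> is a one-parameter family of curves from \<open>q0\<close> with \<open>Z 0 = z\<close> and derivative \<open>X\<close> at \<open>0\<close>.\<close>

definition variation_family ::
  "'a::real_inner set \<Rightarrow> ('m, 'a) chart set \<Rightarrow> real \<Rightarrow> 'm \<Rightarrow> (real \<Rightarrow> 'm \<times> ('m, 'a) covec) \<Rightarrow>
   (real \<Rightarrow> ('m \<times> ('m, 'a) covec) \<times> ('m \<times> ('m, 'a) covec, 'a \<times> 'a) tvec) \<Rightarrow>
   (real \<Rightarrow> real \<Rightarrow> 'm \<times> ('m, 'a) covec) \<Rightarrow> bool" where
  "variation_family E A T q0 z X Z \<longleftrightarrow>
     (\<exists>r>0. C1_family (cotangent_atlas E A) {-r<..<r} {0..T} Z \<and>
        (\<forall>\<epsilon>\<in>{-r<..<r}. Z \<epsilon> \<in> C1_curves_from E A T q0)) \<and>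
     (\<forall>t\<in>{0..T}. Z 0 t = z t \<and> velocity (cotangent_atlas E A) UNIV (\<lambda>\<epsilon>. Z \<epsilon> t) 0 = X t)"

text \<open>\<open>\<delta>S[z](X) = d\<close>. The derivative depends only on \<open>X\<close>, so it is required along every family
  realizing \<open>X\<close>.\<close>

definition has_action_variation ::
  "'a::real_inner set \<Rightarrow> ('m, 'a) chart set \<Rightarrow> real \<Rightarrow> (real \<Rightarrow> 'm \<times> ('m, 'a) covec \<Rightarrow> real) \<Rightarrow> 'm \<Rightarrow>
   (real \<Rightarrow> 'm \<times> ('m, 'a) covec) \<Rightarrow>
   (real \<Rightarrow> ('m \<times> ('m, 'a) covec) \<times> ('m \<times> ('m, 'a) covec, 'a \<times> 'a) tvec) \<Rightarrow> real \<Rightarrow> bool" where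
  "has_action_variation E A T H q0 z X d \<longleftrightarrow>
     (\<forall>Z. variation_family E A T q0 z X Z \<longrightarrow>
        ((\<lambda>\<epsilon>. action A T H (Z \<epsilon>)) has_real_derivative d) (at 0))"

definition free_boundary_dAlembert ::
  "'a::real_inner set \<Rightarrow> ('m, 'a) chart set \<Rightarrow> real \<Rightarrow> (real \<Rightarrow> 'm \<times> ('m, 'a) covec \<Rightarrow> real) \<Rightarrow> 'm \<Rightarrow>
   ('m \<Rightarrow> 'm \<times> ('m, 'a) covec) \<Rightarrow> (real \<Rightarrow> 'm \<times> ('m, 'a) covec) \<Rightarrow> bool" where
  "free_boundary_dAlembert E A T H q0 p1 z \<longleftrightarrow>
     (\<forall>X. partial_variation E A T z X \<longrightarrow>
        has_action_variation E A T H q0 z X (pairing (p1 (fst (z T))) (delta_q E A (X T))))"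


subsection \<open>Partial derivatives of the Hamiltonian in canonical coordinates\<close>

definition D_q ::
  "'a::real_inner set \<Rightarrow> ('m, 'a) chart set \<Rightarrow> ('m, 'a) chart \<Rightarrow>
   ('m \<times> ('m, 'a) covec \<Rightarrow> real) \<Rightarrow> 'm \<times> ('m, 'a) covec \<Rightarrow> 'a" where
  "D_q E A c h z = (let k = cotangent_chart E A c; (x, \<xi>) = snd k z in
     \<Sum>e\<in>E. deriv (\<lambda>s. h (chart_inv k (x + s *\<^sub>R e, \<xi>))) 0 *\<^sub>R e)"

definition D_p ::
  "'a::real_inner set \<Rightarrow> ('m, 'a) chart set \<Rightarrow> ('m, 'a) chart \<Rightarrow>
   ('m \<times> ('m, 'a) covec \<Rightarrow> real) \<Rightarrow> 'm \<times> ('m, 'a) covec \<Rightarrow> 'a" where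
  "D_p E A c h z = (let k = cotangent_chart E A c; (x, \<xi>) = snd k z in
     \<Sum>e\<in>E. deriv (\<lambda>s. h (chart_inv k (x, \<xi> + s *\<^sub>R e))) 0 *\<^sub>R e)"

end

theory Submission
  imports Defs
begin

text \<open>Both bundles carry smooth atlases of their own, so a family of curves in \<open>T\<^sup>*M\<close> may be checked in
  one chart around each time. It therefore suffices to vary \<open>z\<close> inside a single canonical chart:
  in coordinates \<open>y = (q, p)\<close>, take \<open>y + \<epsilon> \<phi> w\<close> with a fixed vector \<open>w\<close> and a \<open>C\<^sup>1\<close> bump function \<open>\<phi>\<close>
  vanishing near time \<open>0\<close>, and leave \<open>z\<close> unchanged where \<open>\<phi>\<close> vanishes. Differentiating the action under
  the integral sign and integrating by parts turns the principle into
  \<open>\<integral> \<phi> (\<langle>w\<^sub>p, q' - D\<^sub>p H\<rangle> - \<langle>p' + D\<^sub>q H, w\<^sub>q\<rangle>) dt = \<phi> T \<langle>p\<^sub>1 (q T) - p T, w\<^sub>q\<rangle>\<close>.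
  Bumps inside \<open>(0, T)\<close> give Hamilton's equations; the left-hand side then vanishes for every \<open>\<phi>\<close>, and
  a bump with \<open>\<phi> T \<noteq> 0\<close> gives the terminal condition.\<close>

subsection \<open>Orthonormal bases\<close>

text \<open>The hypothesis speaks only about fields that are \<open>C1_curve\<close> in the tangent
  bundle of the cotangent bundle and about families that are \<open>C1_family\<close> in every chart
  of the cotangent bundle. The main burden is to certify one explicit family globally, although its
  formula lives in one chart. The properties in \<open>smooth_atlas\<close> pass to both bundle
  atlases, so the bundle construction can be iterated. The mixed derivative in \<epsilon> and t is
  what makes a change of chart cost two derivatives of the transition map. Variations need only be
  C^1, so squares of \<open>max 0\<close> suffice as bumps. Their support starts at a positive time;
  this fixes the initial point and gives \<delta>q(0) = 0 at once. The direction \<open>w\<close> is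
  free in both factors: \<open>(0, e)\<close> isolates a component of the velocity equation,
  \<open>(e, 0)\<close> one of the momentum equation. The boundary term sees only
  \<open>fst w\<close>, because the action contains the velocity of q but not that of p.\<close>

definition orthonormal_basis :: "'a::real_inner set \<Rightarrow> bool" where
  "orthonormal_basis E \<longleftrightarrow>
     finite E \<and> pairwise orthogonal E \<and> (\<forall>e\<in>E. norm e = 1) \<and> span E = UNIV"

lemma orthonormal_basis_finite: "orthonormal_basis E \<Longrightarrow> finite E"
  by (simp add: orthonormal_basis_def)

lemma orthonormal_basis_inner:
  assumes "orthonormal_basis E" "e \<in> E" "f \<in> E"
  shows "e \<bullet> f = (if e = f then 1 else 0)"
  using assms unfolding orthonormal_basis_def pairwise_def orthogonal_def
  by (auto simp: norm_eq_1)

text \<open>The remainder \<open>u\<close> is orthogonal to every basis vector, hence to their span.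
  The span is everything, so \<open>u\<close> is orthogonal to itself.\<close>

lemma orthonormal_basis_expansion:
  assumes "orthonormal_basis E"
  shows "(\<Sum>e\<in>E. (v \<bullet> e) *\<^sub>R e) = v"
proof -
  define u where "u = v - (\<Sum>e\<in>E. (v \<bullet> e) *\<^sub>R e)"
  have fin: "finite E" using assms by (rule orthonormal_basis_finite)
  have "orthogonal u f" if f: "f \<in> E" for f
  proof -
    have "(\<Sum>e\<in>E. (v \<bullet> e) * (e \<bullet> f)) = (\<Sum>e\<in>E. if e = f then v \<bullet> e else 0)"
      by (intro sum.cong refl) (simp add: orthonormal_basis_inner[OF assms _ f])
    also have "\<dots> = v \<bullet> f" using fin f by (simp add: sum.delta)
    finally show ?thesis
      by (simp add: orthogonal_def u_def inner_diff_left inner_sum_left)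
  qed
  moreover have "u \<in> span E" using assms by (simp add: orthonormal_basis_def)
  ultimately have "orthogonal u u" using orthogonal_to_span by blast
  hence "u = 0" by (simp add: orthogonal_def)
  thus ?thesis by (simp add: u_def)
qed

lemma linear_orthonormal_expansion:
  assumes "orthonormal_basis E" "linear f"
  shows "f v = (\<Sum>e\<in>E. (v \<bullet> e) *\<^sub>R f e)"
proof -
  have "f v = f (\<Sum>e\<in>E. (v \<bullet> e) *\<^sub>R e)"
    by (simp add: orthonormal_basis_expansion[OF assms(1)])
  also have "\<dots> = (\<Sum>e\<in>E. (v \<bullet> e) *\<^sub>R f e)"
    by (simp add: linear_sum[OF assms(2)] linear_scale[OF assms(2)])
  finally show ?thesis .
qed

text \<open>Bundle charts take values in pairs of model vectors; this is the orthonormal basis over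
  which both bundle atlases are smooth atlases.\<close>

definition prod_basis :: "'a::real_inner set \<Rightarrow> ('a \<times> 'a) set" where
  "prod_basis E = (\<lambda>e. (e, 0)) ` E \<union> (\<lambda>e. (0, e)) ` E"

lemma orthonormal_basis_prod:
  assumes "orthonormal_basis E"
  shows "orthonormal_basis (prod_basis E)"
proof -
  have nz: "e \<noteq> 0" if "e \<in> E" for e
    using assms that by (auto simp: orthonormal_basis_def)
  have "(x, y) \<in> span (prod_basis E)" for x y
  proof -
    have "(\<Sum>e\<in>E. (x \<bullet> e) *\<^sub>R (e, 0)) + (\<Sum>e\<in>E. (y \<bullet> e) *\<^sub>R (0, e)) \<in> span (prod_basis E)"
      by (intro span_add span_sum span_scale span_base) (auto simp: prod_basis_def)
    also have "(\<Sum>e\<in>E. (x \<bullet> e) *\<^sub>R (e, 0::'a)) + (\<Sum>e\<in>E. (y \<bullet> e) *\<^sub>R (0, e)) = (x, y)"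
      using orthonormal_basis_expansion[OF assms]
      by (simp add: prod_eq_iff fst_sum snd_sum)
    finally show ?thesis .
  qed
  moreover have "pairwise orthogonal (prod_basis E)"
    using assms unfolding orthonormal_basis_def pairwise_def prod_basis_def
    by (fastforce simp: orthogonal_def)
  moreover have "\<forall>e\<in>prod_basis E. norm e = 1" "finite (prod_basis E)"
    using assms unfolding orthonormal_basis_def prod_basis_def
    by (auto simp: norm_Pair)
  ultimately show ?thesis unfolding orthonormal_basis_def by auto
qed


subsection \<open>Calculus of \<open>C\<^sup>k\<close> functions\<close>

lemma Ck_on_has_derivative:
  assumes "Ck_on (Suc k) S f" "x \<in> S"
  shows "(f has_derivative frechet_derivative f (at x)) (at x)"
  using assms frechet_derivative_works by auto

lemma Ck_on_subset: "Ck_on k S f \<Longrightarrow> R \<subseteq> S \<Longrightarrow> Ck_on k R f"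
  by (induction k arbitrary: f) (auto intro: continuous_on_subset)

lemma Ck_on_SucD: "Ck_on (Suc k) S f \<Longrightarrow> Ck_on k S f"
proof (induction k arbitrary: f)
  case 0
  thus ?case
    by (auto intro!: continuous_at_imp_continuous_on differentiable_imp_continuous_within)
next
  case (Suc k)
  thus ?case by (metis Ck_on.simps(2))
qed

lemma Ck_on_continuous: "Ck_on k S f \<Longrightarrow> continuous_on S f"
  by (induction k arbitrary: f) (auto dest: Ck_on_SucD simp del: Ck_on.simps(2))

text \<open>Openness matters: agreement on a neighbourhood of each point forces equal Frechet
  derivatives there, which feeds the induction.\<close>

lemma Ck_on_cong:
  assumes "open S" "\<And>x. x \<in> S \<Longrightarrow> f x = g x" "Ck_on k S f"
  shows "Ck_on k S g"
  using assms(2,3)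
proof (induction k arbitrary: f g)
  case 0
  thus ?case by (simp cong: continuous_on_cong)
next
  case (Suc k)
  have d: "(g has_derivative frechet_derivative f (at x)) (at x)" if "x \<in> S" for x
    using Ck_on_has_derivative[OF Suc.prems(2) that] \<open>open S\<close> that Suc.prems(1)
    by (rule has_derivative_transform_within_open)
  have "Ck_on k S (\<lambda>x. frechet_derivative g (at x) v)" for v
    by (rule Suc.IH[of "\<lambda>x. frechet_derivative f (at x) v"])
      (use Suc.prems(2) frechet_derivative_at[OF d] in auto)
  with d show ?case by (auto simp: differentiable_def)
qed

text \<open>\<open>Ck_on\<close> is phrased with the chosen \<open>frechet_derivative\<close>. By
  uniqueness of derivatives any explicit formula may replace it, and the closure rules below all
  enter through this lemma.\<close>

lemma Ck_on_SucI:
  assumes "open S" "\<And>x. x \<in> S \<Longrightarrow> (f has_derivative f' x) (at x)"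
    and "\<And>v. Ck_on k S (\<lambda>x. f' x v)"
  shows "Ck_on (Suc k) S f"
proof -
  have "Ck_on k S (\<lambda>x. frechet_derivative f (at x) v)" for v
    by (rule Ck_on_cong[OF assms(1) _ assms(3)]) (use frechet_derivative_at[OF assms(2)] in auto)
  thus ?thesis using assms(2) by (auto simp: differentiable_def)
qed

lemma Ck_on_local:
  assumes "open S" "\<And>x. x \<in> S \<Longrightarrow> \<exists>W. open W \<and> x \<in> W \<and> Ck_on k W f"
  shows "Ck_on k S f"
  using assms(2)
proof (induction k arbitrary: f)
  case 0
  show ?case
    unfolding Ck_on.simps continuous_on_eq_continuous_at[OF assms(1)]
    using 0 by (metis Ck_on.simps(1) continuous_on_eq_continuous_at)
next
  case (Suc k)
  have "Ck_on k S (\<lambda>x. frechet_derivative f (at x) v)" for v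
    by (rule Suc.IH) (use Suc.prems in fastforce)
  with Suc.prems show ?case by fastforce
qed

text \<open>On an open set a local extension coincides with the function itself near the point, so
  the two notions of smoothness agree there.\<close>

lemma smooth_on_imp_Ck_on:
  assumes "smooth_on S f" "open S"
  shows "Ck_on k S f"
proof (rule Ck_on_local[OF assms(2)])
  fix x assume "x \<in> S"
  then obtain W g where W: "open W" "x \<in> W" "\<forall>k. Ck_on k W g" "\<forall>y\<in>S \<inter> W. g y = f y"
    using assms(1) unfolding smooth_on_def by blast
  have "Ck_on k (S \<inter> W) f"
    by (rule Ck_on_cong[of _ g]) (use W assms(2) in \<open>auto intro: Ck_on_subset\<close>)
  with W \<open>x \<in> S\<close> assms(2) show "\<exists>W. open W \<and> x \<in> W \<and> Ck_on k W f"
    by (intro exI[of _ "S \<inter> W"]) auto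
qed

lemma Ck_on_imp_smooth_on: "(\<And>k. Ck_on k S f) \<Longrightarrow> open S \<Longrightarrow> smooth_on S f"
  unfolding smooth_on_def by blast

lemma smooth_on_imp_continuous_on:
  assumes "smooth_on S f"
  shows "continuous_on S f"
  unfolding continuous_on_eq_continuous_within
proof
  fix x assume "x \<in> S"
  then obtain W g where W: "open W" "x \<in> W" "\<forall>k. Ck_on k W g" "\<forall>y\<in>S \<inter> W. g y = f y"
    using assms(1) unfolding smooth_on_def by blast
  have "continuous_on W g" using W(3) Ck_on_continuous by blast
  hence "continuous_on (S \<inter> W) f"
    using W(4) by (metis continuous_on_cong continuous_on_subset inf_le2)
  hence "continuous (at x within (S \<inter> W)) f"
    using \<open>x \<in> S\<close> W(2) by (auto simp: continuous_on_eq_continuous_within)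
  thus "continuous (at x within S) f"
    using at_within_nhd[of x W "S \<inter> W" S] W(1,2) by auto
qed

lemma Ck_on_const: "open S \<Longrightarrow> Ck_on k S (\<lambda>_. c)"
proof (induction k arbitrary: c)
  case (Suc k)
  show ?case
    by (rule Ck_on_SucI[OF Suc.prems has_derivative_const Suc.IH[OF Suc.prems]])
qed simp

lemma Ck_on_ident: "open S \<Longrightarrow> Ck_on k S (\<lambda>x. x)"
proof (cases k)
  case (Suc j)
  assume "open S"
  thus ?thesis unfolding Suc
    by (intro Ck_on_SucI[of _ _ "\<lambda>_ v. v"]) (auto intro: has_derivative_ident Ck_on_const)
qed simp

lemma Ck_on_add:
  assumes "open S" "Ck_on k S f" "Ck_on k S g"
  shows "Ck_on k S (\<lambda>x. f x + g x)"
  using assms(2,3)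
proof (induction k arbitrary: f g)
  case (Suc k)
  show ?case
  proof (rule Ck_on_SucI[OF assms(1)])
    fix x assume "x \<in> S"
    with Suc.prems show "((\<lambda>x. f x + g x) has_derivative
        (\<lambda>v. frechet_derivative f (at x) v + frechet_derivative g (at x) v)) (at x)"
      by (intro has_derivative_add Ck_on_has_derivative)
  qed (use Suc in auto)
qed (auto intro: continuous_on_add)

lemma (in bounded_linear) Ck_on:
  assumes "open S" "Ck_on k S g"
  shows "Ck_on k S (\<lambda>x. f (g x))"
  using assms(2)
proof (induction k arbitrary: g)
  case 0
  thus ?case by (auto intro: continuous_on)
next
  case (Suc k)
  show ?case
  proof (rule Ck_on_SucI[OF assms(1)])
    fix x assume "x \<in> S"
    with Suc.prems show "((\<lambda>x. f (g x)) has_derivative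
        (\<lambda>v. f (frechet_derivative g (at x) v))) (at x)"
      by (intro has_derivative Ck_on_has_derivative)
  qed (use Suc in auto)
qed

text \<open>In the product rule each summand contains one factor that is differentiated and one that
  is not; the latter is lowered by one order so that the induction hypothesis covers both.\<close>

lemma (in bounded_bilinear) Ck_on:
  assumes "open S" "Ck_on k S f" "Ck_on k S g"
  shows "Ck_on k S (\<lambda>x. prod (f x) (g x))"
  using assms(2,3)
proof (induction k arbitrary: f g)
  case 0
  thus ?case by (auto intro: continuous_on)
next
  case (Suc k)
  show ?case
  proof (rule Ck_on_SucI[OF assms(1)])
    fix x assume "x \<in> S"
    with Suc.prems show "((\<lambda>x. prod (f x) (g x)) has_derivative
        (\<lambda>v. prod (f x) (frechet_derivative g (at x) v) + prod (frechet_derivative f (at x) v) (g x))) (at x)"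
      by (intro FDERIV Ck_on_has_derivative)
  next
    fix v
    show "Ck_on k S (\<lambda>x. prod (f x) (frechet_derivative g (at x) v) + prod (frechet_derivative f (at x) v) (g x))"
      using Suc.prems Ck_on_SucD[OF Suc.prems(1)] Ck_on_SucD[OF Suc.prems(2)]
      by (intro Ck_on_add assms(1) Suc.IH) auto
  qed
qed

lemmas Ck_on_fst = bounded_linear.Ck_on[OF bounded_linear_fst]
lemmas Ck_on_snd = bounded_linear.Ck_on[OF bounded_linear_snd]
lemmas Ck_on_inner = bounded_bilinear.Ck_on[OF bounded_bilinear_inner]
lemmas Ck_on_scaleR = bounded_bilinear.Ck_on[OF bounded_bilinear_scaleR]

lemma Ck_on_sum:
  assumes "open S" "\<And>i. i \<in> F \<Longrightarrow> Ck_on k S (f i)"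
  shows "Ck_on k S (\<lambda>x. \<Sum>i\<in>F. f i x)"
  using assms(2)
  by (induction F rule: infinite_finite_induct) (auto intro: Ck_on_const Ck_on_add assms(1))

lemma Ck_on_Pair:
  assumes "open S" "Ck_on k S f" "Ck_on k S g"
  shows "Ck_on k S (\<lambda>x. (f x, g x))"
proof -
  have "bounded_linear (\<lambda>u::'b. (u, 0::'c))" "bounded_linear (\<lambda>u::'c. (0::'b, u))"
    by (auto intro!: bounded_linear_Pair bounded_linear_zero bounded_linear_ident)
  from Ck_on_add[OF assms(1) bounded_linear.Ck_on[OF this(1) assms(1,2)]
      bounded_linear.Ck_on[OF this(2) assms(1,3)]]
  show ?thesis by simp
qed

text \<open>The chain rule evaluates the derivative of \<open>g\<close> in a direction that depends
  on \<open>x\<close>, whereas \<open>Ck_on\<close> controls fixed directions only. Expanding that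
  direction in the finite basis leaves scalar coefficients times derivatives of \<open>g\<close>
  along fixed basis vectors, to which the induction hypothesis applies.\<close>

lemma Ck_on_compose:
  fixes E :: "'b::real_inner set" and f :: "'a::real_normed_vector \<Rightarrow> 'b"
  assumes E: "orthonormal_basis E" and S: "open S" and f: "Ck_on k S f"
    and g: "Ck_on k R g" and sub: "\<And>x. x \<in> S \<Longrightarrow> f x \<in> R"
  shows "Ck_on k S (\<lambda>x. g (f x))"
  using f g
proof (induction k arbitrary: g)
  case 0
  thus ?case using sub by (auto intro: continuous_on_compose2)
next
  case (Suc k)
  have fk: "Ck_on k S f" by (rule Ck_on_SucD[OF Suc.prems(1)])
  have gd: "(g has_derivative frechet_derivative g (at (f x))) (at (f x))" if "x \<in> S" for x
    by (rule Ck_on_has_derivative[OF Suc.prems(2) sub[OF that]])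
  show ?case
  proof (rule Ck_on_SucI[OF S])
    fix x assume x: "x \<in> S"
    show "((\<lambda>x. g (f x)) has_derivative
        (\<lambda>v. \<Sum>e\<in>E. (frechet_derivative f (at x) v \<bullet> e) *\<^sub>R frechet_derivative g (at (f x)) e)) (at x)"
      using has_derivative_compose[OF Ck_on_has_derivative[OF Suc.prems(1) x] gd[OF x]]
      by (simp flip: linear_orthonormal_expansion[OF E has_derivative_linear[OF gd[OF x]]])
  next
    fix v
    show "Ck_on k S (\<lambda>x. \<Sum>e\<in>E. (frechet_derivative f (at x) v \<bullet> e) *\<^sub>R frechet_derivative g (at (f x)) e)"
      using Suc.prems by (intro Ck_on_sum Ck_on_scaleR Ck_on_inner Ck_on_const S Suc.IH fk) auto
  qed
qed

text \<open>Joint regularity in point and direction, again by expanding the direction in the basis.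
  This is what makes the fibre part of a bundle transition map smooth.\<close>

lemma Ck_on_frechet_derivative:
  fixes E :: "'a::real_inner set" and f :: "'a \<Rightarrow> 'b::real_normed_vector"
  assumes E: "orthonormal_basis E" and S: "open S" and f: "Ck_on (Suc k) S f"
  shows "Ck_on k (S \<times> UNIV) (\<lambda>p. frechet_derivative f (at (fst p)) (snd p))"
proof -
  have o: "open (S \<times> (UNIV :: 'a set))" using S by (simp add: open_Times)
  have "Ck_on k (S \<times> UNIV) (\<lambda>p. \<Sum>e\<in>E. (snd p \<bullet> e) *\<^sub>R frechet_derivative f (at (fst p)) e)"
    using f by (intro Ck_on_sum Ck_on_scaleR Ck_on_inner Ck_on_const Ck_on_snd Ck_on_ident o
        Ck_on_compose[OF E o Ck_on_fst]) auto
  thus ?thesis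
    by (rule Ck_on_cong[OF o, rotated])
      (auto simp flip: linear_orthonormal_expansion[OF E
          has_derivative_linear[OF Ck_on_has_derivative[OF f]]])
qed

subsection \<open>Atlases and their tangent and cotangent atlases\<close>

lemma chart_inv_snd: "inj_on (snd c) (fst c) \<Longrightarrow> x \<in> fst c \<Longrightarrow> chart_inv c (snd c x) = x"
  by (simp add: chart_inv_def)

lemma chart_inv_mem: "y \<in> snd c ` fst c \<Longrightarrow> chart_inv c y \<in> fst c"
  by (simp add: chart_inv_def inv_into_into)

lemma snd_chart_inv: "y \<in> snd c ` fst c \<Longrightarrow> snd c (chart_inv c y) = y"
  by (simp add: chart_inv_def f_inv_into_f)

abbreviation transition :: "('m, 'a) chart \<Rightarrow> ('m, 'a) chart \<Rightarrow> 'a \<Rightarrow> 'a" where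
  "transition c d \<equiv> snd d \<circ> chart_inv c"

abbreviation transition_deriv ::
  "('m, 'a::real_normed_vector) chart \<Rightarrow> ('m, 'a) chart \<Rightarrow> 'm \<Rightarrow> 'a \<Rightarrow> 'a" where
  "transition_deriv c d x \<equiv> frechet_derivative (transition c d) (at (snd c x))"

text \<open>Collects the conditions that are checked by computation in coordinates, so that the
  tangent and cotangent atlases can be shown to be instances and every later lemma reused for
  them.\<close>

locale smooth_atlas =
  fixes E :: "'a::real_inner set" and A :: "('m, 'a) chart set"
  assumes basis: "orthonormal_basis E"
    and inj: "c \<in> A \<Longrightarrow> inj_on (snd c) (fst c)"
    and open_overlap: "c \<in> A \<Longrightarrow> d \<in> A \<Longrightarrow> open (snd c ` (fst c \<inter> fst d))"
    and smooth_transition: "c \<in> A \<Longrightarrow> d \<in> A \<Longrightarrow>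
      smooth_on (snd c ` (fst c \<inter> fst d)) (transition c d)"

lemma smooth_manifold_imp_smooth_atlas: "smooth_manifold E A \<Longrightarrow> smooth_atlas E A"
  unfolding smooth_manifold_def smooth_atlas_def orthonormal_basis_def by auto

context smooth_atlas
begin

lemma inv_snd [simp]: "c \<in> A \<Longrightarrow> x \<in> fst c \<Longrightarrow> chart_inv c (snd c x) = x"
  by (rule chart_inv_snd[OF inj])

lemma open_image: "c \<in> A \<Longrightarrow> open (snd c ` fst c)"
  using open_overlap[of c c] by simp

lemma snd_mem_overlap:
  "c \<in> A \<Longrightarrow> x \<in> fst c \<Longrightarrow> snd c x \<in> snd c ` (fst c \<inter> fst d) \<longleftrightarrow> x \<in> fst d"
  using inj[of c] by (auto simp: inj_on_def)

lemma transition_Ck: "c \<in> A \<Longrightarrow> d \<in> A \<Longrightarrow> Ck_on k (snd c ` (fst c \<inter> fst d)) (transition c d)"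
  using smooth_on_imp_Ck_on[OF smooth_transition open_overlap] .

lemma transition_has_derivative:
  assumes "c \<in> A" "d \<in> A" "x \<in> fst c" "x \<in> fst d"
  shows "(transition c d has_derivative transition_deriv c d x) (at (snd c x))"
  using Ck_on_has_derivative[OF transition_Ck[OF assms(1,2), of "Suc 0"]] assms by blast

lemma linear_transition_deriv:
  assumes "c \<in> A" "d \<in> A" "x \<in> fst c" "x \<in> fst d"
  shows "linear (transition_deriv c d x)"
  using transition_has_derivative[OF assms] has_derivative_linear by blast

lemma transition_deriv_refl:
  assumes "c \<in> A" "x \<in> fst c"
  shows "transition_deriv c c x w = w"
proof -
  have "(transition c c has_derivative (\<lambda>w. w)) (at (snd c x))"
    by (rule has_derivative_transform_within_open[OF has_derivative_ident open_image[OF assms(1)]])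
      (use assms in auto)
  from frechet_derivative_at[OF this] show ?thesis by metis
qed

text \<open>The cocycle identity, from the chain rule. It is the reason why
  \<open>chart_vector\<close> satisfies the compatibility condition of
  \<open>tangent_space\<close>.\<close>

lemma transition_deriv_comp:
  assumes "c \<in> A" "d \<in> A" "e \<in> A" "x \<in> fst c" "x \<in> fst d" "x \<in> fst e"
  shows "transition_deriv d e x (transition_deriv c d x w) = transition_deriv c e x w"
proof -
  have eq: "transition c d (snd c x) = snd d x" using assms by simp
  have "(transition d e \<circ> transition c d has_derivative
      transition_deriv d e x \<circ> transition_deriv c d x) (at (snd c x))"
    using assms eq by (intro diff_chain_at) (simp_all only: eq transition_has_derivative)
  hence "(transition c e has_derivative transition_deriv d e x \<circ> transition_deriv c d x) (at (snd c x))"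
    by (rule has_derivative_transform_within_open[OF _ open_overlap[OF assms(1,2)]])
      (use assms in auto)
  from frechet_derivative_at[OF this] show ?thesis by (metis comp_apply)
qed

section \<open>Tangent vectors in charts and the tangent atlas\<close>

lemma chart_vector_self [simp]:
  "c \<in> A \<Longrightarrow> x \<in> fst c \<Longrightarrow> chart_vector A c x w c = w"
  by (simp add: chart_vector_def transition_deriv_refl)

lemma chart_vector_tangent:
  "c \<in> A \<Longrightarrow> x \<in> fst c \<Longrightarrow> chart_vector A c x w \<in> tangent_space A x"
  unfolding chart_vector_def tangent_space_def by (simp add: transition_deriv_comp del: comp_apply)

text \<open>One representative determines all the others by the transformation law, and the vector
  is \<open>0\<close> at irrelevant charts. Hence the tangent space is a copy of the model space,
  and the bundle chart is injective.\<close>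

lemma tangent_eq_chart_vector:
  assumes "v \<in> tangent_space A x" "c \<in> A" "x \<in> fst c"
  shows "v = chart_vector A c x (v c)"
proof
  fix d
  have "v d = transition_deriv c d x (v c)" if "d \<in> A" "x \<in> fst d"
    using assms that unfolding tangent_space_def mem_Collect_eq by (metis IntI)
  moreover have "v d = 0" if "\<not> (d \<in> A \<and> x \<in> fst d)"
    using assms(1) that unfolding tangent_space_def mem_Collect_eq by metis
  ultimately show "v d = chart_vector A c x (v c) d"
    by (simp add: chart_vector_def del: comp_apply)
qed

lemma chart_vector_add:
  assumes "c \<in> A" "x \<in> fst c"
  shows "chart_vector A c x (u + w) = (\<lambda>d. chart_vector A c x u d + chart_vector A c x w d)"
  by (rule ext) (simp add: chart_vector_def linear_add[OF linear_transition_deriv] assms)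

lemma chart_vector_scale:
  assumes "c \<in> A" "x \<in> fst c"
  shows "chart_vector A c x (r *\<^sub>R w) = (\<lambda>d. r *\<^sub>R chart_vector A c x w d)"
  by (rule ext) (simp add: chart_vector_def linear_scale[OF linear_transition_deriv] assms)

lemma chart_vector_0: "c \<in> A \<Longrightarrow> x \<in> fst c \<Longrightarrow> chart_vector A c x 0 = (\<lambda>_. 0)"
  using chart_vector_scale[of c x 0 0] by simp

lemma mem_carrier: "c \<in> A \<Longrightarrow> x \<in> fst c \<Longrightarrow> x \<in> carrier_of A"
  by (auto simp: carrier_of_def)

lemma zero_tangent:
  assumes "x \<in> carrier_of A"
  shows "(\<lambda>_. 0) \<in> tangent_space A x"
proof -
  obtain c where "c \<in> A" "x \<in> fst c" using assms by (auto simp: carrier_of_def)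
  from chart_vector_tangent[OF this, of 0] show ?thesis unfolding chart_vector_0[OF \<open>c \<in> A\<close> \<open>x \<in> fst c\<close>] .
qed

lemma mem_tangent_chart [simp]:
  "p \<in> fst (tangent_chart A c) \<longleftrightarrow> fst p \<in> fst c \<and> snd p \<in> tangent_space A (fst p)"
  by (auto simp: tangent_chart_def)

lemma snd_tangent_chart [simp]: "snd (tangent_chart A c) p = (snd c (fst p), snd p c)"
  by (auto simp: tangent_chart_def split: prod.split)

lemma inj_tangent_chart:
  assumes "c \<in> A"
  shows "inj_on (snd (tangent_chart A c)) (fst (tangent_chart A c))"
proof (rule inj_onI)
  fix p p' assume "p \<in> fst (tangent_chart A c)" "p' \<in> fst (tangent_chart A c)"
    "snd (tangent_chart A c) p = snd (tangent_chart A c) p'"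
  hence *: "fst p \<in> fst c" "fst p' \<in> fst c" "snd p \<in> tangent_space A (fst p)"
      "snd p' \<in> tangent_space A (fst p')" "snd c (fst p) = snd c (fst p')" "snd p c = snd p' c"
    by auto
  have 1: "fst p = fst p'" using inj_onD[OF inj[OF assms] *(5)] * by blast
  have "snd p = snd p'"
    using tangent_eq_chart_vector[OF *(3) assms *(1)] tangent_eq_chart_vector[OF *(4) assms *(2)]
    unfolding 1 *(6) by (rule trans[OF _ sym])
  with 1 show "p = p'" by (simp add: prod_eq_iff)
qed

lemma tangent_chart_inv:
  assumes "c \<in> A" "y \<in> snd c ` fst c"
  shows "chart_inv (tangent_chart A c) (y, w) = (chart_inv c y, chart_vector A c (chart_inv c y) w)"
    (is "_ = ?p")
proof -
  have "chart_inv (tangent_chart A c) (snd (tangent_chart A c) ?p) = ?p"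
    by (rule chart_inv_snd[OF inj_tangent_chart])
      (simp_all add: assms(1) chart_inv_mem[OF assms(2)] chart_vector_tangent[OF assms(1)])
  thus ?thesis
    by (simp add: chart_vector_self[OF assms(1) chart_inv_mem] snd_chart_inv assms(2))
qed

lemma tangent_overlap:
  assumes "c \<in> A"
  shows "snd (tangent_chart A c) ` (fst (tangent_chart A c) \<inter> fst (tangent_chart A d))
    = snd c ` (fst c \<inter> fst d) \<times> UNIV"
proof (intro equalityI subsetI)
  fix p :: "'a \<times> 'a" assume "p \<in> snd c ` (fst c \<inter> fst d) \<times> UNIV"
  then obtain x w where x: "x \<in> fst c" "x \<in> fst d" "p = (snd c x, w)" by auto
  have "p = snd (tangent_chart A c) (x, chart_vector A c x w)" using x assms by simp
  moreover have "(x, chart_vector A c x w) \<in> fst (tangent_chart A c) \<inter> fst (tangent_chart A d)"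
    using x assms by (simp add: chart_vector_tangent)
  ultimately show "p \<in> snd (tangent_chart A c) ` (fst (tangent_chart A c) \<inter> fst (tangent_chart A d))"
    by blast
qed auto

text \<open>A transition map sends \<open>(y, w)\<close> to the transition of \<open>y\<close>
  paired with its derivative at \<open>y\<close> applied to \<open>w\<close>; the second component
  is smooth by \<open>Ck_on_frechet_derivative\<close>.\<close>

lemma smooth_atlas_tangent: "smooth_atlas (prod_basis E) (tangent_atlas A)"
proof
  show "orthonormal_basis (prod_basis E)" by (rule orthonormal_basis_prod[OF basis])
next
  fix k assume "k \<in> tangent_atlas A"
  thus "inj_on (snd k) (fst k)" using inj_tangent_chart by (auto simp: tangent_atlas_def)
next
  fix k k' assume "k \<in> tangent_atlas A" "k' \<in> tangent_atlas A"
  then obtain c d where cd: "c \<in> A" "d \<in> A" "k = tangent_chart A c" "k' = tangent_chart A d"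
    by (auto simp: tangent_atlas_def)
  let ?S = "snd c ` (fst c \<inter> fst d)"
  have im: "snd k ` (fst k \<inter> fst k') = ?S \<times> UNIV"
    using cd tangent_overlap by simp
  have o: "open (?S \<times> (UNIV::'a set))" using open_overlap cd by (simp add: open_Times)
  show "open (snd k ` (fst k \<inter> fst k'))" using im o by simp
  have "Ck_on j (?S \<times> UNIV) (\<lambda>p::'a \<times> 'a. transition c d (fst p))" for j
    by (rule Ck_on_compose[OF basis o Ck_on_fst[OF o Ck_on_ident[OF o]] transition_Ck[OF cd(1,2)]]) auto
  hence "Ck_on j (?S \<times> UNIV) (\<lambda>p. (transition c d (fst p),
      frechet_derivative (transition c d) (at (fst p)) (snd p)))" for j
    by (intro Ck_on_Pair o Ck_on_frechet_derivative[OF basis] transition_Ck open_overlap cd)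
  hence "Ck_on j (?S \<times> UNIV) (transition k k')" for j
    by (rule Ck_on_cong[OF o, rotated])
      (use cd in \<open>auto simp: tangent_chart_inv chart_vector_def\<close>)
  thus "smooth_on (snd k ` (fst k \<inter> fst k')) (transition k k')"
    unfolding im using o by (intro Ck_on_imp_smooth_on)
qed

section \<open>Covectors in canonical coordinates and the cotangent atlas\<close>

definition momentum :: "('m, 'a) chart \<Rightarrow> 'm \<times> ('m, 'a) covec \<Rightarrow> 'a" where
  "momentum c p = (\<Sum>e\<in>E. snd p (chart_vector A c (fst p) e) *\<^sub>R e)"

text \<open>The inverse of \<open>momentum\<close> on each fibre: the functional with given
  momentum, extended by \<open>0\<close> as \<open>cotangent_space\<close> requires.\<close>

definition covector :: "('m, 'a) chart \<Rightarrow> 'm \<Rightarrow> 'a \<Rightarrow> ('m, 'a) covec" where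
  "covector c x \<xi> = (\<lambda>v. if v \<in> tangent_space A x then \<xi> \<bullet> v c else 0)"

lemma tangent_space_add:
  assumes "u \<in> tangent_space A x" "v \<in> tangent_space A x" "x \<in> carrier_of A"
  shows "(\<lambda>c. u c + v c) \<in> tangent_space A x"
proof -
  obtain c where c: "c \<in> A" "x \<in> fst c" using assms(3) by (auto simp: carrier_of_def)
  have "(\<lambda>d. u d + v d) = chart_vector A c x (u c + v c)"
    unfolding chart_vector_add[OF c]
    using tangent_eq_chart_vector[OF assms(1) c] tangent_eq_chart_vector[OF assms(2) c] by metis
  thus ?thesis using chart_vector_tangent[OF c] by simp
qed

lemma tangent_space_scale:
  assumes "v \<in> tangent_space A x" "x \<in> carrier_of A"
  shows "(\<lambda>c. r *\<^sub>R v c) \<in> tangent_space A x"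
proof -
  obtain c where c: "c \<in> A" "x \<in> fst c" using assms(2) by (auto simp: carrier_of_def)
  have "(\<lambda>d. r *\<^sub>R v d) = chart_vector A c x (r *\<^sub>R v c)"
    unfolding chart_vector_scale[OF c] using tangent_eq_chart_vector[OF assms(1) c] by metis
  thus ?thesis using chart_vector_tangent[OF c] by simp
qed

lemma covector_cotangent:
  "x \<in> carrier_of A \<Longrightarrow> covector c x \<xi> \<in> cotangent_space A x"
  unfolding cotangent_space_def mem_Collect_eq
  by (simp add: covector_def inner_add_right tangent_space_add tangent_space_scale)

lemma mem_cotangent_chart [simp]:
  "p \<in> fst (cotangent_chart E A c) \<longleftrightarrow> fst p \<in> fst c \<and> snd p \<in> cotangent_space A (fst p)"
  by (auto simp: cotangent_chart_def)

lemma snd_cotangent_chart [simp]: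
  "snd (cotangent_chart E A c) p = (snd c (fst p), momentum c p)"
  by (auto simp: cotangent_chart_def momentum_def split: prod.split)

text \<open>In canonical coordinates the duality pairing is the inner product, because the momentum
  lists the values of the functional on the coordinate vectors and the functional is linear.\<close>

lemma covector_apply:
  assumes "\<alpha> \<in> cotangent_space A x" "v \<in> tangent_space A x" "c \<in> A" "x \<in> fst c"
  shows "\<alpha> v = momentum c (x, \<alpha>) \<bullet> v c"
proof -
  have "linear (\<lambda>w. \<alpha> (chart_vector A c x w))"
  proof (rule linearI)
    fix u w r
    show "\<alpha> (chart_vector A c x (u + w)) = \<alpha> (chart_vector A c x u) + \<alpha> (chart_vector A c x w)"
      unfolding chart_vector_add[OF assms(3,4)]
      using assms(1) chart_vector_tangent[OF assms(3,4)] by (simp add: cotangent_space_def)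
    show "\<alpha> (chart_vector A c x (r *\<^sub>R w)) = r *\<^sub>R \<alpha> (chart_vector A c x w)"
      unfolding chart_vector_scale[OF assms(3,4)]
      using assms(1) chart_vector_tangent[OF assms(3,4)] by (simp add: cotangent_space_def)
  qed
  from linear_orthonormal_expansion[OF basis this, of "v c"] show ?thesis
    using tangent_eq_chart_vector[OF assms(2-4)]
    by (simp add: momentum_def inner_sum_left) (simp add: inner_commute mult.commute)
qed

text \<open>Momenta transform by the transpose of the derivative of the backward transition
  \<open>d\<close> to \<open>c\<close>, opposite to the direction in which tangent vectors
  transform.\<close>

lemma momentum_covector:
  assumes "c \<in> A" "x \<in> fst c" "d \<in> A" "x \<in> fst d"
  shows "momentum d (x, covector c x \<xi>) = (\<Sum>e\<in>E. (\<xi> \<bullet> transition_deriv d c x e) *\<^sub>R e)"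
proof -
  have "covector c x \<xi> (chart_vector A d x e) = \<xi> \<bullet> transition_deriv d c x e" for e
    using chart_vector_tangent[OF assms(3,4)] assms by (simp add: covector_def chart_vector_def)
  thus ?thesis by (simp add: momentum_def)
qed

lemma momentum_covector_self:
  assumes "c \<in> A" "x \<in> fst c"
  shows "momentum c (x, covector c x \<xi>) = \<xi>"
  unfolding momentum_covector[OF assms assms]
  using orthonormal_basis_expansion[OF basis, of \<xi>] assms by (simp add: transition_deriv_refl)

lemma inj_cotangent_chart:
  assumes "c \<in> A"
  shows "inj_on (snd (cotangent_chart E A c)) (fst (cotangent_chart E A c))"
proof (rule inj_onI)
  fix p p' assume p: "p \<in> fst (cotangent_chart E A c)" "p' \<in> fst (cotangent_chart E A c)"
    "snd (cotangent_chart E A c) p = snd (cotangent_chart E A c) p'"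
  have 1: "fst p = fst p'" using p inj_onD[OF inj[OF assms]] by simp
  have "snd p v = snd p' v" for v
  proof (cases "v \<in> tangent_space A (fst p)")
    case True
    have "snd p v = momentum c p \<bullet> v c" "snd p' v = momentum c p' \<bullet> v c"
      using covector_apply[of "snd p" "fst p" v c] covector_apply[of "snd p'" "fst p'" v c]
        p(1,2) True True[unfolded 1] assms
      unfolding mem_cotangent_chart prod.collapse by blast+
    thus ?thesis using p(3) by simp
  next
    case False
    thus ?thesis using p 1 by (simp add: cotangent_space_def)
  qed
  with 1 show "p = p'" by (simp add: prod_eq_iff fun_eq_iff)
qed

lemma cotangent_chart_inv:
  assumes "c \<in> A" "y \<in> snd c ` fst c"
  shows "chart_inv (cotangent_chart E A c) (y, \<xi>) = (chart_inv c y, covector c (chart_inv c y) \<xi>)"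
    (is "_ = ?p")
proof -
  have "chart_inv (cotangent_chart E A c) (snd (cotangent_chart E A c) ?p) = ?p"
    by (rule chart_inv_snd[OF inj_cotangent_chart])
      (simp_all add: assms(1) chart_inv_mem[OF assms(2)] covector_cotangent mem_carrier[OF assms(1)])
  moreover have "snd (cotangent_chart E A c) ?p = (y, \<xi>)"
    unfolding snd_cotangent_chart fst_conv
    using momentum_covector_self[OF assms(1) chart_inv_mem[OF assms(2)]] assms
    by (simp add: snd_chart_inv)
  ultimately show ?thesis by simp
qed

lemma cotangent_overlap:
  assumes "c \<in> A"
  shows "snd (cotangent_chart E A c) ` (fst (cotangent_chart E A c) \<inter> fst (cotangent_chart E A d))
    = snd c ` (fst c \<inter> fst d) \<times> UNIV"
proof (intro equalityI subsetI)
  fix p :: "'a \<times> 'a" assume "p \<in> snd c ` (fst c \<inter> fst d) \<times> UNIV"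
  then obtain x w where x: "x \<in> fst c" "x \<in> fst d" "p = (snd c x, w)" by auto
  have "p = snd (cotangent_chart E A c) (x, covector c x w)"
    unfolding snd_cotangent_chart using momentum_covector_self[OF assms x(1)] x by simp
  moreover have "(x, covector c x w) \<in> fst (cotangent_chart E A c) \<inter> fst (cotangent_chart E A d)"
    using x assms by (simp add: covector_cotangent mem_carrier[OF assms(1)])
  ultimately show "p \<in> snd (cotangent_chart E A c) ` (fst (cotangent_chart E A c) \<inter> fst (cotangent_chart E A d))"
    by blast
qed auto

text \<open>The fibre part uses the derivative of the backward transition, evaluated at the image
  point. It is smooth as a composition, so no matrix has to be inverted.\<close>

lemma smooth_atlas_cotangent: "smooth_atlas (prod_basis E) (cotangent_atlas E A)"
proof
  show "orthonormal_basis (prod_basis E)" by (rule orthonormal_basis_prod[OF basis])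
next
  fix k assume "k \<in> cotangent_atlas E A"
  thus "inj_on (snd k) (fst k)" using inj_cotangent_chart by (auto simp: cotangent_atlas_def)
next
  fix k k' assume "k \<in> cotangent_atlas E A" "k' \<in> cotangent_atlas E A"
  then obtain c d where cd: "c \<in> A" "d \<in> A" "k = cotangent_chart E A c" "k' = cotangent_chart E A d"
    by (auto simp: cotangent_atlas_def)
  let ?S = "snd c ` (fst c \<inter> fst d)" and ?R = "snd d ` (fst d \<inter> fst c)"
  have im: "snd k ` (fst k \<inter> fst k') = ?S \<times> UNIV"
    using cd cotangent_overlap by simp
  have o: "open (?S \<times> (UNIV::'a set))" using open_overlap cd by (simp add: open_Times)
  show "open (snd k ` (fst k \<inter> fst k'))" using im o by simp
  have fst_Ck: "Ck_on j (?S \<times> UNIV) (\<lambda>p::'a \<times> 'a. transition c d (fst p))" for j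
    by (rule Ck_on_compose[OF basis o Ck_on_fst[OF o Ck_on_ident[OF o]] transition_Ck[OF cd(1,2)]]) auto
  have tr: "Ck_on j ?R (\<lambda>y. frechet_derivative (transition d c) (at y) e)" for j e
    using transition_Ck[OF cd(2,1), of "Suc j"] by simp
  \<comment> \<open>The derivative belongs to a map defined on the coordinates of \<open>d\<close>,
    hence the inner \<open>transition c d\<close>.\<close>
  have "Ck_on j (?S \<times> UNIV) (\<lambda>p::'a \<times> 'a. frechet_derivative (transition d c) (at (transition c d (fst p))) e)" for j e
    by (rule Ck_on_compose[OF basis o fst_Ck tr]) (use cd in auto)
  hence "Ck_on j (?S \<times> UNIV) (\<lambda>p. (transition c d (fst p),
      \<Sum>e\<in>E. (snd p \<bullet> frechet_derivative (transition d c) (at (transition c d (fst p))) e) *\<^sub>R e))" for j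
    by (intro Ck_on_Pair o Ck_on_sum Ck_on_scaleR Ck_on_inner Ck_on_const fst_Ck Ck_on_snd Ck_on_ident)
  hence "Ck_on j (?S \<times> UNIV) (transition k k')" for j
    by (rule Ck_on_cong[OF o, rotated])
      (use cd momentum_covector[of c _ d] in \<open>auto simp: cotangent_chart_inv\<close>)
  thus "smooth_on (snd k ` (fst k \<inter> fst k')) (transition k k')"
    unfolding im using o by (intro Ck_on_imp_smooth_on)
qed

end

subsection \<open>Curves and families of curves\<close>

lemma continuous_on_openin_cover:
  fixes S :: "'a::metric_space set"
  assumes "\<And>x. x \<in> S \<Longrightarrow> \<exists>R. openin (top_of_set S) R \<and> x \<in> R \<and> continuous_on R f"
  shows "continuous_on S f"
  unfolding continuous_on_eq_continuous_within
proof
  fix x assume "x \<in> S"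
  then obtain R where R: "openin (top_of_set S) R" "x \<in> R" "continuous_on R f"
    using assms by blast
  then obtain W where W: "open W" "R = S \<inter> W" by (auto simp: openin_open)
  have "at x within S = at x within R"
    using R(2) W by (intro at_within_nhd[of x W]) auto
  thus "continuous (at x within S) f"
    using R(2,3) by (simp add: continuous_on_eq_continuous_within)
qed

lemma has_vector_derivative_chain:
  assumes "(f has_vector_derivative f') (at t within S)" "(g has_derivative g') (at (f t))"
  shows "((\<lambda>s. g (f s)) has_vector_derivative g' f') (at t within S)"
  using vector_derivative_diff_chain_within[OF assms(1) has_derivative_at_withinI[OF assms(2)]]
  by (simp add: o_def)

lemma has_vector_derivative_Pair:
  assumes "(f has_vector_derivative f') (at t within S)" "(g has_vector_derivative g') (at t within S)"
  shows "((\<lambda>s. (f s, g s)) has_vector_derivative (f', g')) (at t within S)"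
  using has_derivative_Pair[OF assms[unfolded has_vector_derivative_def]]
  by (simp add: has_vector_derivative_def)

lemma has_vector_derivative_cong_local:
  assumes "openin (top_of_set J) N" "t \<in> N" "\<And>s. s \<in> N \<Longrightarrow> f s = g s"
  shows "(f has_vector_derivative v) (at t within J) \<longleftrightarrow> (g has_vector_derivative v) (at t within J)"
proof -
  obtain e where e: "e > 0" "\<And>s. s \<in> J \<Longrightarrow> dist s t < e \<Longrightarrow> s \<in> N"
    using assms(1,2) unfolding openin_euclidean_subtopology_iff by blast
  have "t \<in> J" using openin_imp_subset[OF assms(1)] assms(2) by blast
  thus ?thesis
    using has_vector_derivative_transform_within[OF _ e(1), of f v t J g]
      has_vector_derivative_transform_within[OF _ e(1), of g v t J f] e(2) assms(3) by metis
qed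

text \<open>The condition that \<^const>\<open>C1_family\<close> imposes in one chart, for the coordinates \<open>Y\<close> of the family.\<close>

definition C1_coords :: "real set \<Rightarrow> (real \<times> real) set \<Rightarrow> (real \<Rightarrow> real \<Rightarrow> 'a::real_normed_vector) \<Rightarrow> bool" where
  "C1_coords J S Y \<longleftrightarrow> (\<exists>Yt Ye Yet.
     continuous_on S (\<lambda>(\<epsilon>, t). Yt \<epsilon> t) \<and> continuous_on S (\<lambda>(\<epsilon>, t). Ye \<epsilon> t) \<and>
     continuous_on S (\<lambda>(\<epsilon>, t). Yet \<epsilon> t) \<and>
     (\<forall>(\<epsilon>, t)\<in>S.
        (Y \<epsilon> has_vector_derivative Yt \<epsilon> t) (at t within J) \<and>
        ((\<lambda>\<eta>. Y \<eta> t) has_vector_derivative Ye \<epsilon> t) (at \<epsilon>) \<and>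
        ((\<lambda>\<eta>. Yt \<eta> t) has_vector_derivative Yet \<epsilon> t) (at \<epsilon>)))"

lemma C1_coordsI:
  assumes "continuous_on S (\<lambda>(\<epsilon>, t). Yt \<epsilon> t)" "continuous_on S (\<lambda>(\<epsilon>, t). Ye \<epsilon> t)"
    "continuous_on S (\<lambda>(\<epsilon>, t). Yet \<epsilon> t)"
    and "\<And>\<epsilon> t. (\<epsilon>, t) \<in> S \<Longrightarrow> (Y \<epsilon> has_vector_derivative Yt \<epsilon> t) (at t within J)"
    and "\<And>\<epsilon> t. (\<epsilon>, t) \<in> S \<Longrightarrow> ((\<lambda>\<eta>. Y \<eta> t) has_vector_derivative Ye \<epsilon> t) (at \<epsilon>)"
    and "\<And>\<epsilon> t. (\<epsilon>, t) \<in> S \<Longrightarrow> ((\<lambda>\<eta>. Yt \<eta> t) has_vector_derivative Yet \<epsilon> t) (at \<epsilon>)"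
  shows "C1_coords J S Y"
  unfolding C1_coords_def by (intro exI[of _ Yt] exI[of _ Ye] exI[of _ Yet]) (use assms in auto)

lemma C1_coordsE:
  assumes "C1_coords J S Y"
  obtains Yt Ye Yet where
    "continuous_on S (\<lambda>(\<epsilon>, t). Yt \<epsilon> t)" "continuous_on S (\<lambda>(\<epsilon>, t). Ye \<epsilon> t)"
    "continuous_on S (\<lambda>(\<epsilon>, t). Yet \<epsilon> t)"
    "\<And>\<epsilon> t. (\<epsilon>, t) \<in> S \<Longrightarrow> (Y \<epsilon> has_vector_derivative Yt \<epsilon> t) (at t within J)"
    "\<And>\<epsilon> t. (\<epsilon>, t) \<in> S \<Longrightarrow> ((\<lambda>\<eta>. Y \<eta> t) has_vector_derivative Ye \<epsilon> t) (at \<epsilon>)"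
    "\<And>\<epsilon> t. (\<epsilon>, t) \<in> S \<Longrightarrow> ((\<lambda>\<eta>. Yt \<eta> t) has_vector_derivative Yet \<epsilon> t) (at \<epsilon>)"
  using assms unfolding C1_coords_def by fast

lemma C1_coords_subset:
  assumes "C1_coords J S Y" "R \<subseteq> S"
  shows "C1_coords J R Y"
  using assms(1)
proof (rule C1_coordsE)
  fix Yt Ye Yet
  assume "continuous_on S (\<lambda>(\<epsilon>, t). Yt \<epsilon> t)" "continuous_on S (\<lambda>(\<epsilon>, t). Ye \<epsilon> t)"
    "continuous_on S (\<lambda>(\<epsilon>, t). Yet \<epsilon> t)"
    "\<And>\<epsilon> t. (\<epsilon>, t) \<in> S \<Longrightarrow> (Y \<epsilon> has_vector_derivative Yt \<epsilon> t) (at t within J)"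
    "\<And>\<epsilon> t. (\<epsilon>, t) \<in> S \<Longrightarrow> ((\<lambda>\<eta>. Y \<eta> t) has_vector_derivative Ye \<epsilon> t) (at \<epsilon>)"
    "\<And>\<epsilon> t. (\<epsilon>, t) \<in> S \<Longrightarrow> ((\<lambda>\<eta>. Yt \<eta> t) has_vector_derivative Yet \<epsilon> t) (at \<epsilon>)"
  thus ?thesis
    using assms(2) by (intro C1_coordsI[of R Yt Ye Yet]) (auto intro: continuous_on_subset)
qed

text \<open>The four conditions survive a C^2 map: the derivative in t, differentiated in
  \<epsilon>, brings in a second derivative of \<open>G\<close>, which must still be
  continuous.\<close>

lemma C1_coords_compose:
  fixes F :: "'a::real_inner set" and G :: "'a \<Rightarrow> 'b::real_normed_vector"
  assumes F: "orthonormal_basis F" and V: "open V" and G: "Ck_on 2 V G"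
    and Y: "C1_coords J S Y" and cY: "continuous_on S (\<lambda>(\<epsilon>, t). Y \<epsilon> t)"
    and YV: "\<And>\<epsilon> t. (\<epsilon>, t) \<in> S \<Longrightarrow> Y \<epsilon> t \<in> V"
  shows "C1_coords J S (\<lambda>\<epsilon> t. G (Y \<epsilon> t))"
  using Y
proof (rule C1_coordsE)
  fix Yt Ye Yet
  assume c: "continuous_on S (\<lambda>(\<epsilon>, t). Yt \<epsilon> t)" "continuous_on S (\<lambda>(\<epsilon>, t). Ye \<epsilon> t)"
    "continuous_on S (\<lambda>(\<epsilon>, t). Yet \<epsilon> t)"
    and d: "\<And>\<epsilon> t. (\<epsilon>, t) \<in> S \<Longrightarrow> (Y \<epsilon> has_vector_derivative Yt \<epsilon> t) (at t within J)"
    "\<And>\<epsilon> t. (\<epsilon>, t) \<in> S \<Longrightarrow> ((\<lambda>\<eta>. Y \<eta> t) has_vector_derivative Ye \<epsilon> t) (at \<epsilon>)"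
    "\<And>\<epsilon> t. (\<epsilon>, t) \<in> S \<Longrightarrow> ((\<lambda>\<eta>. Yt \<eta> t) has_vector_derivative Yet \<epsilon> t) (at \<epsilon>)"
  \<comment> \<open>\<open>K\<close> is the derivative as a function of point and direction. Then
    the t-derivative of the composite is \<open>K (Y, Yt)\<close>, and the mixed derivative is the
    first derivative of \<open>K\<close> at \<open>(Y, Yt)\<close> along \<open>(Ye, Yet)\<close>;
    no second-derivative formula is needed.\<close>
  define K where "K = (\<lambda>p. frechet_derivative G (at (fst p)) (snd p))"
  have G2: "Ck_on (Suc (Suc 0)) V G" using G by (simp add: numeral_2_eq_2)
  have oV: "open (V \<times> (UNIV::'a set))" using V by (simp add: open_Times)
  have KC: "Ck_on (Suc 0) (V \<times> UNIV) K"
    unfolding K_def by (rule Ck_on_frechet_derivative[OF F V G2])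
  have Gd: "(G has_derivative (\<lambda>v. K (y, v))) (at y)" if "y \<in> V" for y
    using Ck_on_has_derivative[OF G2 that] by (simp add: K_def)
  have Kd: "(K has_derivative frechet_derivative K (at p)) (at p)" if "fst p \<in> V" for p
    using Ck_on_has_derivative[OF KC, of p] that by (cases p) auto
  have cK: "continuous_on (V \<times> UNIV) K" by (rule Ck_on_continuous[OF KC])
  have cDK: "continuous_on ((V \<times> UNIV) \<times> UNIV) (\<lambda>p. frechet_derivative K (at (fst p)) (snd p))"
    using Ck_on_frechet_derivative[OF orthonormal_basis_prod[OF F] oV KC] by (rule Ck_on_continuous)
  note c = c[unfolded case_prod_beta] and cY = cY[unfolded case_prod_beta]
  show ?thesis
  proof (rule C1_coordsI)
    show "continuous_on S (\<lambda>(\<epsilon>, t). K (Y \<epsilon> t, Yt \<epsilon> t))"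
      unfolding case_prod_beta
      by (rule continuous_on_compose2[OF cK]) (use YV in \<open>auto intro!: continuous_on_Pair c cY\<close>)
    show "continuous_on S (\<lambda>(\<epsilon>, t). K (Y \<epsilon> t, Ye \<epsilon> t))"
      unfolding case_prod_beta
      by (rule continuous_on_compose2[OF cK]) (use YV in \<open>auto intro!: continuous_on_Pair c cY\<close>)
    show "continuous_on S (\<lambda>(\<epsilon>, t).
        frechet_derivative K (at (fst ((Y \<epsilon> t, Yt \<epsilon> t), (Ye \<epsilon> t, Yet \<epsilon> t)))) (snd ((Y \<epsilon> t, Yt \<epsilon> t), (Ye \<epsilon> t, Yet \<epsilon> t))))"
      unfolding case_prod_beta
      by (rule continuous_on_compose2[OF cDK])
        (use YV in \<open>auto intro!: continuous_on_Pair c cY\<close>)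
  next
    fix \<epsilon> t assume S: "(\<epsilon>, t) \<in> S"
    show "((\<lambda>t. G (Y \<epsilon> t)) has_vector_derivative K (Y \<epsilon> t, Yt \<epsilon> t)) (at t within J)"
      by (rule has_vector_derivative_chain[OF d(1)[OF S] Gd[OF YV[OF S]]])
    show "((\<lambda>\<eta>. G (Y \<eta> t)) has_vector_derivative K (Y \<epsilon> t, Ye \<epsilon> t)) (at \<epsilon>)"
      by (rule has_vector_derivative_chain[OF d(2)[OF S] Gd[OF YV[OF S]]])
    show "((\<lambda>\<eta>. K (Y \<eta> t, Yt \<eta> t)) has_vector_derivative
        frechet_derivative K (at (fst ((Y \<epsilon> t, Yt \<epsilon> t), (Ye \<epsilon> t, Yet \<epsilon> t)))) (snd ((Y \<epsilon> t, Yt \<epsilon> t), (Ye \<epsilon> t, Yet \<epsilon> t)))) (at \<epsilon>)"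
      unfolding fst_conv snd_conv
      by (rule has_vector_derivative_chain[OF has_vector_derivative_Pair[OF d(2,3)[OF S]] Kd])
        (use YV[OF S] in simp)
  qed
qed

text \<open>In \<epsilon> a full neighbourhood is available since \<open>I\<close> is open; in t
  only a neighbourhood relative to \<open>J\<close>. This matches the two kinds of derivative in
  \<open>C1_coords\<close>.\<close>

lemma openin_slices:
  fixes S :: "(real \<times> real) set"
  assumes "open I" "openin (top_of_set (I \<times> J)) S" "(\<epsilon>, t) \<in> S"
  obtains r where "r > 0" "\<And>\<eta>. dist \<eta> \<epsilon> < r \<Longrightarrow> (\<eta>, t) \<in> S"
    "\<And>s. s \<in> J \<Longrightarrow> dist s t < r \<Longrightarrow> (\<epsilon>, s) \<in> S"
proof -
  have IJ: "\<epsilon> \<in> I" "t \<in> J" using openin_imp_subset[OF assms(2)] assms(3) by auto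
  obtain r1 where r1: "r1 > 0" "\<And>p. p \<in> I \<times> J \<Longrightarrow> dist p (\<epsilon>, t) < r1 \<Longrightarrow> p \<in> S"
    using assms(2,3) unfolding openin_euclidean_subtopology_iff by blast
  obtain r2 where r2: "r2 > 0" "\<And>\<eta>. dist \<eta> \<epsilon> < r2 \<Longrightarrow> \<eta> \<in> I"
    using assms(1) IJ(1) unfolding open_dist by blast
  show thesis
    by (rule that[of "min r1 r2"]) (use r1 r2 IJ in \<open>auto simp: dist_Pair_Pair\<close>)
qed

lemma C1_coords_cong:
  assumes "open I" "openin (top_of_set (I \<times> J)) S" "C1_coords J S Y"
    and eq: "\<And>\<epsilon> t. (\<epsilon>, t) \<in> S \<Longrightarrow> Y \<epsilon> t = Y' \<epsilon> t"
  shows "C1_coords J S Y'"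
  using assms(3)
proof (rule C1_coordsE)
  fix Yt Ye Yet
  assume c: "continuous_on S (\<lambda>(\<epsilon>, t). Yt \<epsilon> t)" "continuous_on S (\<lambda>(\<epsilon>, t). Ye \<epsilon> t)"
    "continuous_on S (\<lambda>(\<epsilon>, t). Yet \<epsilon> t)"
    and d: "\<And>\<epsilon> t. (\<epsilon>, t) \<in> S \<Longrightarrow> (Y \<epsilon> has_vector_derivative Yt \<epsilon> t) (at t within J)"
    "\<And>\<epsilon> t. (\<epsilon>, t) \<in> S \<Longrightarrow> ((\<lambda>\<eta>. Y \<eta> t) has_vector_derivative Ye \<epsilon> t) (at \<epsilon>)"
    "\<And>\<epsilon> t. (\<epsilon>, t) \<in> S \<Longrightarrow> ((\<lambda>\<eta>. Yt \<eta> t) has_vector_derivative Yet \<epsilon> t) (at \<epsilon>)"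
  show ?thesis
  proof (rule C1_coordsI[OF c _ _ d(3)])
    fix \<epsilon> t assume S: "(\<epsilon>, t) \<in> S"
    have "t \<in> J" using openin_imp_subset[OF assms(2)] S by auto
    obtain r where r: "r > 0" "\<And>\<eta>. dist \<eta> \<epsilon> < r \<Longrightarrow> (\<eta>, t) \<in> S"
      "\<And>s. s \<in> J \<Longrightarrow> dist s t < r \<Longrightarrow> (\<epsilon>, s) \<in> S"
      by (rule openin_slices[OF assms(1,2) S]) blast
    show "(Y' \<epsilon> has_vector_derivative Yt \<epsilon> t) (at t within J)"
      by (rule has_vector_derivative_transform_within[OF d(1)[OF S] r(1) \<open>t \<in> J\<close>]) (use r eq in auto)
    show "((\<lambda>\<eta>. Y' \<eta> t) has_vector_derivative Ye \<epsilon> t) (at \<epsilon>)"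
      by (rule has_vector_derivative_transform_within[OF d(2)[OF S] r(1)]) (use r eq in auto)
  qed
qed

text \<open>The local witnesses are existential and could differ from patch to patch. They are
  replaced by the canonical \<open>vector_derivative\<close>s, with which all of them agree by
  uniqueness; at points of \<open>J\<close> uniqueness requires the filter within \<open>J\<close>
  to be nontrivial.\<close>

lemma C1_coords_glue:
  assumes I: "open I" and J: "\<And>t. t \<in> J \<Longrightarrow> at t within J \<noteq> bot"
    and S: "openin (top_of_set (I \<times> J)) S"
    and loc: "\<And>p. p \<in> S \<Longrightarrow> \<exists>R. openin (top_of_set (I \<times> J)) R \<and> p \<in> R \<and> R \<subseteq> S \<and> C1_coords J R Y"
  shows "C1_coords J S Y"
proof -
  define Yt where "Yt \<epsilon> t = vector_derivative (Y \<epsilon>) (at t within J)" for \<epsilon> t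
  define Ye where "Ye \<epsilon> t = vector_derivative (\<lambda>\<eta>. Y \<eta> t) (at \<epsilon>)" for \<epsilon> t
  define Yet where "Yet \<epsilon> t = vector_derivative (\<lambda>\<eta>. Yt \<eta> t) (at \<epsilon>)" for \<epsilon> t
  have SIJ: "S \<subseteq> I \<times> J" using openin_imp_subset[OF S] .
  have *: "\<exists>R. openin (top_of_set S) R \<and> p \<in> R \<and> continuous_on R (\<lambda>(\<epsilon>, t). Yt \<epsilon> t) \<and>
      continuous_on R (\<lambda>(\<epsilon>, t). Ye \<epsilon> t) \<and> continuous_on R (\<lambda>(\<epsilon>, t). Yet \<epsilon> t) \<and>
      (\<forall>(\<epsilon>, t)\<in>R. (Y \<epsilon> has_vector_derivative Yt \<epsilon> t) (at t within J) \<and>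
        ((\<lambda>\<eta>. Y \<eta> t) has_vector_derivative Ye \<epsilon> t) (at \<epsilon>) \<and>
        ((\<lambda>\<eta>. Yt \<eta> t) has_vector_derivative Yet \<epsilon> t) (at \<epsilon>))" if p: "p \<in> S" for p
  proof -
    obtain R where R: "openin (top_of_set (I \<times> J)) R" "p \<in> R" "R \<subseteq> S" "C1_coords J R Y"
      using loc[OF p] by blast
    have RIJ: "R \<subseteq> I \<times> J" using R(3) SIJ by blast
    have "openin (top_of_set S) R"
      using R(1,3) SIJ by (meson openin_subset_trans)
    from R(4) show ?thesis
    proof (rule C1_coordsE)
      fix At Ae Aet
      assume c: "continuous_on R (\<lambda>(\<epsilon>, t). At \<epsilon> t)" "continuous_on R (\<lambda>(\<epsilon>, t). Ae \<epsilon> t)"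
        "continuous_on R (\<lambda>(\<epsilon>, t). Aet \<epsilon> t)"
        and d: "\<And>\<epsilon> t. (\<epsilon>, t) \<in> R \<Longrightarrow> (Y \<epsilon> has_vector_derivative At \<epsilon> t) (at t within J)"
        "\<And>\<epsilon> t. (\<epsilon>, t) \<in> R \<Longrightarrow> ((\<lambda>\<eta>. Y \<eta> t) has_vector_derivative Ae \<epsilon> t) (at \<epsilon>)"
        "\<And>\<epsilon> t. (\<epsilon>, t) \<in> R \<Longrightarrow> ((\<lambda>\<eta>. At \<eta> t) has_vector_derivative Aet \<epsilon> t) (at \<epsilon>)"
      have et: "Yt \<epsilon> t = At \<epsilon> t" if "(\<epsilon>, t) \<in> R" for \<epsilon> t
        unfolding Yt_def using vector_derivative_within[OF J d(1)[OF that]] RIJ that by auto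
      have ee: "Ye \<epsilon> t = Ae \<epsilon> t" if "(\<epsilon>, t) \<in> R" for \<epsilon> t
        unfolding Ye_def using vector_derivative_at[OF d(2)[OF that]] .
      have det: "((\<lambda>\<eta>. Yt \<eta> t) has_vector_derivative Aet \<epsilon> t) (at \<epsilon>)" if p: "(\<epsilon>, t) \<in> R" for \<epsilon> t
      proof -
        obtain r where r: "r > 0" "\<And>\<eta>. dist \<eta> \<epsilon> < r \<Longrightarrow> (\<eta>, t) \<in> R"
            "\<And>s. s \<in> J \<Longrightarrow> dist s t < r \<Longrightarrow> (\<epsilon>, s) \<in> R"
          by (rule openin_slices[OF I R(1) p]) blast
        show ?thesis
          by (rule has_vector_derivative_transform_within[OF d(3)[OF p] r(1)]) (use r et in auto)
      qed
      have eet: "Yet \<epsilon> t = Aet \<epsilon> t" if "(\<epsilon>, t) \<in> R" for \<epsilon> t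
        unfolding Yet_def using vector_derivative_at[OF det[OF that]] .
      have "continuous_on R (\<lambda>(\<epsilon>, t). Yt \<epsilon> t)"
        by (rule continuous_on_eq[OF c(1)]) (auto simp: et)
      moreover have "continuous_on R (\<lambda>(\<epsilon>, t). Ye \<epsilon> t)"
        by (rule continuous_on_eq[OF c(2)]) (auto simp: ee)
      moreover have "continuous_on R (\<lambda>(\<epsilon>, t). Yet \<epsilon> t)"
        by (rule continuous_on_eq[OF c(3)]) (auto simp: eet)
      moreover have "\<forall>(\<epsilon>, t)\<in>R. (Y \<epsilon> has_vector_derivative Yt \<epsilon> t) (at t within J) \<and>
          ((\<lambda>\<eta>. Y \<eta> t) has_vector_derivative Ye \<epsilon> t) (at \<epsilon>) \<and>
          ((\<lambda>\<eta>. Yt \<eta> t) has_vector_derivative Yet \<epsilon> t) (at \<epsilon>)"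
      proof (safe)
        fix \<epsilon> t assume p: "(\<epsilon>, t) \<in> R"
        show "(Y \<epsilon> has_vector_derivative Yt \<epsilon> t) (at t within J)"
          "((\<lambda>\<eta>. Y \<eta> t) has_vector_derivative Ye \<epsilon> t) (at \<epsilon>)"
          "((\<lambda>\<eta>. Yt \<eta> t) has_vector_derivative Yet \<epsilon> t) (at \<epsilon>)"
          using d(1,2)[OF p] det[OF p] by (simp_all only: et[OF p] ee[OF p] eet[OF p])
      qed
      ultimately show ?thesis
        using \<open>openin (top_of_set S) R\<close> R(2) by (intro exI[of _ R] conjI)
    qed
  qed
  have cont: "continuous_on S (\<lambda>(\<epsilon>, t). Yt \<epsilon> t)" "continuous_on S (\<lambda>(\<epsilon>, t). Ye \<epsilon> t)"
      "continuous_on S (\<lambda>(\<epsilon>, t). Yet \<epsilon> t)"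
    by (rule continuous_on_openin_cover, use * in metis)+
  show ?thesis
  proof (rule C1_coordsI[OF cont])
    fix \<epsilon> t assume "(\<epsilon>, t) \<in> S"
    from *[OF this]
    show "(Y \<epsilon> has_vector_derivative Yt \<epsilon> t) (at t within J)"
      "((\<lambda>\<eta>. Y \<eta> t) has_vector_derivative Ye \<epsilon> t) (at \<epsilon>)"
      "((\<lambda>\<eta>. Yt \<eta> t) has_vector_derivative Yet \<epsilon> t) (at \<epsilon>)"
      by (auto dest!: bspec)
  qed
qed

section \<open>Continuity into a manifold and the passage from one chart to all charts\<close>

lemma topspace_atlas_topology [simp]: "topspace (atlas_topology A) = carrier_of A"
  unfolding atlas_topology_def carrier_of_def by auto blast

text \<open>The topology is generated by the chart preimages of open sets, so continuity is tested
  on these alone; landing in the carrier is a separate condition.\<close>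

lemma continuous_map_atlas_topology_iff:
  "continuous_map (top_of_set S) (atlas_topology A) f \<longleftrightarrow>
     f \<in> S \<rightarrow> carrier_of A \<and>
     (\<forall>c\<in>A. \<forall>W. open W \<longrightarrow> openin (top_of_set S) {x\<in>S. f x \<in> fst c \<and> snd c (f x) \<in> W})"
proof -
  have eq: "f -` (fst c \<inter> snd c -` W) \<inter> S = {x\<in>S. f x \<in> fst c \<and> snd c (f x) \<in> W}" for c W
    by auto
  have un: "\<Union>{fst c \<inter> snd c -` W |c W. c \<in> A \<and> open W} = carrier_of A"
    using topspace_atlas_topology[of A] unfolding atlas_topology_def by simp
  have "continuous_map (top_of_set S) (atlas_topology A) f \<longleftrightarrow>
      f \<in> S \<rightarrow> carrier_of A \<and>
      (\<forall>U. (\<exists>c W. U = fst c \<inter> snd c -` W \<and> c \<in> A \<and> open W) \<longrightarrow> openin (top_of_set S) (f -` U \<inter> S))"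
    unfolding atlas_topology_def continuous_on_generated_topo_iff un
    by (simp add: image_subset_iff_funcset conj_commute)
  also have "\<dots> \<longleftrightarrow> f \<in> S \<rightarrow> carrier_of A \<and>
      (\<forall>c\<in>A. \<forall>W. open W \<longrightarrow> openin (top_of_set S) (f -` (fst c \<inter> snd c -` W) \<inter> S))"
    by blast
  finally show ?thesis unfolding eq .
qed

lemma openin_chart_preimage:
  assumes "continuous_map (top_of_set S) (atlas_topology A) f" "c \<in> A"
  shows "openin (top_of_set S) {x\<in>S. f x \<in> fst c}"
  using assms unfolding continuous_map_atlas_topology_iff by (auto dest!: bspec spec[of _ UNIV])

lemma C1_family_iff:
  "C1_family A I J Z \<longleftrightarrow>
     continuous_map (top_of_set (I \<times> J)) (atlas_topology A) (\<lambda>(\<epsilon>, t). Z \<epsilon> t) \<and>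
     (\<forall>c\<in>A. C1_coords J {(\<epsilon>, t) \<in> I \<times> J. Z \<epsilon> t \<in> fst c} (\<lambda>\<epsilon> t. snd c (Z \<epsilon> t)))"
proof -
  have "(\<forall>p\<in>{(\<epsilon>, t) \<in> I \<times> J. Q \<epsilon> t}. P (fst p) (snd p)) \<longleftrightarrow> (\<forall>\<epsilon>\<in>I. \<forall>t\<in>J. Q \<epsilon> t \<longrightarrow> P \<epsilon> t)"
    for P Q :: "real \<Rightarrow> real \<Rightarrow> bool" by auto
  thus ?thesis unfolding C1_family_def C1_coords_def case_prod_beta[of "\<lambda>\<epsilon> t. _ \<epsilon> t \<and> _ \<epsilon> t"] by simp
qed

lemma C1_family_curve:
  assumes "C1_family A I J Z" "\<epsilon> \<in> I"
  shows "C1_curve A J (Z \<epsilon>)"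
  unfolding C1_curve_def
proof (intro conjI ballI)
  have "continuous_map (top_of_set J) (top_of_set (I \<times> J)) (\<lambda>t. (\<epsilon>, t))"
    using assms(2) by (auto intro!: continuous_intros)
  from continuous_map_compose[OF this] assms(1)
  show "continuous_map (top_of_set J) (atlas_topology A) (Z \<epsilon>)"
    unfolding C1_family_iff by (fastforce simp: o_def)
next
  fix c assume "c \<in> A"
  hence "C1_coords J {(\<epsilon>, t) \<in> I \<times> J. Z \<epsilon> t \<in> fst c} (\<lambda>\<epsilon> t. snd c (Z \<epsilon> t))"
    using assms(1) unfolding C1_family_iff by blast
  thus "C1_on J {t\<in>J. Z \<epsilon> t \<in> fst c} (snd c \<circ> Z \<epsilon>)"
  proof (rule C1_coordsE)
    fix Yt Ye Yet
    assume c: "continuous_on {(\<epsilon>, t) \<in> I \<times> J. Z \<epsilon> t \<in> fst c} (\<lambda>(\<epsilon>, t). Yt \<epsilon> t)"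
      and d: "\<And>\<epsilon> t. (\<epsilon>, t) \<in> {(\<epsilon>, t) \<in> I \<times> J. Z \<epsilon> t \<in> fst c} \<Longrightarrow>
        ((\<lambda>t. snd c (Z \<epsilon> t)) has_vector_derivative Yt \<epsilon> t) (at t within J)"
    have "continuous_on {t\<in>J. Z \<epsilon> t \<in> fst c} (\<lambda>t. (\<lambda>(\<epsilon>, t). Yt \<epsilon> t) (\<epsilon>, t))"
      by (rule continuous_on_compose2[OF c]) (use assms(2) in \<open>auto intro!: continuous_intros\<close>)
    thus ?thesis
      unfolding C1_on_def using d assms(2) by (intro exI[of _ "Yt \<epsilon>"]) (auto simp: o_def)
  qed
qed

context smooth_atlas
begin

text \<open>\<open>C1_family\<close> quantifies over all charts. Near each point one good chart is
  enough: smooth transitions carry its coordinates to any other chart, and the patches are then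
  glued.\<close>

lemma C1_familyI:
  assumes I: "open I" and J: "\<And>t. t \<in> J \<Longrightarrow> at t within J \<noteq> bot"
    and loc: "\<And>p. p \<in> I \<times> J \<Longrightarrow> \<exists>S. \<exists>c\<in>A. openin (top_of_set (I \<times> J)) S \<and> p \<in> S \<and>
      (\<forall>(\<epsilon>, t)\<in>S. Z \<epsilon> t \<in> fst c) \<and> continuous_on S (\<lambda>(\<epsilon>, t). snd c (Z \<epsilon> t)) \<and>
      C1_coords J S (\<lambda>\<epsilon> t. snd c (Z \<epsilon> t))"
  shows "C1_family A I J Z"
proof -
  have loc': "\<exists>S. openin (top_of_set (I \<times> J)) S \<and> p \<in> S \<and> S \<subseteq> {(\<epsilon>, t) \<in> I \<times> J. Z \<epsilon> t \<in> fst d} \<and>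
      continuous_on S (\<lambda>(\<epsilon>, t). snd d (Z \<epsilon> t)) \<and> C1_coords J S (\<lambda>\<epsilon> t. snd d (Z \<epsilon> t))"
    if d: "d \<in> A" and p: "p \<in> {(\<epsilon>, t) \<in> I \<times> J. Z \<epsilon> t \<in> fst d}" for d p
  proof -
    obtain S c where c: "c \<in> A" and S: "openin (top_of_set (I \<times> J)) S" "p \<in> S"
      and Zc: "\<forall>(\<epsilon>, t)\<in>S. Z \<epsilon> t \<in> fst c" and cont: "continuous_on S (\<lambda>(\<epsilon>, t). snd c (Z \<epsilon> t))"
      and C1: "C1_coords J S (\<lambda>\<epsilon> t. snd c (Z \<epsilon> t))"
      using loc[of p] p by blast
    \<comment> \<open>\<open>R\<close> is the part of the patch where the family lies in both
      charts. As the preimage of the open overlap \<open>V\<close> under continuous coordinates it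
      is relatively open.\<close>
    define V where "V = snd c ` (fst c \<inter> fst d)"
    define R where "R = S \<inter> (\<lambda>(\<epsilon>, t). snd c (Z \<epsilon> t)) -` V"
    have V: "open V" unfolding V_def by (rule open_overlap[OF c d])
    have R_iff: "(\<epsilon>, t) \<in> R \<longleftrightarrow> (\<epsilon>, t) \<in> S \<and> Z \<epsilon> t \<in> fst d" for \<epsilon> t
      using Zc snd_mem_overlap[OF c, of "Z \<epsilon> t" d] by (auto simp: R_def V_def)
    have R: "openin (top_of_set (I \<times> J)) R"
      using continuous_openin_preimage_gen[OF cont V] S(1) unfolding R_def by (rule openin_trans)
    have contR: "continuous_on R (\<lambda>(\<epsilon>, t). snd c (Z \<epsilon> t))"
      using cont by (rule continuous_on_subset) (auto simp: R_def)
    have eq: "transition c d (snd c (Z \<epsilon> t)) = snd d (Z \<epsilon> t)" if "(\<epsilon>, t) \<in> R" for \<epsilon> t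
      using that Zc c unfolding R_iff by auto
    have RV: "snd c (Z \<epsilon> t) \<in> V" if "(\<epsilon>, t) \<in> R" for \<epsilon> t
      using that by (simp add: R_def)
    have "C1_coords J R (\<lambda>\<epsilon> t. transition c d (snd c (Z \<epsilon> t)))"
      using C1_coords_subset[OF C1, of R]
      by (intro C1_coords_compose[OF basis V transition_Ck[OF c d, folded V_def] _ contR RV])
        (auto simp: R_def)
    hence "C1_coords J R (\<lambda>\<epsilon> t. snd d (Z \<epsilon> t))"
      by (rule C1_coords_cong[OF I R]) (rule eq)
    moreover have "continuous_on R (\<lambda>p. transition c d ((\<lambda>(\<epsilon>, t). snd c (Z \<epsilon> t)) p))"
      by (rule continuous_on_compose2[OF Ck_on_continuous[OF transition_Ck[OF c d]] contR])
        (use RV in \<open>auto simp: V_def\<close>)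
    hence "continuous_on R (\<lambda>(\<epsilon>, t). snd d (Z \<epsilon> t))"
      by (rule continuous_on_eq) (use eq in auto)
    moreover have "p \<in> R" using p S(2) by (cases p) (auto simp: R_iff)
    moreover have "R \<subseteq> {(\<epsilon>, t) \<in> I \<times> J. Z \<epsilon> t \<in> fst d}"
      using openin_imp_subset[OF R] by (auto simp: R_iff)
    ultimately show ?thesis using R by blast
  qed
  have op: "openin (top_of_set (I \<times> J)) {p\<in>I \<times> J. (\<lambda>(\<epsilon>, t). Z \<epsilon> t) p \<in> fst d \<and> snd d ((\<lambda>(\<epsilon>, t). Z \<epsilon> t) p) \<in> W}"
    (is "openin _ ?O") if d: "d \<in> A" and W: "open W" for d W
  proof (subst openin_subopen, intro ballI)
    fix p assume p: "p \<in> ?O"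
    obtain S where S: "openin (top_of_set (I \<times> J)) S" "p \<in> S"
      "S \<subseteq> {(\<epsilon>, t) \<in> I \<times> J. Z \<epsilon> t \<in> fst d}" "continuous_on S (\<lambda>(\<epsilon>, t). snd d (Z \<epsilon> t))"
      using loc'[OF d, of p] p by auto
    have "openin (top_of_set (I \<times> J)) (S \<inter> (\<lambda>(\<epsilon>, t). snd d (Z \<epsilon> t)) -` W)"
      using continuous_openin_preimage_gen[OF S(4) W] S(1) by (rule openin_trans)
    moreover have "S \<inter> (\<lambda>(\<epsilon>, t). snd d (Z \<epsilon> t)) -` W \<subseteq> ?O" using S(3) by auto
    moreover have "p \<in> S \<inter> (\<lambda>(\<epsilon>, t). snd d (Z \<epsilon> t)) -` W" using S(2) p by auto
    ultimately show "\<exists>T. openin (top_of_set (I \<times> J)) T \<and> p \<in> T \<and> T \<subseteq> ?O" by blast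
  qed
  have "(\<lambda>(\<epsilon>, t). Z \<epsilon> t) \<in> I \<times> J \<rightarrow> carrier_of A"
  proof
    fix p assume "p \<in> I \<times> J"
    from loc[OF this] show "(\<lambda>(\<epsilon>, t). Z \<epsilon> t) p \<in> carrier_of A" by (fastforce intro: mem_carrier)
  qed
  with op have cont: "continuous_map (top_of_set (I \<times> J)) (atlas_topology A) (\<lambda>(\<epsilon>, t). Z \<epsilon> t)"
    unfolding continuous_map_atlas_topology_iff by blast
  have "C1_coords J {(\<epsilon>, t) \<in> I \<times> J. Z \<epsilon> t \<in> fst d} (\<lambda>\<epsilon> t. snd d (Z \<epsilon> t))" if d: "d \<in> A" for d
  proof (rule C1_coords_glue[OF I J])
    have "{(\<epsilon>, t) \<in> I \<times> J. Z \<epsilon> t \<in> fst d} = {p\<in>I \<times> J. (\<lambda>(\<epsilon>, t). Z \<epsilon> t) p \<in> fst d}" by auto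
    thus "openin (top_of_set (I \<times> J)) {(\<epsilon>, t) \<in> I \<times> J. Z \<epsilon> t \<in> fst d}"
      using openin_chart_preimage[OF cont d] by simp
  qed (use loc'[OF d] in blast)+
  with cont show ?thesis unfolding C1_family_iff by blast
qed

text \<open>A curve is a family that is constant in \<epsilon>, so the transfer between charts need
  not be repeated.\<close>

lemma C1_curveI:
  assumes J: "\<And>t. t \<in> J \<Longrightarrow> at t within J \<noteq> bot"
    and loc: "\<And>t. t \<in> J \<Longrightarrow> \<exists>N. \<exists>c\<in>A. openin (top_of_set J) N \<and> t \<in> N \<and>
      (\<forall>s\<in>N. \<gamma> s \<in> fst c) \<and> C1_on J N (\<lambda>s. snd c (\<gamma> s))"
  shows "C1_curve A J \<gamma>"
proof -
  have "C1_family A UNIV J (\<lambda>\<epsilon>. \<gamma>)"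
  proof (rule C1_familyI[OF open_UNIV J])
    fix p :: "real \<times> real" assume p: "p \<in> UNIV \<times> J"
    then obtain N c where c: "c \<in> A" and N: "openin (top_of_set J) N" "snd p \<in> N"
      "\<forall>s\<in>N. \<gamma> s \<in> fst c" "C1_on J N (\<lambda>s. snd c (\<gamma> s))"
      using loc[of "snd p"] by auto
    obtain D where D: "continuous_on N D"
      "\<And>t. t \<in> N \<Longrightarrow> ((\<lambda>s. snd c (\<gamma> s)) has_vector_derivative D t) (at t within J)"
      using N(4) unfolding C1_on_def by blast
    have NJ: "N \<subseteq> J" using openin_imp_subset[OF N(1)] .
    have "continuous_on N (\<lambda>s. snd c (\<gamma> s))"
      unfolding continuous_on_eq_continuous_within
      using D(2) NJ by (meson continuous_within_subset has_vector_derivative_continuous)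
    hence "continuous_on (UNIV \<times> N) (\<lambda>p. snd c (\<gamma> (snd p)))"
      by (rule continuous_on_compose2) (auto intro!: continuous_intros)
    moreover have "C1_coords J (UNIV \<times> N) (\<lambda>\<epsilon> t. snd c (\<gamma> t))"
    proof (rule C1_coordsI)
      have "continuous_on (UNIV \<times> N) (\<lambda>p. D (snd p))"
        by (rule continuous_on_compose2[OF D(1)]) (auto intro!: continuous_intros)
      thus "continuous_on (UNIV \<times> N) (\<lambda>(\<epsilon>, t). D t)" by (simp add: case_prod_beta)
      show "continuous_on (UNIV \<times> N) (\<lambda>(\<epsilon>, t). 0::'a)" by (simp add: case_prod_beta)
      thus "continuous_on (UNIV \<times> N) (\<lambda>(\<epsilon>, t). 0::'a)" .
    qed (use D(2) in auto)
    moreover have "openin (top_of_set (UNIV \<times> J)) (UNIV \<times> N)"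
      using N(1) by (simp add: openin_Times)
    ultimately show "\<exists>S. \<exists>c\<in>A. openin (top_of_set (UNIV \<times> J)) S \<and> p \<in> S \<and>
      (\<forall>(\<epsilon>, t)\<in>S. \<gamma> t \<in> fst c) \<and> continuous_on S (\<lambda>(\<epsilon>, t). snd c (\<gamma> t)) \<and>
      C1_coords J S (\<lambda>\<epsilon> t. snd c (\<gamma> t))"
      using c N by (intro exI[of _ "UNIV \<times> N"] bexI[of _ c]) (auto simp: case_prod_beta mem_Times_iff)
  qed
  thus ?thesis by (rule C1_family_curve) simp
qed

text \<open>By the chain rule for transition maps, the velocity computed in one chart determines its
  representatives in all others. Membership in \<open>fst c\<close> on a relative neighbourhood is
  needed for the coordinates to represent the curve there.\<close>

lemma velocity_eq_chart_vector:
  assumes c: "c \<in> A" and J: "at t within J \<noteq> bot" and N: "openin (top_of_set J) N" "t \<in> N"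
    and \<gamma>: "\<And>s. s \<in> N \<Longrightarrow> \<gamma> s \<in> fst c"
    and v: "((\<lambda>s. snd c (\<gamma> s)) has_vector_derivative v) (at t within J)"
  shows "velocity A J \<gamma> t = (\<gamma> t, chart_vector A c (\<gamma> t) v)"
proof -
  have "vector_derivative (snd d \<circ> \<gamma>) (at t within J) = transition_deriv c d (\<gamma> t) v"
    if d: "d \<in> A" "\<gamma> t \<in> fst d" for d
  proof (rule vector_derivative_within[OF J])
    have "((\<lambda>s. transition c d (snd c (\<gamma> s))) has_vector_derivative transition_deriv c d (\<gamma> t) v) (at t within J)"
      by (rule has_vector_derivative_chain[OF v transition_has_derivative[OF c d(1) \<gamma>[OF N(2)] d(2)]])
    thus "((snd d \<circ> \<gamma>) has_vector_derivative transition_deriv c d (\<gamma> t) v) (at t within J)"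
      by (subst has_vector_derivative_cong_local[OF N]) (use \<gamma> c in auto)
  qed
  thus ?thesis
    unfolding velocity_def chart_vector_def
    by (intro arg_cong[where f = "Pair (\<gamma> t)"] ext) (simp del: comp_apply)
qed

end

subsection \<open>Variations supported in one chart\<close>

lemma C1_on_cong:
  assumes "openin (top_of_set J) N" "C1_on J N f" "\<And>t. t \<in> N \<Longrightarrow> f t = g t"
  shows "C1_on J N g"
proof -
  obtain D where D: "continuous_on N D" "\<And>t. t \<in> N \<Longrightarrow> (f has_vector_derivative D t) (at t within J)"
    using assms(2) unfolding C1_on_def by blast
  have "(g has_vector_derivative D t) (at t within J)" if "t \<in> N" for t
    using has_vector_derivative_cong_local[OF assms(1) that assms(3)] D(2)[OF that] by simp
  with D(1) show ?thesis unfolding C1_on_def by blast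
qed

lemma C1_on_subset: "C1_on J S f \<Longrightarrow> R \<subseteq> S \<Longrightarrow> C1_on J R f"
  unfolding C1_on_def by (meson continuous_on_subset subsetD)

lemma C1_on_Pair:
  assumes "C1_on J S f" "C1_on J S g"
  shows "C1_on J S (\<lambda>t. (f t, g t))"
proof -
  obtain D D' where "continuous_on S D" "\<And>t. t \<in> S \<Longrightarrow> (f has_vector_derivative D t) (at t within J)"
    "continuous_on S D'" "\<And>t. t \<in> S \<Longrightarrow> (g has_vector_derivative D' t) (at t within J)"
    using assms unfolding C1_on_def by metis
  thus ?thesis
    unfolding C1_on_def
    by (intro exI[of _ "\<lambda>t. (D t, D' t)"]) (auto intro: continuous_on_Pair has_vector_derivative_Pair)
qed

lemma C1_on_imp_continuous_on:
  assumes "C1_on J S f" "S \<subseteq> J"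
  shows "continuous_on S f"
  unfolding continuous_on_eq_continuous_within
proof
  fix t assume "t \<in> S"
  with assms(1) obtain d where "(f has_vector_derivative d) (at t within J)"
    unfolding C1_on_def by blast
  thus "continuous (at t within S) f"
    using assms(2) continuous_within_subset has_vector_derivative_continuous by blast
qed

text \<open>The tube lemma: compactness of \<open>K\<close> gives one range of \<epsilon> that works
  for all times at once.\<close>

lemma uniform_segment_in_open:
  fixes y w :: "real \<Rightarrow> 'a::real_normed_vector"
  assumes "compact K" "continuous_on K y" "continuous_on K w" "open V" "\<And>t. t \<in> K \<Longrightarrow> y t \<in> V"
  obtains r where "r > 0" "\<And>\<epsilon> t. \<epsilon> \<in> {-r<..<r} \<Longrightarrow> t \<in> K \<Longrightarrow> y t + \<epsilon> *\<^sub>R w t \<in> V"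
proof -
  have "continuous_on (UNIV \<times> K) (\<lambda>p::real \<times> real. y (snd p) + fst p *\<^sub>R w (snd p))"
    by (intro continuous_intros continuous_on_compose2[OF assms(2)] continuous_on_compose2[OF assms(3)]) auto
  from continuous_openin_preimage_gen[OF this assms(4)]
  obtain W where W: "open W" "(UNIV \<times> K) \<inter> (\<lambda>p. y (snd p) + fst p *\<^sub>R w (snd p)) -` V = (UNIV \<times> K) \<inter> W"
    unfolding openin_open by blast
  have "{0} \<times> K \<subseteq> (UNIV \<times> K) \<inter> (\<lambda>p. y (snd p) + fst p *\<^sub>R w (snd p)) -` V"
    using assms(5) by auto
  hence "{0} \<times> K \<subseteq> W" using W(2) by blast
  from Elementary_Topology.tube_lemma[OF assms(1) W(1) this]
  obtain X0 where X0: "(0::real) \<in> X0" "open X0" "X0 \<times> K \<subseteq> W" by blast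
  then obtain r where r: "r > 0" "\<And>\<epsilon>. dist \<epsilon> 0 < r \<Longrightarrow> \<epsilon> \<in> X0"
    unfolding open_dist by blast
  show thesis
  proof (rule that[OF r(1)])
    fix \<epsilon> t assume "\<epsilon> \<in> {-r<..<r}" "t \<in> K"
    hence "(\<epsilon>, t) \<in> (UNIV \<times> K) \<inter> W" using r(2)[of \<epsilon>] X0(3) by auto
    thus "y t + \<epsilon> *\<^sub>R w t \<in> V" unfolding W(2)[symmetric] by simp
  qed
qed

lemma at_within_Icc_neq_bot: "0 < T \<Longrightarrow> t \<in> {0..T} \<Longrightarrow> at t within {0..T::real} \<noteq> bot"
  by (simp add: trivial_limit_within islimpt_Icc)

text \<open>Stated for an arbitrary atlas and used for that of the cotangent bundle. Two relatively
  open sets of times cover the interval: those with \<open>z t\<close> in the chart, which include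
  \<open>K\<close>, and the complement of the closed set \<open>K\<close>. On their overlap \<phi>
  vanishes, so the chart formula and the unvaried curve agree.\<close>

locale chart_variation = smooth_atlas E A
  for E :: "'a::real_inner set" and A :: "('m, 'a) chart set" +
  fixes T :: real and z :: "real \<Rightarrow> 'm" and k :: "('m, 'a) chart" and K :: "real set"
    and \<phi> \<phi>' :: "real \<Rightarrow> real" and w :: 'a and r :: real
  assumes T: "T > 0"
    and curve: "C1_curve A {0..T} z"
    and chart: "k \<in> A"
    and closed_K: "closed K"
    and K_subset: "K \<subseteq> {0..T}"
    and z_K: "t \<in> K \<Longrightarrow> z t \<in> fst k"
    and \<phi>_deriv: "(\<phi> has_real_derivative \<phi>' t) (at t)"
    and \<phi>'_continuous: "continuous_on UNIV \<phi>'"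
    and \<phi>_support: "t \<in> {0..T} \<Longrightarrow> t \<notin> K \<Longrightarrow> \<phi> t = 0"
    and r: "r > 0"
    and segment: "\<epsilon> \<in> {-r<..<r} \<Longrightarrow> t \<in> K \<Longrightarrow> snd k (z t) + \<epsilon> *\<^sub>R \<phi> t *\<^sub>R w \<in> snd k ` fst k"
begin

definition family :: "real \<Rightarrow> real \<Rightarrow> 'm" where
  "family \<epsilon> t = (if t \<in> K then chart_inv k (snd k (z t) + \<epsilon> *\<^sub>R \<phi> t *\<^sub>R w) else z t)"

definition field :: "real \<Rightarrow> 'm \<times> ('m, 'a) tvec" where
  "field t = (z t, if z t \<in> fst k then chart_vector A k (z t) (\<phi> t *\<^sub>R w) else (\<lambda>_. 0))"

definition U :: "real set" where "U = {t\<in>{0..T}. z t \<in> fst k}"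

lemma continuous_map_curve: "continuous_map (top_of_set {0..T}) (atlas_topology A) z"
  using curve unfolding C1_curve_def by blast

lemma C1_on_curve: "c \<in> A \<Longrightarrow> C1_on {0..T} {t\<in>{0..T}. z t \<in> fst c} (\<lambda>t. snd c (z t))"
  using curve unfolding C1_curve_def by (auto simp: o_def)

lemma openin_U: "openin (top_of_set {0..T}) U"
  unfolding U_def by (rule openin_chart_preimage[OF continuous_map_curve chart])

lemma K_subset_U: "K \<subseteq> U"
  using K_subset z_K by (auto simp: U_def)

lemma \<phi>_continuous: "continuous_on S \<phi>"
  by (rule DERIV_continuous_on[of S \<phi> \<phi>']) (rule has_field_derivative_at_within[OF \<phi>_deriv])

lemma \<phi>'_continuous_on: "continuous_on S \<phi>'"
  using \<phi>'_continuous by (rule continuous_on_subset) simp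

lemma \<phi>_vector_deriv: "(\<phi> has_vector_derivative \<phi>' t) (at t within S)"
  using \<phi>_deriv[of t] by (metis has_real_derivative_iff_has_vector_derivative has_vector_derivative_at_within)

text \<open>Outside \<open>K\<close> the displacement is zero, so the condition extends from
  \<open>K\<close> to the relatively open set \<open>U\<close>, on which derivatives can be
  taken.\<close>

lemma segment_U: "\<epsilon> \<in> {-r<..<r} \<Longrightarrow> t \<in> U \<Longrightarrow> snd k (z t) + \<epsilon> *\<^sub>R \<phi> t *\<^sub>R w \<in> snd k ` fst k"
  using segment \<phi>_support by (cases "t \<in> K") (auto simp: U_def)

lemma family_U:
  assumes "\<epsilon> \<in> {-r<..<r}" "t \<in> U"
  shows "family \<epsilon> t = chart_inv k (snd k (z t) + \<epsilon> *\<^sub>R \<phi> t *\<^sub>R w)"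
    and "family \<epsilon> t \<in> fst k"
    and "snd k (family \<epsilon> t) = snd k (z t) + \<epsilon> *\<^sub>R \<phi> t *\<^sub>R w"
proof -
  show *: "family \<epsilon> t = chart_inv k (snd k (z t) + \<epsilon> *\<^sub>R \<phi> t *\<^sub>R w)"
    using assms(2) \<phi>_support chart by (cases "t \<in> K") (auto simp: family_def U_def)
  show "family \<epsilon> t \<in> fst k" "snd k (family \<epsilon> t) = snd k (z t) + \<epsilon> *\<^sub>R \<phi> t *\<^sub>R w"
    unfolding * using segment_U[OF assms] by (rule chart_inv_mem snd_chart_inv)+
qed

lemma family_off_K: "t \<notin> K \<Longrightarrow> family \<epsilon> t = z t"
  by (simp add: family_def)

lemma family_0: "family 0 t = z t"
  using z_K chart by (simp add: family_def)

lemma family_C1: "C1_family A {-r<..<r} {0..T} family"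
proof (rule C1_familyI)
  show "open {-r<..<r}" by simp
  show "at t within {0..T} \<noteq> bot" if "t \<in> {0..T}" for t
    using at_within_Icc_neq_bot[OF T that] .
next
  fix p assume p: "p \<in> {-r<..<r} \<times> {0..T}"
  let ?P = "\<lambda>S c. openin (top_of_set ({-r<..<r} \<times> {0..T})) S \<and> p \<in> S \<and>
      (\<forall>(\<epsilon>, t)\<in>S. family \<epsilon> t \<in> fst c) \<and> continuous_on S (\<lambda>(\<epsilon>, t). snd c (family \<epsilon> t)) \<and>
      C1_coords {0..T} S (\<lambda>\<epsilon> t. snd c (family \<epsilon> t))"
  show "\<exists>S. \<exists>c\<in>A. ?P S c"
  proof (cases "snd p \<in> K")
    case True
    \<comment> \<open>On all of \<open>U\<close>, not just on \<open>K\<close>, the coordinates are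
      affine in \<epsilon>; \<open>U\<close> is relatively open, so this is a legitimate patch even
      at the boundary of \<open>K\<close>.\<close>
    define S where "S = {-r<..<r} \<times> U"
    have S: "openin (top_of_set ({-r<..<r} \<times> {0..T})) S"
      unfolding S_def by (intro openin_Times openin_U) simp
    obtain D where D: "continuous_on U D"
      "\<And>t. t \<in> U \<Longrightarrow> ((\<lambda>t. snd k (z t)) has_vector_derivative D t) (at t within {0..T})"
      using C1_on_curve[OF chart] unfolding C1_on_def U_def by blast
    have cy: "continuous_on U (\<lambda>t. snd k (z t))"
      using C1_on_imp_continuous_on[OF C1_on_curve[OF chart]] unfolding U_def by blast
    let ?Y = "\<lambda>\<epsilon> t. snd k (z t) + \<epsilon> *\<^sub>R \<phi> t *\<^sub>R w"
    have cp: "continuous_on S (\<lambda>p. g (snd p))" if "continuous_on U g" for g :: "real \<Rightarrow> 'b::topological_space"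
      by (rule continuous_on_compose2[OF that]) (auto simp: S_def intro!: continuous_intros)
    have cont: "continuous_on S (\<lambda>(\<epsilon>, t). ?Y \<epsilon> t)"
      unfolding case_prod_beta by (intro continuous_intros cp cy \<phi>_continuous)
    have "C1_coords {0..T} S ?Y"
    proof (rule C1_coordsI)
      show "continuous_on S (\<lambda>(\<epsilon>, t). D t + \<epsilon> *\<^sub>R \<phi>' t *\<^sub>R w)"
        unfolding case_prod_beta by (intro continuous_intros cp D(1) \<phi>'_continuous_on)
      show "continuous_on S (\<lambda>(\<epsilon>, t). \<phi> t *\<^sub>R w)"
        unfolding case_prod_beta by (intro continuous_intros cp \<phi>_continuous)
      show "continuous_on S (\<lambda>(\<epsilon>, t). \<phi>' t *\<^sub>R w)"
        unfolding case_prod_beta by (intro continuous_intros cp \<phi>'_continuous_on)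
    next
      fix \<epsilon> t assume "(\<epsilon>, t) \<in> S"
      hence t: "t \<in> U" by (simp add: S_def)
      show "(?Y \<epsilon> has_vector_derivative D t + \<epsilon> *\<^sub>R \<phi>' t *\<^sub>R w) (at t within {0..T})"
        using \<phi>_deriv[of t, THEN has_field_derivative_at_within, of "{0..T}"]
        by (auto intro!: derivative_eq_intros D(2)[OF t])
      show "((\<lambda>\<eta>. ?Y \<eta> t) has_vector_derivative \<phi> t *\<^sub>R w) (at \<epsilon>)"
        by (auto intro!: derivative_eq_intros)
      show "((\<lambda>\<eta>. D t + \<eta> *\<^sub>R \<phi>' t *\<^sub>R w) has_vector_derivative \<phi>' t *\<^sub>R w) (at \<epsilon>)"
        by (auto intro!: derivative_eq_intros)
    qed
    hence "C1_coords {0..T} S (\<lambda>\<epsilon> t. snd k (family \<epsilon> t))"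
      by (rule C1_coords_cong[OF open_greaterThanLessThan S]) (auto simp: S_def family_U(3))
    moreover have "continuous_on S (\<lambda>(\<epsilon>, t). snd k (family \<epsilon> t))"
      by (rule continuous_on_eq[OF cont]) (auto simp: S_def family_U(3))
    moreover have "p \<in> S" using p True K_subset_U by (auto simp: S_def)
    moreover have "\<forall>(\<epsilon>, t)\<in>S. family \<epsilon> t \<in> fst k" by (auto simp: S_def family_U(2))
    ultimately have "?P S k" using S by (intro conjI)
    thus ?thesis using chart by blast
  next
    case False
    have "z (snd p) \<in> carrier_of A"
      using continuous_map_curve p unfolding continuous_map_atlas_topology_iff by auto
    then obtain c where c: "c \<in> A" "z (snd p) \<in> fst c" by (auto simp: carrier_of_def)
    \<comment> \<open>Away from \<open>K\<close> the family does not depend on \<epsilon>, so any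
      chart at \<open>z\<close> works, with vanishing \<epsilon>-derivatives.\<close>
    define N where "N = {t\<in>{0..T}. z t \<in> fst c} - K"
    have "openin (top_of_set {0..T}) ({t\<in>{0..T}. z t \<in> fst c} \<inter> - K)"
      using openin_chart_preimage[OF continuous_map_curve c(1)] closed_K
      by (intro openin_Int_open) auto
    hence N: "openin (top_of_set {0..T}) N" by (simp add: N_def Diff_eq)
    define S where "S = {-r<..<r} \<times> N"
    have S: "openin (top_of_set ({-r<..<r} \<times> {0..T})) S"
      unfolding S_def by (intro openin_Times N) simp
    have C1: "C1_on {0..T} N (\<lambda>t. snd c (z t))"
      using C1_on_curve[OF c(1)] by (rule C1_on_subset) (auto simp: N_def)
    then obtain D where D: "continuous_on N D"
      "\<And>t. t \<in> N \<Longrightarrow> ((\<lambda>t. snd c (z t)) has_vector_derivative D t) (at t within {0..T})"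
      unfolding C1_on_def by blast
    have cy: "continuous_on N (\<lambda>t. snd c (z t))"
      using C1_on_imp_continuous_on[OF C1] unfolding N_def by blast
    have cp: "continuous_on S (\<lambda>p. g (snd p))" if "continuous_on N g" for g :: "real \<Rightarrow> 'b::topological_space"
      by (rule continuous_on_compose2[OF that]) (auto simp: S_def intro!: continuous_intros)
    have "C1_coords {0..T} S (\<lambda>\<epsilon> t. snd c (z t))"
    proof (rule C1_coordsI)
      show "continuous_on S (\<lambda>(\<epsilon>, t). D t)" unfolding case_prod_beta by (intro cp D(1))
      show "continuous_on S (\<lambda>(\<epsilon>, t). 0::'a)" by (simp add: case_prod_beta)
      thus "continuous_on S (\<lambda>(\<epsilon>, t). 0::'a)" .
    qed (use D(2) in \<open>auto simp: S_def\<close>)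
    hence "C1_coords {0..T} S (\<lambda>\<epsilon> t. snd c (family \<epsilon> t))"
      by (rule C1_coords_cong[OF open_greaterThanLessThan S]) (auto simp: S_def N_def family_off_K)
    moreover have "continuous_on S (\<lambda>(\<epsilon>, t). snd c (family \<epsilon> t))"
      by (rule continuous_on_eq[OF cp[OF cy]]) (auto simp: S_def N_def family_off_K)
    moreover have "p \<in> S" using p False c by (auto simp: S_def N_def)
    moreover have "\<forall>(\<epsilon>, t)\<in>S. family \<epsilon> t \<in> fst c" by (auto simp: S_def N_def family_off_K)
    ultimately have "?P S c" using S by (intro conjI)
    thus ?thesis using c(1) by blast
  qed
qed

lemma field_U: "t \<in> U \<Longrightarrow> field t = (z t, chart_vector A k (z t) (\<phi> t *\<^sub>R w))"
  by (simp add: field_def U_def)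

lemma field_off_K: "t \<in> {0..T} \<Longrightarrow> t \<notin> K \<Longrightarrow> field t = (z t, \<lambda>_. 0)"
  using \<phi>_support chart_vector_0[OF chart] by (simp add: field_def)

lemma velocity_family:
  assumes t: "t \<in> {0..T}"
  shows "velocity A UNIV (\<lambda>\<epsilon>. family \<epsilon> t) 0 = field t"
proof (cases "t \<in> U")
  case True
  have "((\<lambda>\<epsilon>. snd k (z t) + \<epsilon> *\<^sub>R \<phi> t *\<^sub>R w) has_vector_derivative \<phi> t *\<^sub>R w) (at 0)"
    by (auto intro!: derivative_eq_intros)
  hence "((\<lambda>\<epsilon>. snd k (family \<epsilon> t)) has_vector_derivative \<phi> t *\<^sub>R w) (at 0)"
    by (rule has_vector_derivative_transform_within_open[of _ _ _ "{-r<..<r}"])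
      (use r True in \<open>auto simp: family_U(3)\<close>)
  from velocity_eq_chart_vector[OF chart _ _ _ _ this, of "{-r<..<r}"]
  show ?thesis using r by (simp add: field_U[OF True] family_0 family_U(2)[OF _ True])
next
  case False
  hence K: "t \<notin> K" using K_subset_U by blast
  have "z t \<in> carrier_of A"
    using continuous_map_curve t unfolding continuous_map_atlas_topology_iff by auto
  then obtain c where c: "c \<in> A" "z t \<in> fst c" by (auto simp: carrier_of_def)
  have "velocity A UNIV (\<lambda>\<epsilon>. z t) 0 = (z t, chart_vector A c (z t) 0)"
    by (rule velocity_eq_chart_vector[of c _ _ UNIV]) (use c in auto)
  thus ?thesis
    by (simp add: family_off_K[OF K] field_off_K[OF t K] chart_vector_0[OF c])
qed

text \<open>The same two patches as for the family, now in the tangent atlas: the fibre coordinate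
  is \<open>\<phi> s *\<^sub>R w\<close> on \<open>U\<close> and \<open>0\<close> off
  \<open>K\<close>.\<close>

lemma field_C1: "C1_curve (tangent_atlas A) {0..T} field"
proof -
  interpret T: smooth_atlas "prod_basis E" "tangent_atlas A" by (rule smooth_atlas_tangent)
  show ?thesis
  proof (rule T.C1_curveI)
    show "at t within {0..T} \<noteq> bot" if "t \<in> {0..T}" for t
      using at_within_Icc_neq_bot[OF T that] .
  next
    fix t assume t: "t \<in> {0..T}"
    let ?P = "\<lambda>N c. openin (top_of_set {0..T}) N \<and> t \<in> N \<and> (\<forall>s\<in>N. field s \<in> fst c) \<and>
      C1_on {0..T} N (\<lambda>s. snd c (field s))"
    show "\<exists>N. \<exists>c\<in>tangent_atlas A. ?P N c"
    proof (cases "t \<in> K")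
      case True
      have "C1_on {0..T} U (\<lambda>s. (snd k (z s), \<phi> s *\<^sub>R w))"
      proof (rule C1_on_Pair)
        show "C1_on {0..T} U (\<lambda>s. snd k (z s))"
          using C1_on_curve[OF chart] unfolding U_def .
        have "continuous_on U (\<lambda>s. \<phi>' s *\<^sub>R w)" by (intro continuous_intros \<phi>'_continuous_on)
        moreover have "((\<lambda>s. \<phi> s *\<^sub>R w) has_vector_derivative \<phi>' s *\<^sub>R w) (at s within {0..T})" for s
          using \<phi>_deriv[of s, THEN has_field_derivative_at_within, of "{0..T}"]
          by (auto intro!: derivative_eq_intros)
        ultimately show "C1_on {0..T} U (\<lambda>s. \<phi> s *\<^sub>R w)" unfolding C1_on_def by blast
      qed
      hence "C1_on {0..T} U (\<lambda>s. snd (tangent_chart A k) (field s))"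
        by (rule C1_on_cong[OF openin_U])
          (use chart in \<open>auto simp: field_U, auto simp: U_def\<close>)
      moreover have "\<forall>s\<in>U. field s \<in> fst (tangent_chart A k)"
        using chart_vector_tangent[OF chart] by (auto simp: field_def U_def)
      ultimately have "?P U (tangent_chart A k)" using True K_subset_U openin_U by blast
      thus ?thesis using chart unfolding tangent_atlas_def by blast
    next
      case False
      have "z t \<in> carrier_of A"
        using continuous_map_curve t unfolding continuous_map_atlas_topology_iff by auto
      then obtain c where c: "c \<in> A" "z t \<in> fst c" by (auto simp: carrier_of_def)
      define N where "N = {t\<in>{0..T}. z t \<in> fst c} - K"
      have "openin (top_of_set {0..T}) ({t\<in>{0..T}. z t \<in> fst c} \<inter> - K)"
        using openin_chart_preimage[OF continuous_map_curve c(1)] closed_K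
        by (intro openin_Int_open) auto
      hence N: "openin (top_of_set {0..T}) N" by (simp add: N_def Diff_eq)
      have "C1_on {0..T} N (\<lambda>s. (snd c (z s), 0::'a))"
      proof (rule C1_on_Pair)
        show "C1_on {0..T} N (\<lambda>t. snd c (z t))"
          using C1_on_curve[OF c(1)] by (rule C1_on_subset) (auto simp: N_def)
        show "C1_on {0..T} N (\<lambda>t. 0::'a)"
          unfolding C1_on_def by (intro exI[of _ "\<lambda>_. 0"]) auto
      qed
      hence "C1_on {0..T} N (\<lambda>s. snd (tangent_chart A c) (field s))"
        by (rule C1_on_cong[OF N]) (auto simp: N_def field_off_K)
      moreover have "field s \<in> fst (tangent_chart A c)" if "s \<in> N" for s
        using zero_tangent[OF mem_carrier[OF c(1)]] that by (auto simp: N_def field_off_K)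
      ultimately have "?P N (tangent_chart A c)" using False c t N by (simp add: N_def)
      thus ?thesis using c(1) unfolding tangent_atlas_def by blast
    qed
  qed
qed

end

subsection \<open>The first variation of the action\<close>

text \<open>\<open>J\<close> may be a closed interval, so the product need not be open and
  smoothness only supplies a local extension \<open>g\<close>. The slices at fixed time are open,
  however, so derivatives in the second variable can be read off from \<open>g\<close>, including at
  end points of \<open>J\<close>.\<close>

lemma smooth_on_Times_partial:
  fixes f :: "'a::real_normed_vector \<times> 'b::real_normed_vector \<Rightarrow> 'c::real_normed_vector"
  assumes f: "smooth_on (J \<times> V) f" and V: "open V" and p: "t \<in> J" "y \<in> V"
  obtains W g where "open W" "(t, y) \<in> W" "Ck_on (Suc 0) W g" "\<And>p. p \<in> (J \<times> V) \<inter> W \<Longrightarrow> f p = g p"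
    "\<And>s x. (s, x) \<in> (J \<times> V) \<inter> W \<Longrightarrow>
      ((\<lambda>x. f (s, x)) has_derivative (\<lambda>v. frechet_derivative g (at (s, x)) (0, v))) (at x)"
proof -
  obtain W g where W: "open W" "(t, y) \<in> W" "Ck_on (Suc 0) W g" "\<And>p. p \<in> (J \<times> V) \<inter> W \<Longrightarrow> f p = g p"
    using f p unfolding smooth_on_def by (metis mem_Sigma_iff)
  show thesis
  proof (rule that[OF W])
    fix s x assume sx: "(s, x) \<in> (J \<times> V) \<inter> W"
    have o: "open (V \<inter> Pair s -` W)"
      using V W(1) by (intro open_Int open_vimage continuous_intros)
    have "((\<lambda>x. (s, x)) has_derivative (\<lambda>v. (0, v))) (at x)"
      by (intro has_derivative_Pair has_derivative_const has_derivative_ident)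
    from has_derivative_compose[OF this Ck_on_has_derivative[OF W(3)]] sx
    have "((\<lambda>x. g (s, x)) has_derivative (\<lambda>v. frechet_derivative g (at (s, x)) (0, v))) (at x)"
      by simp
    thus "((\<lambda>x. f (s, x)) has_derivative (\<lambda>v. frechet_derivative g (at (s, x)) (0, v))) (at x)"
      by (rule has_derivative_transform_within_open[OF _ o]) (use sx W(4) in auto)
  qed
qed

lemma smooth_on_Times_partial_derivative:
  fixes f :: "'a::real_normed_vector \<times> 'b::real_normed_vector \<Rightarrow> 'c::real_normed_vector"
  assumes f: "smooth_on (J \<times> V) f" and V: "open V" and "t \<in> J" "y \<in> V"
  shows "((\<lambda>x. f (t, x)) has_derivative frechet_derivative (\<lambda>x. f (t, x)) (at y)) (at y)"
proof (rule smooth_on_Times_partial[OF assms])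
  fix W g assume "(t, y) \<in> W" "\<And>s x. (s, x) \<in> (J \<times> V) \<inter> W \<Longrightarrow>
      ((\<lambda>x. f (s, x)) has_derivative (\<lambda>v. frechet_derivative g (at (s, x)) (0, v))) (at x)"
  hence "(\<lambda>x. f (t, x)) differentiable (at y)"
    using assms(3,4) unfolding differentiable_def by blast
  thus ?thesis by (simp add: frechet_derivative_works)
qed

lemma smooth_on_Times_partial_continuous:
  fixes f :: "'a::real_normed_vector \<times> 'b::real_normed_vector \<Rightarrow> 'c::real_normed_vector"
  assumes f: "smooth_on (J \<times> V) f" and V: "open V"
  shows "continuous_on (J \<times> V) (\<lambda>p. frechet_derivative (\<lambda>x. f (fst p, x)) (at (snd p)) w)"
proof (rule continuous_on_openin_cover)
  fix p assume "p \<in> J \<times> V"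
  hence "fst p \<in> J" "snd p \<in> V" by auto
  from f V this
  show "\<exists>R. openin (top_of_set (J \<times> V)) R \<and> p \<in> R \<and>
      continuous_on R (\<lambda>p. frechet_derivative (\<lambda>x. f (fst p, x)) (at (snd p)) w)"
  proof (rule smooth_on_Times_partial)
    fix W g assume W: "open W" "(fst p, snd p) \<in> W" "Ck_on (Suc 0) W g"
      "\<And>s x. (s, x) \<in> (J \<times> V) \<inter> W \<Longrightarrow>
      ((\<lambda>x. f (s, x)) has_derivative (\<lambda>v. frechet_derivative g (at (s, x)) (0, v))) (at x)"
    have "continuous_on ((J \<times> V) \<inter> W) (\<lambda>q. frechet_derivative g (at q) (0, w))"
      using W(3) by (auto intro: continuous_on_subset)
    moreover have "frechet_derivative g (at q) (0, w) = frechet_derivative (\<lambda>x. f (fst q, x)) (at (snd q)) w"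
      if "q \<in> (J \<times> V) \<inter> W" for q
      using frechet_derivative_at[OF W(4)[of "fst q" "snd q"]] that by (simp add: fun_eq_iff)
    ultimately have "continuous_on ((J \<times> V) \<inter> W) (\<lambda>q. frechet_derivative (\<lambda>x. f (fst q, x)) (at (snd q)) w)"
      by (rule continuous_on_eq)
    moreover have "openin (top_of_set (J \<times> V)) ((J \<times> V) \<inter> W)" using W(1) by (rule openin_open_Int)
    ultimately show ?thesis using \<open>p \<in> J \<times> V\<close> W(2) by (intro exI[of _ "(J \<times> V) \<inter> W"]) auto
  qed
qed

lemma vector_derivative_cong_local:
  assumes "openin (top_of_set J) N" "t \<in> N" "\<And>s. s \<in> N \<Longrightarrow> f s = g s"
  shows "vector_derivative f (at t within J) = vector_derivative g (at t within J)"
  unfolding vector_derivative_def using has_vector_derivative_cong_local[OF assms, where v = "_ :: 'a"] by simp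

section \<open>Base variation and duality pairing in canonical coordinates\<close>

context smooth_atlas
begin

lemma carrier_cotangent_iff:
  "p \<in> carrier_of (cotangent_atlas E A) \<longleftrightarrow>
     fst p \<in> carrier_of A \<and> snd p \<in> cotangent_space A (fst p)"
  by (auto simp: carrier_of_def cotangent_atlas_def)

lemma cotangent_chart_mem: "c \<in> A \<Longrightarrow> cotangent_chart E A c \<in> cotangent_atlas E A"
  by (simp add: cotangent_atlas_def)

lemma mem_cotangent_chartI:
  "p \<in> carrier_of (cotangent_atlas E A) \<Longrightarrow> fst p \<in> fst c \<Longrightarrow> p \<in> fst (cotangent_chart E A c)"
  by (simp add: carrier_cotangent_iff)

lemma carrier_cotangentE:
  assumes "p \<in> carrier_of (cotangent_atlas E A)"
  obtains c where "c \<in> A" "fst p \<in> fst c"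
proof -
  have "fst p \<in> carrier_of A" using assms by (simp add: carrier_cotangent_iff)
  thus thesis unfolding carrier_of_def using that by blast
qed

text \<open>In canonical coordinates the bundle projection is the first projection, so its tangent
  map keeps the first component of \<open>u\<close>.\<close>

lemma delta_q_chart_vector:
  assumes p: "p \<in> carrier_of (cotangent_atlas E A)" and c: "c \<in> A" "fst p \<in> fst c"
  shows "delta_q E A (p, chart_vector (cotangent_atlas E A) (cotangent_chart E A c) p u)
    = (fst p, chart_vector A c (fst p) (fst u))"
proof -
  interpret B: smooth_atlas "prod_basis E" "cotangent_atlas E A" by (rule smooth_atlas_cotangent)
  let ?B = "cotangent_atlas E A" and ?k = "cotangent_chart E A c"
  have k: "?k \<in> ?B" "p \<in> fst ?k" by (rule cotangent_chart_mem[OF c(1)], rule mem_cotangent_chartI[OF p c(2)])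
  \<comment> \<open>\<open>tangent_map\<close> computes in an arbitrarily chosen chart
    \<open>l\<close>, over a base chart \<open>b\<close> that may differ from \<open>c\<close>. The
    result is transported from \<open>c\<close> through \<open>b\<close> by the cocycle
    identity.\<close>
  define l where "l = (SOME l. l \<in> ?B \<and> p \<in> fst l)"
  have l: "l \<in> ?B" "p \<in> fst l" using someI[of "\<lambda>l. l \<in> ?B \<and> p \<in> fst l", OF conjI[OF k]] by (auto simp: l_def)
  then obtain b where b: "b \<in> A" "l = cotangent_chart E A b" "fst p \<in> fst b"
    by (auto simp: cotangent_atlas_def)
  have ob: "open (snd b ` (fst b \<inter> fst d) \<times> (UNIV::'a set))" if "d \<in> A" for d
    using open_overlap[OF b(1) that] by (simp add: open_Times)
  have l_inv: "fst (chart_inv l q) = chart_inv b (fst q)" if "fst q \<in> snd b ` fst b" for q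
    using cotangent_chart_inv[OF b(1) that, of "snd q"] by (simp add: b(2))
  have deriv: "frechet_derivative (snd d \<circ> fst \<circ> chart_inv l) (at (snd l p)) v
      = transition_deriv b d (fst p) (fst v)" if d: "d \<in> A" "fst p \<in> fst d" for d v
  proof -
    have "((\<lambda>q. transition b d (fst q)) has_derivative (\<lambda>v. transition_deriv b d (fst p) (fst v))) (at (snd l p))"
      by (rule has_derivative_compose[OF has_derivative_fst[OF has_derivative_ident]])
        (use transition_has_derivative[OF b(1) d(1) b(3) d(2)] in \<open>simp add: b(2) o_def\<close>)
    hence "((snd d \<circ> fst \<circ> chart_inv l) has_derivative (\<lambda>v. transition_deriv b d (fst p) (fst v))) (at (snd l p))"
      by (rule has_derivative_transform_within_open[OF _ ob[OF d(1)]])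
        (use b d in \<open>auto simp: l_inv[unfolded b(2)]\<close>)
    from frechet_derivative_at[OF this] show ?thesis by metis
  qed
  have "fst (transition_deriv ?k l p u) = transition_deriv c b (fst p) (fst u)"
  proof -
    have "((\<lambda>q. transition c b (fst q)) has_derivative (\<lambda>v. transition_deriv c b (fst p) (fst v))) (at (snd ?k p))"
      by (rule has_derivative_compose[OF has_derivative_fst[OF has_derivative_ident]])
        (use transition_has_derivative[OF c(1) b(1) c(2) b(3)] in \<open>simp add: o_def\<close>)
    hence 1: "((\<lambda>q. fst (transition ?k l q)) has_derivative (\<lambda>v. transition_deriv c b (fst p) (fst v))) (at (snd ?k p))"
    proof (rule has_derivative_transform_within_open)
      show "open (snd c ` (fst c \<inter> fst b) \<times> (UNIV::'a set))"
        using open_overlap[OF c(1) b(1)] by (simp add: open_Times)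
      show "snd ?k p \<in> snd c ` (fst c \<inter> fst b) \<times> UNIV" using c b by auto
      fix q assume "q \<in> snd c ` (fst c \<inter> fst b) \<times> (UNIV::'a set)"
      thus "transition c b (fst q) = fst (transition ?k l q)"
        using cotangent_chart_inv[OF c(1), of "fst q" "snd q"] by (auto simp: b(2))
    qed
    have 2: "((\<lambda>q. fst (transition ?k l q)) has_derivative (\<lambda>v. fst (transition_deriv ?k l p v))) (at (snd ?k p))"
      by (rule has_derivative_fst[OF B.transition_has_derivative[OF k(1) l(1) k(2) l(2)]])
    show ?thesis using has_derivative_unique[OF 1 2] by metis
  qed
  hence *: "fst (chart_vector ?B ?k p u l) = transition_deriv c b (fst p) (fst u)"
    using l by (simp add: chart_vector_def del: comp_apply)
  show ?thesis
    unfolding delta_q_def tangent_map_def split_conv l_def[symmetric] Let_def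
    by (intro arg_cong[where f = "Pair (fst p)"] ext)
      (simp add: chart_vector_def[of A] deriv * transition_deriv_comp[OF c(1) b(1)] c b(1,3)
        del: comp_apply)
qed

lemma delta_q_zero:
  assumes p: "p \<in> carrier_of (cotangent_atlas E A)"
  shows "delta_q E A (p, \<lambda>_. 0) = (fst p, \<lambda>_. 0)"
proof -
  interpret B: smooth_atlas "prod_basis E" "cotangent_atlas E A" by (rule smooth_atlas_cotangent)
  obtain c where c: "c \<in> A" "fst p \<in> fst c" using p by (rule carrier_cotangentE)
  from B.chart_vector_0[OF cotangent_chart_mem[OF c(1)] mem_cotangent_chartI[OF p c(2)]] delta_q_chart_vector[OF p c, of 0] chart_vector_0[OF c]
  show ?thesis by simp
qed

lemma pairing_chart_vector:
  assumes p: "p \<in> carrier_of (cotangent_atlas E A)" and c: "c \<in> A" "fst p \<in> fst c"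
  shows "pairing p (x, chart_vector A c (fst p) u) = momentum c p \<bullet> u"
  using covector_apply[of "snd p" "fst p", OF _ chart_vector_tangent[OF c] c] p c
  by (simp add: pairing_def carrier_cotangent_iff)

end

section \<open>The action integrand along a curve, in canonical coordinates\<close>

locale hamiltonian_system = smooth_atlas E A
  for E :: "'a::real_inner set" and A :: "('m, 'a) chart set" +
  fixes T :: real and H :: "real \<Rightarrow> 'm \<times> ('m, 'a) covec \<Rightarrow> real"
  assumes T_pos: "T > 0"
    and smooth_H: "smooth_time_dependent {0..T} (cotangent_atlas E A) H"
begin

abbreviation B :: "('m \<times> ('m, 'a) covec, 'a \<times> 'a) chart set" where
  "B \<equiv> cotangent_atlas E A"

abbreviation ct :: "('m, 'a) chart \<Rightarrow> ('m \<times> ('m, 'a) covec, 'a \<times> 'a) chart" where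
  "ct c \<equiv> cotangent_chart E A c"

sublocale B: smooth_atlas "prod_basis E" B
  by (rule smooth_atlas_cotangent)

definition lagrangian :: "(real \<Rightarrow> 'm \<times> ('m, 'a) covec) \<Rightarrow> real \<Rightarrow> real" where
  "lagrangian z t = pairing (z t) (velocity A {0..T} (fst \<circ> z) t) - H t (z t)"

definition H_chart :: "('m, 'a) chart \<Rightarrow> real \<times> ('a \<times> 'a) \<Rightarrow> real" where
  "H_chart c = (\<lambda>(t, y). H t (chart_inv (ct c) y))"

definition H_deriv :: "('m, 'a) chart \<Rightarrow> real \<Rightarrow> 'a \<times> 'a \<Rightarrow> 'a \<times> 'a \<Rightarrow> real" where
  "H_deriv c t y = frechet_derivative (\<lambda>y. H_chart c (t, y)) (at y)"

definition coord_deriv :: "('m, 'a) chart \<Rightarrow> (real \<Rightarrow> 'm \<times> ('m, 'a) covec) \<Rightarrow> real \<Rightarrow> 'a \<times> 'a" where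
  "coord_deriv c z t = vector_derivative (\<lambda>s. snd (ct c) (z s)) (at t within {0..T})"

definition chart_times :: "('m, 'a) chart \<Rightarrow> (real \<Rightarrow> 'm \<times> ('m, 'a) covec) \<Rightarrow> real set" where
  "chart_times c z = {t\<in>{0..T}. z t \<in> fst (ct c)}"

lemma smooth_H_chart: "c \<in> A \<Longrightarrow> smooth_on ({0..T} \<times> snd (ct c) ` fst (ct c)) (H_chart c)"
  using smooth_H cotangent_chart_mem unfolding smooth_time_dependent_def H_chart_def by blast

lemma open_ct_image: "c \<in> A \<Longrightarrow> open (snd (ct c) ` fst (ct c))"
  by (rule B.open_image[OF cotangent_chart_mem])

lemma H_deriv_has_derivative:
  assumes "c \<in> A" "t \<in> {0..T}" "y \<in> snd (ct c) ` fst (ct c)"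
  shows "((\<lambda>y. H_chart c (t, y)) has_derivative H_deriv c t y) (at y)"
  unfolding H_deriv_def
  by (rule smooth_on_Times_partial_derivative[OF smooth_H_chart[OF assms(1)] open_ct_image[OF assms(1)] assms(2,3)])

lemma H_deriv_continuous:
  assumes "c \<in> A"
  shows "continuous_on ({0..T} \<times> snd (ct c) ` fst (ct c)) (\<lambda>p. H_deriv c (fst p) (snd p) w)"
  unfolding H_deriv_def
  by (rule smooth_on_Times_partial_continuous[OF smooth_H_chart[OF assms] open_ct_image[OF assms]])

lemma H_chart_continuous:
  "c \<in> A \<Longrightarrow> continuous_on ({0..T} \<times> snd (ct c) ` fst (ct c)) (H_chart c)"
  by (rule smooth_on_imp_continuous_on[OF smooth_H_chart])

context
  fixes z :: "real \<Rightarrow> 'm \<times> ('m, 'a) covec"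
  assumes curve: "C1_curve B {0..T} z"
begin

lemma cont_z: "continuous_map (top_of_set {0..T}) (atlas_topology B) z"
  using curve unfolding C1_curve_def by blast

lemma z_carrier: "t \<in> {0..T} \<Longrightarrow> z t \<in> carrier_of B"
  using cont_z unfolding continuous_map_atlas_topology_iff by auto

lemma chart_times_iff: "t \<in> chart_times c z \<longleftrightarrow> t \<in> {0..T} \<and> fst (z t) \<in> fst c"
  using z_carrier unfolding chart_times_def by (auto simp: carrier_cotangent_iff)

lemma chart_times_cover:
  assumes "t \<in> {0..T}"
  obtains c where "c \<in> A" "t \<in> chart_times c z"
proof (rule carrier_cotangentE[OF z_carrier[OF assms]])
  fix c assume "c \<in> A" "fst (z t) \<in> fst c"
  thus thesis using that assms by (simp add: chart_times_iff)
qed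

lemma openin_chart_times: "c \<in> A \<Longrightarrow> openin (top_of_set {0..T}) (chart_times c z)"
  unfolding chart_times_def by (rule openin_chart_preimage[OF cont_z cotangent_chart_mem])

lemma
  assumes "c \<in> A"
  shows coord_deriv_has_derivative: "t \<in> chart_times c z \<Longrightarrow>
      ((\<lambda>s. snd (ct c) (z s)) has_vector_derivative coord_deriv c z t) (at t within {0..T})"
    and coord_deriv_continuous: "continuous_on (chart_times c z) (coord_deriv c z)"
    and coord_continuous: "continuous_on (chart_times c z) (\<lambda>s. snd (ct c) (z s))"
proof -
  have C1: "C1_on {0..T} (chart_times c z) (\<lambda>s. snd (ct c) (z s))"
    using curve cotangent_chart_mem[OF assms] unfolding C1_curve_def chart_times_def by (auto simp: o_def)
  then obtain D where D: "continuous_on (chart_times c z) D"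
    "\<And>t. t \<in> chart_times c z \<Longrightarrow> ((\<lambda>s. snd (ct c) (z s)) has_vector_derivative D t) (at t within {0..T})"
    unfolding C1_on_def by blast
  have eq: "coord_deriv c z t = D t" if "t \<in> chart_times c z" for t
    unfolding coord_deriv_def
    by (rule vector_derivative_within[OF at_within_Icc_neq_bot[OF T_pos] D(2)[OF that]])
      (use that in \<open>simp add: chart_times_def\<close>)
  show "((\<lambda>s. snd (ct c) (z s)) has_vector_derivative coord_deriv c z t) (at t within {0..T})"
    if "t \<in> chart_times c z" using D(2)[OF that] eq[OF that] by simp
  show "continuous_on (chart_times c z) (coord_deriv c z)"
    by (rule continuous_on_eq[OF D(1)]) (simp add: eq)
  show "continuous_on (chart_times c z) (\<lambda>s. snd (ct c) (z s))"
    by (rule C1_on_imp_continuous_on[OF C1]) (auto simp: chart_times_def)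
qed

text \<open>The derivative \<open>v\<close> is a parameter so that the formula serves the varied
  curves, whose coordinate velocity is known explicitly, as well as \<open>z\<close> with
  \<open>coord_deriv\<close>.\<close>

lemma lagrangian_eq:
  assumes c: "c \<in> A" and t: "t \<in> chart_times c z"
    and d: "((\<lambda>s. snd (ct c) (z s)) has_vector_derivative v) (at t within {0..T})"
  shows "lagrangian z t = snd (snd (ct c) (z t)) \<bullet> fst v - H_chart c (t, snd (ct c) (z t))"
proof -
  have tT: "t \<in> {0..T}" and tc: "fst (z t) \<in> fst c" using t unfolding chart_times_iff by auto
  have "((\<lambda>s. snd c (fst (z s))) has_vector_derivative fst v) (at t within {0..T})"
    using has_vector_derivative_chain[OF d has_derivative_fst[OF has_derivative_ident]] by simp
  hence "velocity A {0..T} (fst \<circ> z) t = ((fst \<circ> z) t, chart_vector A c ((fst \<circ> z) t) (fst v))"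
    by (intro velocity_eq_chart_vector[OF c at_within_Icc_neq_bot[OF T_pos tT] openin_chart_times[OF c] t])
      (auto simp: chart_times_iff)
  thus ?thesis
    using pairing_chart_vector[OF z_carrier[OF tT] c tc] B.inv_snd[OF cotangent_chart_mem[OF c], of "z t"] t
    by (simp add: lagrangian_def H_chart_def chart_times_def)
qed

lemma H_along_continuous:
  assumes "c \<in> A"
  shows "continuous_on (chart_times c z) (\<lambda>t. H_chart c (t, snd (ct c) (z t)))"
  by (rule continuous_on_compose2[OF H_chart_continuous[OF assms]
        continuous_on_Pair[OF continuous_on_id coord_continuous[OF assms]]])
    (auto simp: chart_times_def simp del: snd_cotangent_chart mem_cotangent_chart)

text \<open>Continuity is local and holds in each chart. It gives the integrability needed to split
  the action, although the curve may pass through several charts.\<close>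

lemma lagrangian_continuous: "continuous_on {0..T} (lagrangian z)"
proof (rule continuous_on_openin_cover)
  fix t assume "t \<in> {0..T}"
  then obtain c where c: "c \<in> A" "t \<in> chart_times c z" by (rule chart_times_cover)
  have "continuous_on (chart_times c z)
      (\<lambda>t. snd (snd (ct c) (z t)) \<bullet> fst (coord_deriv c z t) - H_chart c (t, snd (ct c) (z t)))"
    by (intro continuous_intros H_along_continuous coord_continuous coord_deriv_continuous c)
  hence "continuous_on (chart_times c z) (lagrangian z)"
    by (rule continuous_on_eq) (simp only: lagrangian_eq[OF c(1) _ coord_deriv_has_derivative[OF c(1)]])
  thus "\<exists>R. openin (top_of_set {0..T}) R \<and> t \<in> R \<and> continuous_on R (lagrangian z)"
    using c openin_chart_times by blast
qed

end

text \<open>The velocity sees only nearby values of the curve; hence the integrand is unaffected by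
  the variation at times outside its support.\<close>

lemma lagrangian_cong_local:
  assumes "openin (top_of_set {0..T}) N" "t \<in> N" "\<And>s. s \<in> N \<Longrightarrow> z1 s = z2 s"
  shows "lagrangian z1 t = lagrangian z2 t"
proof -
  have "vector_derivative (snd c \<circ> (fst \<circ> z1)) (at t within {0..T})
      = vector_derivative (snd c \<circ> (fst \<circ> z2)) (at t within {0..T})"
    for c :: "('m, 'a) chart"
    by (rule vector_derivative_cong_local[OF assms(1,2)]) (simp add: assms(3))
  hence "velocity A {0..T} (fst \<circ> z1) t = velocity A {0..T} (fst \<circ> z2) t"
    unfolding velocity_def by (simp only: o_apply[of fst] assms(3)[OF assms(2)])
  thus ?thesis using assms(2,3) by (simp add: lagrangian_def)
qed

end

text \<open>The C^1 building block of both bump functions. At \<open>0\<close> the difference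
  quotient \<open>(max 0 h)\<^sup>2 / h\<close> equals \<open>max 0 h\<close>, which tends to
  \<open>0\<close>.\<close>

lemma has_real_derivative_max_0_power2:
  "((\<lambda>t::real. (max 0 t)\<^sup>2) has_real_derivative 2 * max 0 t) (at t)"
proof -
  consider "t > 0" | "t < 0" | "t = 0" by linarith
  thus ?thesis
  proof cases
    case 1
    have "((\<lambda>t::real. t\<^sup>2) has_real_derivative 2 * max 0 t) (at t)"
      using 1 by (auto intro!: derivative_eq_intros)
    thus ?thesis
      by (rule has_field_derivative_transform_within_open[of _ _ _ "{0<..}"]) (use 1 in auto)
  next
    case 2
    have "((\<lambda>t::real. 0) has_real_derivative 2 * max 0 t) (at t)"
      using 2 by simp
    thus ?thesis
      by (rule has_field_derivative_transform_within_open[of _ _ _ "{..<0}"]) (use 2 in auto)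
  next
    case 3
    have "((\<lambda>h::real. max 0 h) \<longlongrightarrow> 0) (at 0)"
      using tendsto_max[OF tendsto_const tendsto_ident_at, of 0 0 UNIV] by simp
    hence "((\<lambda>h::real. (max 0 h)\<^sup>2 / h) \<longlongrightarrow> 0) (at 0)"
      by (rule Lim_transform_eventually)
        (auto simp: eventually_at_filter max_def power2_eq_square)
    thus ?thesis using 3 by (simp add: DERIV_def)
  qed
qed

lemma has_real_derivative_max_0_power2_chain:
  assumes "(f has_real_derivative d) (at s)"
  shows "((\<lambda>s. (max 0 (f s))\<^sup>2) has_real_derivative 2 * max 0 (f s) * d) (at s)"
  using DERIV_chain2[OF has_real_derivative_max_0_power2 assms] .

context hamiltonian_system
begin

text \<open>The integrand of the first variation after integration by parts, in the direction
  \<open>w\<close>: \<open>fst w\<close> displaces q and \<open>snd w\<close> displaces p.\<close>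

definition euler_lagrange ::
  "('m, 'a) chart \<Rightarrow> (real \<Rightarrow> 'm \<times> ('m, 'a) covec) \<Rightarrow> 'a \<times> 'a \<Rightarrow> real \<Rightarrow> real" where
  "euler_lagrange c z w t = snd w \<bullet> fst (coord_deriv c z t) - snd (coord_deriv c z t) \<bullet> fst w
     - H_deriv c t (snd (cotangent_chart E A c) (z t)) w"

lemma H_deriv_along_line:
  assumes "c \<in> A" "t \<in> {0..T}" "y + \<epsilon> *\<^sub>R u \<in> snd (ct c) ` fst (ct c)"
  shows "((\<lambda>\<eta>. H_chart c (t, y + \<eta> *\<^sub>R u)) has_real_derivative H_deriv c t (y + \<epsilon> *\<^sub>R u) u) (at \<epsilon>)"
proof -
  have "((\<lambda>\<eta>. y + \<eta> *\<^sub>R u) has_vector_derivative u) (at \<epsilon>)"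
    by (auto intro!: derivative_eq_intros)
  from has_vector_derivative_chain[OF this H_deriv_has_derivative[OF assms]]
  show ?thesis by (simp add: has_real_derivative_iff_has_vector_derivative)
qed

lemma H_deriv_scale:
  assumes "c \<in> A" "t \<in> {0..T}" "y \<in> snd (ct c) ` fst (ct c)"
  shows "H_deriv c t y (s *\<^sub>R u) = s * H_deriv c t y u"
  using linear_scale[OF has_derivative_linear[OF H_deriv_has_derivative[OF assms]]] by simp

text \<open>Only the integral over \<open>{a..b}\<close> depends on \<epsilon>, and there everything
  happens in one chart, so Leibniz' rule applies. The term with \<phi>' comes from the velocity of
  the varied base curve.\<close>

lemma action_family_has_derivative:
  assumes var: "chart_variation (prod_basis E) B T z (ct c) {a..b} \<phi> \<phi>' w r"
    and c: "c \<in> A" and ab: "0 \<le> a" "a \<le> b" "b \<le> T"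
  shows "((\<lambda>\<epsilon>. action A T H (chart_variation.family z (ct c) {a..b} \<phi> w \<epsilon>)) has_real_derivative
      integral {a..b} (\<lambda>t. \<phi> t * (snd w \<bullet> fst (coord_deriv c z t)) +
        \<phi>' t * (snd (snd (ct c) (z t)) \<bullet> fst w) - \<phi> t * H_deriv c t (snd (ct c) (z t)) w)) (at 0)"
proof -
  interpret V: chart_variation "prod_basis E" B T z "ct c" "{a..b}" \<phi> \<phi>' w r by (rule var)
  let ?I = "{-r<..<r}" and ?V = "snd (ct c) ` fst (ct c)"
  let ?y = "\<lambda>t. snd (ct c) (z t)" and ?D = "coord_deriv c z"
  have U: "V.U = chart_times c z" by (simp add: V.U_def chart_times_def)
  have K: "t \<in> chart_times c z" "t \<in> {0..T}" if "t \<in> {a..b}" for t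
    using that V.K_subset_U U V.K_subset by auto
  have curve: "C1_curve B {0..T} (V.family \<epsilon>)" if "\<epsilon> \<in> ?I" for \<epsilon>
    using C1_family_curve[OF V.family_C1 that] .
  \<comment> \<open>\<open>L\<close> is the integrand written in the chart and \<open>L'\<close> its
    \<epsilon>-derivative: product rule on the pairing, chain rule on
    \<open>H_chart\<close>.\<close>
  define L where "L \<epsilon> t = (snd (?y t) + \<epsilon> *\<^sub>R \<phi> t *\<^sub>R snd w) \<bullet> (fst (?D t) + \<epsilon> *\<^sub>R \<phi>' t *\<^sub>R fst w)
      - H_chart c (t, ?y t + \<epsilon> *\<^sub>R \<phi> t *\<^sub>R w)" for \<epsilon> t
  define L' where "L' \<epsilon> t = (\<phi> t *\<^sub>R snd w) \<bullet> (fst (?D t) + \<epsilon> *\<^sub>R \<phi>' t *\<^sub>R fst w)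
      + (snd (?y t) + \<epsilon> *\<^sub>R \<phi> t *\<^sub>R snd w) \<bullet> (\<phi>' t *\<^sub>R fst w)
      - \<phi> t * H_deriv c t (?y t + \<epsilon> *\<^sub>R \<phi> t *\<^sub>R w) w" for \<epsilon> t
  have LK: "lagrangian (V.family \<epsilon>) t = L \<epsilon> t" if \<epsilon>: "\<epsilon> \<in> ?I" and t: "t \<in> {a..b}" for \<epsilon> t
  proof -
    have tU: "t \<in> V.U" using K(1)[OF t] U by simp
    have tZ: "t \<in> chart_times c (V.family \<epsilon>)"
      using K(2)[OF t] V.family_U(2)[OF \<epsilon> tU] unfolding chart_times_def by blast
    have "((\<lambda>s. ?y s + \<epsilon> *\<^sub>R \<phi> s *\<^sub>R w) has_vector_derivative ?D t + \<epsilon> *\<^sub>R \<phi>' t *\<^sub>R w) (at t within {0..T})"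
      using V.\<phi>_deriv[of t, THEN has_field_derivative_at_within, of "{0..T}"]
      by (auto intro!: derivative_eq_intros coord_deriv_has_derivative[OF V.curve c K(1)[OF t]]
          simp del: snd_cotangent_chart)
    hence "((\<lambda>s. snd (ct c) (V.family \<epsilon> s)) has_vector_derivative ?D t + \<epsilon> *\<^sub>R \<phi>' t *\<^sub>R w) (at t within {0..T})"
      by (subst has_vector_derivative_cong_local[OF V.openin_U tU V.family_U(3)[OF \<epsilon>]])
    from lagrangian_eq[OF curve[OF \<epsilon>] c tZ this] show ?thesis
      unfolding L_def V.family_U(3)[OF \<epsilon> tU] by simp
  qed
  have off: "lagrangian (V.family \<epsilon>) t = lagrangian z t" if t: "t \<in> {0..T}" "t \<notin> {a..b}" for \<epsilon> t
  proof (rule lagrangian_cong_local)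
    show "openin (top_of_set {0..T}) ({0..T} \<inter> - {a..b})" by (intro openin_open_Int) auto
  qed (use t V.family_off_K in auto)
  have intble: "lagrangian (V.family \<epsilon>) integrable_on {u..v}" if "\<epsilon> \<in> ?I" "{u..v} \<subseteq> {0..T}" for \<epsilon> u v
    by (rule integrable_continuous_real)
      (rule continuous_on_subset[OF lagrangian_continuous[OF curve[OF that(1)]] that(2)])
  have act: "action A T H (V.family \<epsilon>) =
      integral {0..a} (lagrangian z) + integral {a..b} (L \<epsilon>) + integral {b..T} (lagrangian z)"
    if \<epsilon>: "\<epsilon> \<in> ?I" for \<epsilon>
  proof -
    have "action A T H (V.family \<epsilon>) = integral {0..T} (lagrangian (V.family \<epsilon>))"
      unfolding action_def lagrangian_def ..
    also have "\<dots> = integral {0..a} (lagrangian (V.family \<epsilon>)) + integral {a..T} (lagrangian (V.family \<epsilon>))"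
      using ab intble[OF \<epsilon>] by (intro Henstock_Kurzweil_Integration.integral_combine[symmetric]) auto
    also have "integral {a..T} (lagrangian (V.family \<epsilon>)) =
        integral {a..b} (lagrangian (V.family \<epsilon>)) + integral {b..T} (lagrangian (V.family \<epsilon>))"
      using ab intble[OF \<epsilon>] by (intro Henstock_Kurzweil_Integration.integral_combine[symmetric]) auto
    \<comment> \<open>The end point \<open>a\<close> belongs to \<open>{a..b}\<close>, where
      \<open>off\<close> does not apply; a single point is negligible. The same happens at
      \<open>b\<close> below.\<close>
    also have "integral {0..a} (lagrangian (V.family \<epsilon>)) = integral {0..a} (lagrangian z)"
      by (rule integral_spike[of "{a}"]) (use off ab in auto)
    also have "integral {b..T} (lagrangian (V.family \<epsilon>)) = integral {b..T} (lagrangian z)"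
      by (rule integral_spike[of "{b}"]) (use off ab in auto)
    also have "integral {a..b} (lagrangian (V.family \<epsilon>)) = integral {a..b} (L \<epsilon>)"
      by (rule integral_cong) (rule LK[OF \<epsilon>])
    finally show ?thesis by simp
  qed
  have seg: "?y t + \<epsilon> *\<^sub>R \<phi> t *\<^sub>R w \<in> ?V" if "\<epsilon> \<in> ?I" "t \<in> {a..b}" for \<epsilon> t
    using V.segment that by blast
  have "((\<lambda>\<epsilon>. integral (cbox a b) (L \<epsilon>)) has_field_derivative integral (cbox a b) (L' 0)) (at 0 within ?I)"
  proof (rule leibniz_rule_field_derivative)
    fix \<epsilon> t assume \<epsilon>: "\<epsilon> \<in> ?I" and t: "t \<in> cbox a b"
    hence t': "t \<in> {a..b}" by simp
    have "((\<lambda>\<epsilon>. H_chart c (t, ?y t + \<epsilon> *\<^sub>R \<phi> t *\<^sub>R w)) has_real_derivative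
        \<phi> t * H_deriv c t (?y t + \<epsilon> *\<^sub>R \<phi> t *\<^sub>R w) w) (at \<epsilon> within ?I)"
      using H_deriv_along_line[OF c K(2)[OF t'] seg[OF \<epsilon> t']] H_deriv_scale[OF c K(2)[OF t'] seg[OF \<epsilon> t']]
      by (simp add: has_field_derivative_at_within del: snd_cotangent_chart)
    moreover have "((\<lambda>\<epsilon>. (p + \<epsilon> *\<^sub>R u) \<bullet> (q + \<epsilon> *\<^sub>R v)) has_real_derivative
        u \<bullet> (q + \<epsilon> *\<^sub>R v) + (p + \<epsilon> *\<^sub>R u) \<bullet> v) (at \<epsilon> within ?I)" for p u q v :: 'a
      unfolding has_field_derivative_def
      by (rule has_derivative_eq_rhs, (rule derivative_intros)+) (simp add: fun_eq_iff algebra_simps)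
    ultimately show "((\<lambda>\<epsilon>. L \<epsilon> t) has_field_derivative L' \<epsilon> t) (at \<epsilon> within ?I)"
      unfolding L_def L'_def by (intro DERIV_diff)
  next
    fix \<epsilon> assume \<epsilon>: "\<epsilon> \<in> ?I"
    have "L \<epsilon> integrable_on {a..b}"
      by (rule integrable_eq[OF intble[OF \<epsilon>]]) (use V.K_subset LK[OF \<epsilon>] in auto)
    thus "L \<epsilon> integrable_on cbox a b" by simp
  next
    have sub: "{a..b} \<subseteq> chart_times c z" using K(1) by blast
    have cp: "continuous_on (?I \<times> {a..b}) (\<lambda>p. g (snd p))" if "continuous_on {a..b} g"
      for g :: "real \<Rightarrow> 'b::topological_space"
      by (rule continuous_on_compose2[OF that]) (auto intro!: continuous_intros)
    note cy = cp[OF continuous_on_subset[OF coord_continuous[OF V.curve c] sub]]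
    note cD = cp[OF continuous_on_subset[OF coord_deriv_continuous[OF V.curve c] sub]]
    note c\<phi> = cp[OF V.\<phi>_continuous] cp[OF V.\<phi>'_continuous_on]
    have "continuous_on (?I \<times> {a..b}) (\<lambda>p. (snd p, ?y (snd p) + fst p *\<^sub>R \<phi> (snd p) *\<^sub>R w))"
      by (intro continuous_on_Pair continuous_on_add continuous_on_scaleR continuous_on_fst
          continuous_on_snd continuous_on_id continuous_on_const cy c\<phi>)
    from continuous_on_compose2[OF H_deriv_continuous[OF c, of w] this]
    have "continuous_on (?I \<times> {a..b})
        (\<lambda>p. H_deriv c (snd p) (?y (snd p) + fst p *\<^sub>R \<phi> (snd p) *\<^sub>R w) w)"
      unfolding fst_conv snd_conv by (rule meta_mp) (use K(2) seg in auto)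
    hence "continuous_on (?I \<times> {a..b}) (\<lambda>(\<epsilon>, t). L' \<epsilon> t)"
      unfolding L'_def case_prod_beta
      by (intro continuous_on_add continuous_on_diff continuous_on_mult continuous_on_scaleR continuous_on_inner
          continuous_on_fst continuous_on_snd continuous_on_id continuous_on_const cy cD c\<phi>)
    thus "continuous_on (?I \<times> cbox a b) (\<lambda>(\<epsilon>, t). L' \<epsilon> t)" by simp
  qed (use V.r in auto)
  hence "((\<lambda>\<epsilon>. integral {a..b} (L \<epsilon>)) has_field_derivative integral {a..b} (L' 0)) (at 0)"
    using V.r by (simp add: at_within_open[of 0 ?I])
  hence "((\<lambda>\<epsilon>. integral {0..a} (lagrangian z) + integral {a..b} (L \<epsilon>) + integral {b..T} (lagrangian z))
      has_field_derivative integral {a..b} (L' 0)) (at 0)"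
    by (auto intro!: derivative_eq_intros)
  hence "((\<lambda>\<epsilon>. action A T H (V.family \<epsilon>)) has_field_derivative integral {a..b} (L' 0)) (at 0)"
    by (rule has_field_derivative_transform_within_open[of _ _ _ ?I]) (use V.r act in auto)
  moreover have "L' 0 = (\<lambda>t. \<phi> t * (snd w \<bullet> fst (?D t)) + \<phi>' t * (snd (?y t) \<bullet> fst w) - \<phi> t * H_deriv c t (?y t) w)"
    by (simp add: L'_def fun_eq_iff)
  ultimately show ?thesis by simp
qed

subsection \<open>The Euler--Lagrange equations and the terminal condition\<close>

lemma euler_lagrange_continuous:
  assumes curve: "C1_curve B {0..T} z" and c: "c \<in> A"
  shows "continuous_on (chart_times c z) (euler_lagrange c z w)"
proof -
  have "continuous_on (chart_times c z) (\<lambda>t. (t, snd (ct c) (z t)))"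
    by (intro continuous_on_Pair continuous_on_id coord_continuous[OF curve c])
  from continuous_on_compose2[OF H_deriv_continuous[OF c, of w] this]
  have "continuous_on (chart_times c z) (\<lambda>t. H_deriv c t (snd (ct c) (z t)) w)"
    unfolding fst_conv snd_conv by (rule meta_mp) (auto simp: chart_times_def simp del: mem_cotangent_chart)
  thus ?thesis
    unfolding euler_lagrange_def
    by (intro continuous_on_diff continuous_on_inner continuous_on_fst continuous_on_snd
        continuous_on_const coord_deriv_continuous[OF curve c])
qed

lemma covector_field_carrier:
  assumes p1: "smooth_covector_field E A p1" and q: "q \<in> carrier_of A"
  shows "p1 q \<in> carrier_of B" "fst (p1 q) = q"
proof -
  have "continuous_map (atlas_topology A) (atlas_topology B) p1"
    using p1 unfolding smooth_covector_field_def smooth_map_def by blast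
  from continuous_map_funspace[OF this] q show "p1 q \<in> carrier_of B" by auto
  show "fst (p1 q) = q" using p1 q unfolding smooth_covector_field_def by blast
qed

text \<open>The d'Alembert principle tested against \<open>\<phi> w\<close> in the chart of \<open>c\<close>, after integrating
  \<open>\<phi>' \<langle>p, w\<rangle>\<close> by parts.\<close>

lemma weak_euler_lagrange:
  assumes z: "z \<in> C1_curves_from E A T q0" and p1: "smooth_covector_field E A p1"
    and dA: "free_boundary_dAlembert E A T H q0 p1 z"
    and c: "c \<in> A" and ab: "0 < a" "a \<le> b" "b \<le> T" and sub: "{a..b} \<subseteq> chart_times c z"
    and \<phi>: "\<And>t. (\<phi> has_real_derivative \<phi>' t) (at t)" and \<phi>': "continuous_on UNIV \<phi>'"
    and supp: "\<phi> a = 0" "\<And>t. t \<in> {0..T} \<Longrightarrow> t \<notin> {a..b} \<Longrightarrow> \<phi> t = 0" "b < T \<Longrightarrow> \<phi> b = 0"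
  shows "integral {a..b} (\<lambda>t. \<phi> t * euler_lagrange c z w t) =
    \<phi> T * ((momentum c (p1 (fst (z T))) - momentum c (z T)) \<bullet> fst w)"
proof -
  have curve: "C1_curve B {0..T} z" and z0: "fst (z 0) = q0"
    using z by (auto simp: C1_curves_from_def)
  let ?V = "snd (ct c) ` fst (ct c)" and ?y = "\<lambda>t. snd (ct c) (z t)" and ?D = "coord_deriv c z"
  have c\<phi>: "continuous_on S \<phi>" "continuous_on S \<phi>'" for S
    using DERIV_continuous_on[of S \<phi> \<phi>'] has_field_derivative_at_within[OF \<phi>]
      continuous_on_subset[OF \<phi>' subset_UNIV] by blast+
  have yV: "?y t \<in> ?V" if "t \<in> {a..b}" for t
    using sub that unfolding chart_times_def by blast
  \<comment> \<open>One \<epsilon>-range for the whole compact interval keeps the displaced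
    coordinates inside the open chart image.\<close>
  obtain r where r: "r > 0" "\<And>\<epsilon> t. \<epsilon> \<in> {-r<..<r} \<Longrightarrow> t \<in> {a..b} \<Longrightarrow> ?y t + \<epsilon> *\<^sub>R \<phi> t *\<^sub>R w \<in> ?V"
    using uniform_segment_in_open[OF compact_Icc
        continuous_on_subset[OF coord_continuous[OF curve c] sub]
        continuous_on_scaleR[OF c\<phi>(1) continuous_on_const] open_ct_image[OF c] yV] by metis
  have var: "chart_variation (prod_basis E) B T z (ct c) {a..b} \<phi> \<phi>' w r"
  proof (intro chart_variation.intro chart_variation_axioms.intro smooth_atlas_cotangent)
    show "z t \<in> fst (ct c)" if "t \<in> {a..b}" for t using sub that unfolding chart_times_def by blast
    show "continuous_on UNIV \<phi>'" by (rule \<phi>')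
    show "snd (ct c) (z t) + \<epsilon> *\<^sub>R \<phi> t *\<^sub>R w \<in> ?V" if "\<epsilon> \<in> {-r<..<r}" "t \<in> {a..b}" for \<epsilon> t
      using r(2) that by blast
  qed (use T_pos curve cotangent_chart_mem[OF c] ab \<phi> supp(2) r(1) in auto)
  interpret V: chart_variation "prod_basis E" B T z "ct c" "{a..b}" \<phi> \<phi>' w r by (rule var)
  have zT: "z T \<in> carrier_of B" and z0': "z 0 \<in> carrier_of B"
    using z_carrier[OF curve] T_pos by auto
  \<comment> \<open>As \<open>0 < a\<close>, time \<open>0\<close> lies outside the support and the
    field vanishes there. For the same reason every curve of the family below starts over
    \<open>q0\<close>.\<close>
  have "partial_variation E A T z V.field"
    unfolding partial_variation_def
    using V.field_C1 delta_q_zero[OF z0'] V.field_off_K[of 0] ab T_pos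
    by (auto simp: V.field_def)
  hence "has_action_variation E A T H q0 z V.field (pairing (p1 (fst (z T))) (delta_q E A (V.field T)))"
    using dA unfolding free_boundary_dAlembert_def by blast
  moreover have "variation_family E A T q0 z V.field V.family"
    unfolding variation_family_def C1_curves_from_def
    using V.r V.family_C1 C1_family_curve[OF V.family_C1] V.family_off_K[of 0] ab z0
    by (intro conjI exI[of _ r] ballI) (auto simp: V.family_0 V.velocity_family)
  ultimately have "((\<lambda>\<epsilon>. action A T H (V.family \<epsilon>)) has_real_derivative
      pairing (p1 (fst (z T))) (delta_q E A (V.field T))) (at 0)"
    unfolding has_action_variation_def by blast
  from DERIV_unique[OF this action_family_has_derivative[OF var c]] ab
  have eq: "pairing (p1 (fst (z T))) (delta_q E A (V.field T)) =
      integral {a..b} (\<lambda>t. \<phi> t * (snd w \<bullet> fst (?D t)) + \<phi>' t * (snd (?y t) \<bullet> fst w) - \<phi> t * H_deriv c t (?y t) w)"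
    by simp
  have qT: "fst (z T) \<in> carrier_of A" using zT by (simp add: carrier_cotangent_iff)
  note p1T = covector_field_carrier[OF p1 qT]
  \<comment> \<open>If \<open>T\<close> is outside \<open>{a..b}\<close>, the final point may leave
    the chart \<open>c\<close>, but then \<open>\<phi> T = 0\<close> and both sides vanish.\<close>
  have endpoint: "pairing (p1 (fst (z T))) (delta_q E A (V.field T)) = \<phi> T * (momentum c (p1 (fst (z T))) \<bullet> fst w)"
  proof (cases "T \<in> {a..b}")
    case True
    hence zc: "fst (z T) \<in> fst c" using sub chart_times_iff[OF curve] by blast
    have "T \<in> V.U" using True V.K_subset_U by blast
    hence "delta_q E A (V.field T) = (fst (z T), chart_vector A c (fst (z T)) (\<phi> T *\<^sub>R fst w))"
      using delta_q_chart_vector[OF zT c zc, of "\<phi> T *\<^sub>R w"] by (simp add: V.field_U)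
    thus ?thesis
      using pairing_chart_vector[OF p1T(1) c, unfolded p1T(2), OF zc] by simp
  next
    case False
    obtain d where d: "d \<in> A" "fst (z T) \<in> fst d" using zT by (rule carrier_cotangentE)
    have "delta_q E A (V.field T) = (fst (z T), chart_vector A d (fst (z T)) 0)"
      using False T_pos V.field_off_K[of T] delta_q_zero[OF zT] by (simp add: chart_vector_0[OF d])
    thus ?thesis
      using pairing_chart_vector[OF p1T(1) d(1), unfolded p1T(2), OF d(2)] supp(2)[OF _ False] T_pos by simp
  qed
  \<comment> \<open>Either \<open>b = T\<close>, or both \<open>\<phi> b\<close> and
    \<open>\<phi> T\<close> are zero. This lets the boundary term be written at \<open>T\<close> in
    both uses.\<close>
  have \<phi>b: "\<phi> b * x = \<phi> T * x'" if "b = T \<Longrightarrow> x = x'" for x x'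
    using supp ab T_pos that by (cases "b = T") auto
  have "((\<lambda>t. \<phi>' t * (snd (?y t) \<bullet> fst w) + \<phi> t * (snd (?D t) \<bullet> fst w)) has_integral
      \<phi> b * (snd (?y b) \<bullet> fst w) - \<phi> a * (snd (?y a) \<bullet> fst w)) {a..b}"
  proof (rule fundamental_theorem_of_calculus)
    fix t assume t: "t \<in> {a..b}"
    have "(?y has_vector_derivative ?D t) (at t within {a..b})"
      using coord_deriv_has_derivative[OF curve c] sub t ab
      by (meson V.K_subset has_vector_derivative_within_subset subsetD)
    hence "((\<lambda>t. snd (?y t) \<bullet> fst w) has_vector_derivative snd (?D t) \<bullet> fst w) (at t within {a..b})"
      by (rule has_vector_derivative_chain) (auto intro!: derivative_eq_intros)
    from has_vector_derivative_mult[OF V.\<phi>_vector_deriv[of t "{a..b}"] this]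
    show "((\<lambda>t. \<phi> t * (snd (?y t) \<bullet> fst w)) has_vector_derivative
        \<phi>' t * (snd (?y t) \<bullet> fst w) + \<phi> t * (snd (?D t) \<bullet> fst w)) (at t within {a..b})"
      by (simp add: add.commute del: snd_cotangent_chart)
  qed (use ab in simp)
  hence parts: "((\<lambda>t. \<phi>' t * (snd (?y t) \<bullet> fst w) + \<phi> t * (snd (?D t) \<bullet> fst w)) has_integral
      \<phi> T * (momentum c (z T) \<bullet> fst w)) {a..b}"
    using supp(1) \<phi>b[of "snd (?y b) \<bullet> fst w" "snd (?y T) \<bullet> fst w"] by simp
  have EL: "continuous_on {a..b} (\<lambda>t. \<phi> t * euler_lagrange c z w t)"
    by (intro continuous_on_mult c\<phi> continuous_on_subset[OF euler_lagrange_continuous[OF curve c] sub])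
  \<comment> \<open>Adding the exact derivative of \<open>\<phi> \<langle>p, fst w\<rangle>\<close>
    back to the Euler-Lagrange term cancels the term with the derivative of p and restores the
    first-variation integrand.\<close>
  have "((\<lambda>t. \<phi> t * euler_lagrange c z w t + (\<phi>' t * (snd (?y t) \<bullet> fst w) + \<phi> t * (snd (?D t) \<bullet> fst w)))
      has_integral integral {a..b} (\<lambda>t. \<phi> t * euler_lagrange c z w t) + \<phi> T * (momentum c (z T) \<bullet> fst w)) {a..b}"
    by (intro has_integral_add parts integrable_integral integrable_continuous_real EL)
  also have "(\<lambda>t. \<phi> t * euler_lagrange c z w t + (\<phi>' t * (snd (?y t) \<bullet> fst w) + \<phi> t * (snd (?D t) \<bullet> fst w)))
      = (\<lambda>t. \<phi> t * (snd w \<bullet> fst (?D t)) + \<phi>' t * (snd (?y t) \<bullet> fst w) - \<phi> t * H_deriv c t (?y t) w)"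
    by (simp add: euler_lagrange_def algebra_simps fun_eq_iff)
  finally show ?thesis
    using eq endpoint by (simp add: integral_unique inner_diff_left right_diff_distrib del: snd_cotangent_chart)
qed

context
  fixes z :: "real \<Rightarrow> 'm \<times> ('m, 'a) covec" and q0 :: 'm and p1 :: "'m \<Rightarrow> 'm \<times> ('m, 'a) covec"
  assumes z: "z \<in> C1_curves_from E A T q0" and p1: "smooth_covector_field E A p1"
    and dA: "free_boundary_dAlembert E A T H q0 p1 z"
begin

lemma curve_z: "C1_curve B {0..T} z"
  using z by (simp add: C1_curves_from_def)

text \<open>The fundamental lemma of the calculus of variations: a nonzero value would keep its sign
  nearby, and a nonnegative bump supported there would have a nonzero weighted integral.\<close>

lemma euler_lagrange_zero:
  assumes c: "c \<in> A" and t: "t \<in> {0<..<T}" "t \<in> chart_times c z"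
  shows "euler_lagrange c z w t = 0"
proof (rule ccontr)
  let ?f = "euler_lagrange c z w"
  assume ne: "?f t \<noteq> 0"
  \<comment> \<open>Multiplying by the constant \<open>?f t\<close> turns "same sign as at t" into
    positivity and avoids a case distinction.\<close>
  have "continuous_on (chart_times c z) (\<lambda>s. ?f s * ?f t)"
    by (intro continuous_intros euler_lagrange_continuous[OF curve_z c])
  from continuous_openin_preimage_gen[OF this open_greaterThan[of 0]]
  have "openin (top_of_set {0..T}) (chart_times c z \<inter> (\<lambda>s. ?f s * ?f t) -` {0<..})"
    using openin_chart_times[OF curve_z c] by (rule openin_trans)
  moreover have "?f t * ?f t > 0" using ne by (simp add: zero_less_mult_iff) linarith
  ultimately obtain e where e: "e > 0"
    "\<And>s. s \<in> {0..T} \<Longrightarrow> dist s t < e \<Longrightarrow> s \<in> chart_times c z \<and> ?f s * ?f t > 0"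
    using t(2) unfolding openin_euclidean_subtopology_iff by (metis (no_types, lifting) IntD1 IntD2 IntI greaterThan_iff vimage_eq)
  \<comment> \<open>The halves keep the closed interval around t strictly inside
    \<open>(0, T)\<close> and inside the neighbourhood of radius \<open>e\<close>.\<close>
  define \<delta> where "\<delta> = min (e / 2) (min (t / 2) ((T - t) / 2))"
  define a b where "a = t - \<delta>" and "b = t + \<delta>"
  have "\<delta> > 0" "\<delta> \<le> e / 2" "\<delta> \<le> t / 2" "\<delta> \<le> (T - t) / 2"
    using e(1) t(1) unfolding \<delta>_def by (auto simp: min_def)
  hence \<delta>: "\<delta> > 0" "\<delta> < e" "\<delta> < t" "\<delta> < T - t" using e(1) t(1) by auto
  hence ab: "0 < a" "a \<le> b" "a < b" "b < T" by (auto simp: a_def b_def)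
  have near: "s \<in> chart_times c z" "?f s * ?f t > 0" if "s \<in> {a..b}" for s
    using e(2)[of s] that ab \<delta> by (auto simp: a_def b_def dist_real_def)
  define \<phi> where "\<phi> s = (max 0 (s - a))\<^sup>2 * (max 0 (b - s))\<^sup>2" for s
  define \<phi>' where "\<phi>' s = 2 * max 0 (s - a) * (max 0 (b - s))\<^sup>2 - (max 0 (s - a))\<^sup>2 * (2 * max 0 (b - s))" for s
  have d\<phi>: "(\<phi> has_real_derivative \<phi>' s) (at s)" for s
  proof -
    have "((\<lambda>s. (max 0 (s - a))\<^sup>2) has_real_derivative 2 * max 0 (s - a)) (at s)"
      using has_real_derivative_max_0_power2_chain[of "\<lambda>s. s - a" 1 s]
      by (simp add: DERIV_cong[OF DERIV_diff[OF DERIV_ident DERIV_const]])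
    moreover have "((\<lambda>s. (max 0 (b - s))\<^sup>2) has_real_derivative - (2 * max 0 (b - s))) (at s)"
      using has_real_derivative_max_0_power2_chain[of "\<lambda>s. b - s" "-1" s]
      by (simp add: DERIV_cong[OF DERIV_diff[OF DERIV_const DERIV_ident]])
    ultimately show ?thesis
      unfolding \<phi>_def by (rule DERIV_cong[OF DERIV_mult]) (simp add: \<phi>'_def)
  qed
  have c\<phi>: "continuous_on S \<phi>" for S
    unfolding \<phi>_def by (intro continuous_intros)
  have sub: "{a..b} \<subseteq> chart_times c z" using near(1) by blast
  have "integral {a..b} (\<lambda>s. \<phi> s * ?f s) = \<phi> T * ((momentum c (p1 (fst (z T))) - momentum c (z T)) \<bullet> fst w)"
  proof (rule weak_euler_lagrange[OF z p1 dA c ab(1,2) _ sub d\<phi>])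
    show "continuous_on UNIV \<phi>'" unfolding \<phi>'_def by (intro continuous_intros)
  qed (use ab in \<open>auto simp: \<phi>_def\<close>)
  also have "\<phi> T = 0" using ab by (simp add: \<phi>_def)
  finally have "integral {a..b} (\<lambda>s. \<phi> s * ?f s * ?f t) = 0" by simp
  moreover have "continuous_on {a..b} (\<lambda>s. \<phi> s * ?f s * ?f t)"
    by (intro continuous_intros c\<phi> continuous_on_subset[OF euler_lagrange_continuous[OF curve_z c] sub])
  moreover have "\<phi> s * ?f s * ?f t \<ge> 0" if "s \<in> {a..b}" for s
    using near(2)[OF that] by (simp add: \<phi>_def mult.assoc)
  \<comment> \<open>A continuous nonnegative function with zero integral vanishes everywhere; at the
    centre the bump has the value \<open>\<delta> ^ 4 > 0\<close>.\<close>
  ultimately have "\<phi> t * ?f t * ?f t = 0"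
    using integral_eq_0_iff[of a b "\<lambda>s. \<phi> s * ?f s * ?f t"] ab \<delta> by (auto simp: a_def b_def)
  thus False using ne \<delta> by (simp add: \<phi>_def a_def b_def)
qed

lemma terminal_momentum: "z T = p1 (fst (z T))"
proof -
  have zT: "z T \<in> carrier_of B" using z_carrier[OF curve_z] T_pos by simp
  hence qT: "fst (z T) \<in> carrier_of A" by (simp add: carrier_cotangent_iff)
  note p1T = covector_field_carrier[OF p1 qT]
  obtain c where c: "c \<in> A" "T \<in> chart_times c z"
    using chart_times_cover[OF curve_z, of T] T_pos by auto
  obtain e where e: "e > 0" "\<And>s. s \<in> {0..T} \<Longrightarrow> dist s T < e \<Longrightarrow> s \<in> chart_times c z"
    using openin_chart_times[OF curve_z c(1)] c(2) unfolding openin_euclidean_subtopology_iff by blast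
  \<comment> \<open>A one-sided bump on \<open>{a..T}\<close> is nonzero at \<open>T\<close>; the
    halves keep \<open>a\<close> positive and within the chart neighbourhood.\<close>
  define a where "a = T - min (e / 2) (T / 2)"
  have a: "0 < a" "a < T" "T - a < e" using e(1) T_pos by (auto simp: a_def)
  have sub: "{a..T} \<subseteq> chart_times c z" using e(2) a by (auto simp: dist_real_def)
  have "(momentum c (p1 (fst (z T))) - momentum c (z T)) \<bullet> v = 0" for v
  proof -
    let ?\<phi> = "\<lambda>s. (max 0 (s - a))\<^sup>2" and ?f = "euler_lagrange c z (v, 0)"
    have "integral {a..T} (\<lambda>s. ?\<phi> s * ?f s) =
        ?\<phi> T * ((momentum c (p1 (fst (z T))) - momentum c (z T)) \<bullet> fst (v, 0::'a))"
    proof (rule weak_euler_lagrange[where \<phi> = ?\<phi> and \<phi>' = "\<lambda>s. 2 * max 0 (s - a)", OF z p1 dA c(1) a(1) _ order_refl sub])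
      show "(?\<phi> has_real_derivative 2 * max 0 (s - a)) (at s)" for s
        using has_real_derivative_max_0_power2_chain[of "\<lambda>s. s - a" 1 s]
        by (simp add: DERIV_cong[OF DERIV_diff[OF DERIV_ident DERIV_const]])
      show "continuous_on UNIV (\<lambda>s. 2 * max 0 (s - a))" by (intro continuous_intros)
    qed (use a in auto)
    \<comment> \<open>The Euler-Lagrange expression is known to vanish only before \<open>T\<close>;
      the single point \<open>T\<close> is discarded as negligible.\<close>
    moreover have "integral {a..T} (\<lambda>s. ?\<phi> s * ?f s) = integral {a..T} (\<lambda>s. 0)"
      by (rule integral_spike[of "{T}"]) (use euler_lagrange_zero[OF c(1)] sub a in auto)
    ultimately show ?thesis using a by simp
  qed
  \<comment> \<open>Testing with the momentum difference itself makes its squared norm zero.\<close>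
  from this[of "momentum c (p1 (fst (z T))) - momentum c (z T)"]
  have "momentum c (p1 (fst (z T))) = momentum c (z T)" by simp
  moreover have "fst (z T) \<in> fst c" using c(2) chart_times_iff[OF curve_z] by simp
  ultimately show ?thesis
    using inj_onD[OF inj_cotangent_chart[OF c(1)], of "z T" "p1 (fst (z T))"]
      mem_cotangent_chartI[OF zT] mem_cotangent_chartI[OF p1T(1)] p1T(2) by simp
qed

text \<open>The Euler-Lagrange identity in the directions \<open>(0, e)\<close> and
  \<open>(e, 0)\<close> identifies the partial derivatives of the Hamiltonian with the components of
  the coordinate velocity; summing over the orthonormal basis recovers the vectors.\<close>

lemma hamilton_equations:
  assumes c: "c \<in> A" and t: "t \<in> {0<..<T}" "fst (z t) \<in> fst c"
  shows "((\<lambda>s. fst (snd (ct c) (z s))) has_vector_derivative D_p E A c (H t) (z t)) (at t)"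
    and "((\<lambda>s. snd (snd (ct c) (z s))) has_vector_derivative - D_q E A c (H t) (z t)) (at t)"
proof -
  let ?x = "snd c (fst (z t))" and ?\<xi> = "momentum c (z t)" and ?D = "coord_deriv c z t"
  have tc: "t \<in> chart_times c z" using t chart_times_iff[OF curve_z] by auto
  have tT: "t \<in> {0..T}" using t by simp
  \<comment> \<open>The zero displacement matches \<open>H_deriv_along_line\<close> at \<epsilon> =
    0, which links \<open>H_deriv\<close> to the one-variable \<open>deriv\<close> in
    \<open>D_p\<close> and \<open>D_q\<close>.\<close>
  have yV: "(?x, ?\<xi>) + 0 *\<^sub>R u \<in> snd (ct c) ` fst (ct c)" for u
    using tc unfolding chart_times_def by (auto intro!: image_eqI[of _ _ "z t"])
  note line = DERIV_imp_deriv[OF H_deriv_along_line[OF c tT yV]]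
  have q: "H_deriv c t (?x, ?\<xi>) (e, 0) = deriv (\<lambda>s. H t (chart_inv (ct c) (?x + s *\<^sub>R e, ?\<xi>))) 0" for e
    using line[of "(e, 0)"] by (simp add: H_chart_def)
  have p: "H_deriv c t (?x, ?\<xi>) (0, e) = deriv (\<lambda>s. H t (chart_inv (ct c) (?x, ?\<xi> + s *\<^sub>R e))) 0" for e
    using line[of "(0, e)"] by (simp add: H_chart_def)
  have "D_p E A c (H t) (z t) = (\<Sum>e\<in>E. (fst ?D \<bullet> e) *\<^sub>R e)"
    using euler_lagrange_zero[OF c t(1) tc, of "(0, _)"]
    by (simp add: D_p_def p[symmetric] euler_lagrange_def inner_commute)
  hence Dp: "D_p E A c (H t) (z t) = fst ?D" by (simp add: orthonormal_basis_expansion[OF basis])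
  have "H_deriv c t (?x, ?\<xi>) (e, 0) = (- snd ?D) \<bullet> e" for e
    using euler_lagrange_zero[OF c t(1) tc, of "(e, 0)"] by (simp add: euler_lagrange_def)
  hence "D_q E A c (H t) (z t) = (\<Sum>e\<in>E. ((- snd ?D) \<bullet> e) *\<^sub>R e)"
    by (simp add: D_q_def q[symmetric])
  hence Dq: "- D_q E A c (H t) (z t) = snd ?D"
    by (simp only: orthonormal_basis_expansion[OF basis] minus_minus)
  \<comment> \<open>At an interior time the derivative within \<open>{0..T}\<close> is the two-sided
    one.\<close>
  have "((\<lambda>s. snd (ct c) (z s)) has_vector_derivative ?D) (at t)"
    using coord_deriv_has_derivative[OF curve_z c tc] t(1) by (simp add: at_within_Icc_at)
  from has_vector_derivative_chain[OF this has_derivative_fst[OF has_derivative_ident]]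
    has_vector_derivative_chain[OF this has_derivative_snd[OF has_derivative_ident]]
  show "((\<lambda>s. fst (snd (ct c) (z s))) has_vector_derivative D_p E A c (H t) (z t)) (at t)"
    "((\<lambda>s. snd (snd (ct c) (z s))) has_vector_derivative - D_q E A c (H t) (z t)) (at t)"
    unfolding Dp Dq .
qed

end

end

theorem proposition2p4:
  fixes E :: "'a::real_inner set"
    and A :: "('m, 'a) chart set"
    and T :: real
    and H :: "real \<Rightarrow> 'm \<times> ('m, 'a) covec \<Rightarrow> real"
    and q0 :: 'm
    and p1 :: "'m \<Rightarrow> 'm \<times> ('m, 'a) covec"
    and z :: "real \<Rightarrow> 'm \<times> ('m, 'a) covec"
  assumes "smooth_manifold E A"
    and "T > 0"
    and "smooth_time_dependent {0..T} (cotangent_atlas E A) H"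
    and "q0 \<in> carrier_of A"
    and "smooth_covector_field E A p1"
    and "z \<in> C1_curves_from E A T q0"
    and "free_boundary_dAlembert E A T H q0 p1 z"
  shows "(\<forall>c\<in>A. \<forall>t\<in>{0<..<T}. fst (z t) \<in> fst c \<longrightarrow>
            ((\<lambda>s. fst (snd (cotangent_chart E A c) (z s)))
               has_vector_derivative D_p E A c (H t) (z t)) (at t) \<and>
            ((\<lambda>s. snd (snd (cotangent_chart E A c) (z s)))
               has_vector_derivative - D_q E A c (H t) (z t)) (at t)) \<and>
         fst (z 0) = q0 \<and>
         z T = p1 (fst (z T))"
proof -
  interpret hamiltonian_system E A T H
    using assms(1-3) smooth_manifold_imp_smooth_atlas
    by (intro hamiltonian_system.intro hamiltonian_system_axioms.intro)
  show ?thesis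
    using hamilton_equations[OF assms(6,5,7)] terminal_momentum[OF assms(6,5,7)] assms(6)
    by (simp add: C1_curves_from_def del: snd_cotangent_chart)
qed

end
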